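(* Let $M$ be a complete $C^1$ Finsler manifold modeled on a Banach space that admits a $C^1$ Lipschitz bump function, and let $H_1,H_2:[0,\infty)\times M\times\mathbb{R}\to\mathbb{R}$ be two continuous functions satisfying condition (A) (defined in the context) with $H_1\le H_2$. Let $h_1,h_2:M\to\mathbb{R}$ be bounded and continuous with $h_2\le h_1$. Let $v:[0,\infty)\times M\to\mathbb{R}$ be a viscosity supersolution of $v_t+H_1(t,x,\|v_x\|_x)=0$ $(t>0)$ with initial condition $v(0,x)=h_1(x)$, and let $u:[0,\infty)\times M\to\mathbb{R}$ be a viscosity subsolution of $u_t+H_2(t,x,\|u_x\|_x)=0$ $(t>0)$ with initial condition $u(0,x)=h_2(x)$. Assume that for every $T>0$ the functions $u$ and $v$ are bounded in $[0,T)\times M$, and that for every $(t,x)\in(0,\infty)\times M$ either $u$ or $v$ is Lipschitz in a neighborhood of $(t,x)$. Then $$\sup_{[0,\infty)\times M}(u-v)\le\sup_{[0,\infty)\times M\times\mathbb{R}}(H_2-H_1)+\sup_M(h_2-h_1).$$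
   Context: $C^1$ Finsler manifold (in the sense of Palais): a connected, paracompact $C^1$ Banach manifold $M$ modeled on a Banach space $(X,\|\cdot\|)$, with a continuous map $\|\cdot\|_M:TM\to[0,\infty)$ such that: (P1) for every $x\in M$ the restriction $\|\cdot\|_x$ of $\|\cdot\|_M$ to $T_xM$ is a norm such that for every chart $\varphi:U\to X$ with $x\in U$, the norm $v\in X\mapsto\|d\varphi^{-1}(\varphi(x))(v)\|_x$ is equivalent to $\|\cdot\|$; (P2) for every $x_0\in M$, $\varepsilon>0$ and chart $\varphi:U\to X$ with $x_0\in U$ there is an open neighborhood $W$ of $x_0$ such that for all $x\in W$, $v\in X$, $\frac{1}{1+\varepsilon}\|d\varphi^{-1}(\varphi(x_0))(v)\|_{x_0}\le\|d\varphi^{-1}(\varphi(x))(v)\|_x\le(1+\varepsilon)\|d\varphi^{-1}(\varphi(x_0))(v)\|_{x_0}$. Finsler metric: $d(p,q)$ is the infimum of the lengths $\ell(c)=\int_a^b\|c'(t)\|_{c(t)}\,dt$ over piecewise $C^1$ paths $c:[a,b]\to M$ connecting $p$ to $q$. $M$ is complete if $(M,d)$ is complete. On $[0,\infty)\times M$, Lipschitz is with respect to $|t-s|+d(x,y)$. $C^1$ Lipschitz bump function on $X$: a $C^1$, Lipschitz function $b:X\to\mathbb{R}$ with bounded, non-empty support. Sub/superdifferential: for $(t,x)\in(0,\infty)\times M$, $D^-u(t,x)$ (resp. $D^+u(t,x)$) is the set of pairs $(\alpha,\Delta)\in\mathbb{R}\times T_xM^*$ representing $dg(t,x)$ (i.e.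 $\alpha=g_t(t,x)$, $\Delta=g_x(t,x)$), where $g:(0,\infty)\times M\to\mathbb{R}$ is $C^1$ and $u-g$ attains a local minimum (resp. local maximum) at $(t,x)$. For $\xi\in T_xM^*$, $\|\xi\|_x$ denotes the dual norm $\sup\{|\xi(v)|:v\in T_xM,\ \|v\|_x=1\}$. For continuous $H$ and bounded continuous $h$, a viscosity subsolution of $u_t+H(t,x,\|u_x\|_x)=0$ $(t>0)$ with initial condition $u(0,x)=h(x)$ is an upper semicontinuous $u:[0,\infty)\times M\to\mathbb{R}$ with $\alpha+H(t,x,\|\Delta\|_x)\le0$ for every $(t,x)\in(0,\infty)\times M$ and $(\alpha,\Delta)\in D^+u(t,x)$, and $u(0,x)\le h(x)$ for every $x\in M$. A viscosity supersolution is a lower semicontinuous $u$ with $\alpha+H(t,x,\|\Delta\|_x)\ge0$ for every $(t,x)\in(0,\infty)\times M$ and $(\alpha,\Delta)\in D^-u(t,x)$, and $u(0,x)\ge h(x)$ for every $x\in M$. Condition (A) for $H$: there are a constant $C\ge0$ and a continuous function $\omega:[0,\infty)\times\mathbb{R}\times\mathbb{R}\to\mathbb{R}$ with $\omega(0,0,0)=0$ such that for all $t_1,t_2\in[0,\infty)$, $x_1,x_2\in M$, $r_1,r_2\in\mathbb{R}$, $|H(t_1,x_1,r_1)-H(t_2,x_2,r_2)|\le\omega(|t_1-t_2|,d(x_1,x_2),r_1-r_2)+C\max\{|r_1|,|r_2|\}(|t_1-t_2|+d(x_1,x_2))$. Suprema are taken in the extended reals. *)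

theory Defs
  imports "HOL-Analysis.Analysis"
begin

section \<open>Maps of class C1 between normed spaces\<close>

text \<open>Only used for open sets S; continuity of the derivative is with respect to the operator norm.\<close>

definition C1_on :: "('a::real_normed_vector \<Rightarrow> 'b::real_normed_vector) \<Rightarrow> 'a set \<Rightarrow> bool" where
  "C1_on f S \<longleftrightarrow>
     (\<exists>f' :: 'a \<Rightarrow> 'a \<Rightarrow>\<^sub>L 'b.
        (\<forall>x\<in>S. (f has_derivative blinfun_apply (f' x)) (at x)) \<and> continuous_on S f')"

definition C1_Lipschitz_bump :: "('b::real_normed_vector \<Rightarrow> real) \<Rightarrow> bool" where
  "C1_Lipschitz_bump b \<longleftrightarrow>
     C1_on b UNIV \<and> (\<exists>L. L-lipschitz_on UNIV b) \<and>
     bounded (closure (support_on UNIV b)) \<and> support_on UNIV b \<noteq> {}"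


section \<open>C1 Banach manifolds\<close>

text \<open>A chart is a domain together with a coordinate map; the values of the coordinate map
  outside the domain are irrelevant.\<close>

type_synonym ('m, 'b) chart = "'m set \<times> ('m \<Rightarrow> 'b)"

definition chart_inv :: "('m, 'b) chart \<Rightarrow> 'b \<Rightarrow> 'm" where
  "chart_inv c = inv_into (fst c) (snd c)"

definition is_chart :: "('m::topological_space, 'b::real_normed_vector) chart \<Rightarrow> bool" where
  "is_chart c \<longleftrightarrow> open (fst c) \<and> open (snd c ` fst c) \<and>
     homeomorphism (fst c) (snd c ` fst c) (snd c) (chart_inv c)"

definition transition :: "('m, 'b) chart \<Rightarrow> ('m, 'b) chart \<Rightarrow> 'b \<Rightarrow> 'b" where
  "transition c c' = snd c' \<circ> chart_inv c"

definition C1_compatible ::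
  "('m, 'b::real_normed_vector) chart \<Rightarrow> ('m, 'b) chart \<Rightarrow> bool" where
  "C1_compatible c c' \<longleftrightarrow>
     C1_on (transition c c') (snd c ` (fst c \<inter> fst c')) \<and>
     C1_on (transition c' c) (snd c' ` (fst c \<inter> fst c'))"

text \<open>A C1 structure is a maximal C1 atlas, so that ``every chart'' of the manifold means
  ``every element of the atlas''.\<close>

definition C1_structure :: "('m::topological_space, 'b::real_normed_vector) chart set \<Rightarrow> bool" where
  "C1_structure A \<longleftrightarrow>
     (\<forall>c\<in>A. is_chart c) \<and> (\<Union>c\<in>A. fst c) = UNIV \<and>
     (\<forall>c\<in>A. \<forall>c'\<in>A. C1_compatible c c') \<and>
     (\<forall>c. is_chart c \<and> (\<forall>c'\<in>A. C1_compatible c c') \<longrightarrow> c \<in> A)"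

text \<open>The Hausdorff property, usually part of paracompactness, is provided by the class t2-space.\<close>

definition paracompact_type :: "'m::t2_space itself \<Rightarrow> bool" where
  "paracompact_type _ \<longleftrightarrow>
     (\<forall>\<U> :: 'm set set. (\<forall>U\<in>\<U>. open U) \<and> \<Union>\<U> = UNIV \<longrightarrow>
        (\<exists>\<V>. (\<forall>V\<in>\<V>. open V \<and> (\<exists>U\<in>\<U>. V \<subseteq> U)) \<and> \<Union>\<V> = UNIV \<and>
             locally_finite_in euclidean \<V>))"


section \<open>Tangent and cotangent spaces\<close>

text \<open>A tangent vector at x is the family of its coordinates in all charts around x, these being
  related by the derivatives of the coordinate changes. The value is set to 0 on everything that
  is not a chart around x, so that the vector space operations are the pointwise ones.\<close>

type_synonym ('m, 'b) tangent = "('m, 'b) chart \<Rightarrow> 'b"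

definition charts_at :: "('m, 'b) chart set \<Rightarrow> 'm \<Rightarrow> ('m, 'b) chart set" where
  "charts_at A x = {c \<in> A. x \<in> fst c}"

definition tangent_space ::
  "('m, 'b::real_normed_vector) chart set \<Rightarrow> 'm \<Rightarrow> ('m, 'b) tangent set" where
  "tangent_space A x =
     {\<xi>. (\<forall>c\<in>charts_at A x. \<forall>c'\<in>charts_at A x.
            \<xi> c' = frechet_derivative (transition c c') (at (snd c x)) (\<xi> c)) \<and>
         (\<forall>c. c \<notin> charts_at A x \<longrightarrow> \<xi> c = 0)}"

text \<open>The tangent vector at x with coordinates v in the chart c, that is, the image of v under
  the differential of the inverse of c at c(x).\<close>

definition tangent_of ::
  "('m, 'b::real_normed_vector) chart set \<Rightarrow> ('m, 'b) chart \<Rightarrow> 'm \<Rightarrow> 'b \<Rightarrow> ('m, 'b) tangent" where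
  "tangent_of A c x v =
     (\<lambda>c'. if c' \<in> charts_at A x
           then frechet_derivative (transition c c') (at (snd c x)) v else 0)"

definition tangent_bundle ::
  "('m, 'b::real_normed_vector) chart set \<Rightarrow> ('m \<times> ('m, 'b) tangent) set" where
  "tangent_bundle A = Sigma UNIV (tangent_space A)"

text \<open>The topology for which every chart (U, c) of the manifold identifies the part of the tangent
  bundle over U with the open subset c(U) \<open>\<times>\<close> X of X \<open>\<times>\<close> X.\<close>

definition tangent_bundle_topology ::
  "('m, 'b::real_normed_vector) chart set \<Rightarrow> ('m \<times> ('m, 'b) tangent) topology" where
  "tangent_bundle_topology A = topology (\<lambda>W. W \<subseteq> tangent_bundle A \<and>
     (\<forall>c\<in>A. open {(y, v). y \<in> snd c ` fst c \<and>
                        (chart_inv c y, tangent_of A c (chart_inv c y) v) \<in> W}))"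

text \<open>Continuous linear functionals on the tangent space at x, with value undefined off it.\<close>

definition cotangent_space ::
  "('m, 'b::real_normed_vector) chart set \<Rightarrow> 'm \<Rightarrow> (('m, 'b) tangent \<Rightarrow> real) set" where
  "cotangent_space A x =
     {\<Delta> \<in> extensional (tangent_space A x).
        \<forall>c\<in>charts_at A x. bounded_linear (\<lambda>v. \<Delta> (tangent_of A c x v))}"


section \<open>C1 Finsler manifolds\<close>

text \<open>The function F, which plays the role of the Finsler structure, takes a base point x and a
  tangent vector at x; its values elsewhere are irrelevant.\<close>

definition norm_on_tangent_space ::
  "('m, 'b::real_normed_vector) chart set \<Rightarrow> 'm \<Rightarrow> (('m, 'b) tangent \<Rightarrow> real) \<Rightarrow> bool" where
  "norm_on_tangent_space A x N \<longleftrightarrow>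
     (\<forall>\<xi>\<in>tangent_space A x. 0 \<le> N \<xi> \<and> (N \<xi> = 0 \<longleftrightarrow> \<xi> = (\<lambda>_. 0))) \<and>
     (\<forall>\<xi>\<in>tangent_space A x. \<forall>r. N (\<lambda>c. r *\<^sub>R \<xi> c) = \<bar>r\<bar> * N \<xi>) \<and>
     (\<forall>\<xi>\<in>tangent_space A x. \<forall>\<eta>\<in>tangent_space A x. N (\<lambda>c. \<xi> c + \<eta> c) \<le> N \<xi> + N \<eta>)"

definition equivalent_norm :: "('b::real_normed_vector \<Rightarrow> real) \<Rightarrow> bool" where
  "equivalent_norm N \<longleftrightarrow> (\<exists>k>0. \<exists>K>0. \<forall>v. k * norm v \<le> N v \<and> N v \<le> K * norm v)"

locale C1_Finsler_manifold =
  fixes A :: "('m::t2_space, 'b::banach) chart set"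
    and F :: "'m \<Rightarrow> ('m, 'b) tangent \<Rightarrow> real"
  assumes C1_structure: "C1_structure A"
    and connected: "connected (UNIV :: 'm set)"
    and paracompact: "paracompact_type TYPE('m)"
    and continuous_norm:
      "continuous_map (tangent_bundle_topology A) euclideanreal (\<lambda>(x, \<xi>). F x \<xi>)"
    and P1_norm: "\<And>x. norm_on_tangent_space A x (F x)"
    and P1_equivalent:
      "\<And>x c. c \<in> charts_at A x \<Longrightarrow> equivalent_norm (\<lambda>v. F x (tangent_of A c x v))"
    and P2: "\<And>x\<^sub>0 \<epsilon> c. \<epsilon> > 0 \<Longrightarrow> c \<in> charts_at A x\<^sub>0 \<Longrightarrow>
      \<exists>W. open W \<and> x\<^sub>0 \<in> W \<and> W \<subseteq> fst c \<and>
        (\<forall>x\<in>W. \<forall>v.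
           1 / (1 + \<epsilon>) * F x\<^sub>0 (tangent_of A c x\<^sub>0 v) \<le> F x (tangent_of A c x v) \<and>
           F x (tangent_of A c x v) \<le> (1 + \<epsilon>) * F x\<^sub>0 (tangent_of A c x\<^sub>0 v))"

text \<open>The number 0 is inserted only to give the norm the value 0 when the tangent space is
  trivial.\<close>

definition dual_norm ::
  "('m, 'b::real_normed_vector) chart set \<Rightarrow> ('m \<Rightarrow> ('m, 'b) tangent \<Rightarrow> real) \<Rightarrow>
   'm \<Rightarrow> (('m, 'b) tangent \<Rightarrow> real) \<Rightarrow> real" where
  "dual_norm A F x \<Delta> = Sup (insert 0 {\<bar>\<Delta> \<xi>\<bar> | \<xi>. \<xi> \<in> tangent_space A x \<and> F x \<xi> = 1})"


section \<open>The Finsler metric\<close>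

text \<open>At the end points of the interval the derivatives are the one-sided ones.\<close>

definition C1_path ::
  "('m::topological_space, 'b::real_normed_vector) chart set \<Rightarrow> (real \<Rightarrow> 'm) \<Rightarrow> real \<Rightarrow> real \<Rightarrow> bool"
  where
  "C1_path A \<gamma> a b \<longleftrightarrow> continuous_on {a..b} \<gamma> \<and>
     (\<forall>c\<in>A. \<exists>D.
        (\<forall>t \<in> {a..b} \<inter> \<gamma> -` fst c.
           ((snd c \<circ> \<gamma>) has_vector_derivative D t) (at t within {a..b})) \<and>
        continuous_on ({a..b} \<inter> \<gamma> -` fst c) D)"

text \<open>The library's notion of piecewise C1 curves does not require the derivative to extend
  continuously to the break points, hence the explicit subdivision.\<close>

definition piecewise_C1_path ::
  "('m::topological_space, 'b::real_normed_vector) chart set \<Rightarrow> (real \<Rightarrow> 'm) \<Rightarrow> real \<Rightarrow> real \<Rightarrow> bool"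
  where
  "piecewise_C1_path A \<gamma> a b \<longleftrightarrow> a < b \<and>
     (\<exists>(n::nat) s. s 0 = a \<and> s n = b \<and>
        (\<forall>i<n. s i < s (Suc i) \<and> C1_path A \<gamma> (s i) (s (Suc i))))"

text \<open>The velocity is meaningful where the path is differentiable, that is, on the domain of a
  piecewise C1 path up to finitely many points, which do not affect the length.\<close>

definition velocity ::
  "('m, 'b::real_normed_vector) chart set \<Rightarrow> (real \<Rightarrow> 'm) \<Rightarrow> real \<Rightarrow> ('m, 'b) tangent" where
  "velocity A \<gamma> t =
     (\<lambda>c. if c \<in> charts_at A (\<gamma> t) then vector_derivative (snd c \<circ> \<gamma>) (at t) else 0)"

definition path_length ::
  "('m, 'b::real_normed_vector) chart set \<Rightarrow> ('m \<Rightarrow> ('m, 'b) tangent \<Rightarrow> real) \<Rightarrow>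
   (real \<Rightarrow> 'm) \<Rightarrow> real \<Rightarrow> real \<Rightarrow> real" where
  "path_length A F \<gamma> a b = integral {a..b} (\<lambda>t. F (\<gamma> t) (velocity A \<gamma> t))"

definition finsler_dist ::
  "('m::topological_space, 'b::real_normed_vector) chart set \<Rightarrow>
   ('m \<Rightarrow> ('m, 'b) tangent \<Rightarrow> real) \<Rightarrow> 'm \<Rightarrow> 'm \<Rightarrow> real" where
  "finsler_dist A F p q =
     Inf {path_length A F \<gamma> a b | \<gamma> a b. piecewise_C1_path A \<gamma> a b \<and> \<gamma> a = p \<and> \<gamma> b = q}"

definition complete_Finsler ::
  "('m::topological_space, 'b::real_normed_vector) chart set \<Rightarrow>
   ('m \<Rightarrow> ('m, 'b) tangent \<Rightarrow> real) \<Rightarrow> bool" where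
  "complete_Finsler A F \<longleftrightarrow> Metric_space.mcomplete UNIV (finsler_dist A F)"

definition Lipschitz_near ::
  "('m::topological_space, 'b::real_normed_vector) chart set \<Rightarrow>
   ('m \<Rightarrow> ('m, 'b) tangent \<Rightarrow> real) \<Rightarrow> (real \<times> 'm \<Rightarrow> real) \<Rightarrow> real \<times> 'm \<Rightarrow> bool" where
  "Lipschitz_near A F u p \<longleftrightarrow>
     (\<exists>N L. open N \<and> p \<in> N \<and>
        (\<forall>t s x y. t \<ge> 0 \<longrightarrow> s \<ge> 0 \<longrightarrow> (t, x) \<in> N \<longrightarrow> (s, y) \<in> N \<longrightarrow>
           \<bar>u (t, x) - u (s, y)\<bar> \<le> L * (\<bar>t - s\<bar> + finsler_dist A F x y)))"


section \<open>Viscosity solutions\<close>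

text \<open>Functions on \<open>[0,\<infinity>) \<times> M\<close>, respectively \<open>(0,\<infinity>) \<times> M\<close>, are represented by total functions of
  whose values only those at times \<open>t \<ge> 0\<close>, respectively \<open>t > 0\<close>, are used.\<close>

definition upper_semicontinuous_on :: "'a::topological_space set \<Rightarrow> ('a \<Rightarrow> real) \<Rightarrow> bool" where
  "upper_semicontinuous_on S f \<longleftrightarrow> (\<forall>r. openin (top_of_set S) {x \<in> S. f x < r})"

definition lower_semicontinuous_on :: "'a::topological_space set \<Rightarrow> ('a \<Rightarrow> real) \<Rightarrow> bool" where
  "lower_semicontinuous_on S f \<longleftrightarrow> (\<forall>r. openin (top_of_set S) {x \<in> S. r < f x})"

definition C1_function ::
  "('m, 'b::real_normed_vector) chart set \<Rightarrow> (real \<times> 'm \<Rightarrow> real) \<Rightarrow> bool" where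
  "C1_function A g \<longleftrightarrow>
     (\<forall>c\<in>A. C1_on (\<lambda>(t, y). g (t, chart_inv c y)) ({0<..} \<times> snd c ` fst c))"

definition represents_differential ::
  "('m, 'b::real_normed_vector) chart set \<Rightarrow> (real \<times> 'm \<Rightarrow> real) \<Rightarrow> real \<times> 'm \<Rightarrow>
   real \<times> (('m, 'b) tangent \<Rightarrow> real) \<Rightarrow> bool" where
  "represents_differential A g = (\<lambda>(t, x) (\<alpha>, \<Delta>).
     ((\<lambda>s. g (s, x)) has_real_derivative \<alpha>) (at t) \<and>
     \<Delta> \<in> cotangent_space A x \<and>
     (\<forall>c\<in>charts_at A x.
        ((\<lambda>y. g (t, chart_inv c y)) has_derivative (\<lambda>v. \<Delta> (tangent_of A c x v))) (at (snd c x))))"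

text \<open>The sub- and superdifferential are only used at points p with positive time component.\<close>

definition subdifferential ::
  "('m::topological_space, 'b::real_normed_vector) chart set \<Rightarrow> (real \<times> 'm \<Rightarrow> real) \<Rightarrow>
   real \<times> 'm \<Rightarrow> (real \<times> (('m, 'b) tangent \<Rightarrow> real)) set" where
  "subdifferential A u p =
     {D. \<exists>g. C1_function A g \<and> (\<forall>\<^sub>F q in nhds p. u p - g p \<le> u q - g q) \<and>
             represents_differential A g p D}"

definition superdifferential ::
  "('m::topological_space, 'b::real_normed_vector) chart set \<Rightarrow> (real \<times> 'm \<Rightarrow> real) \<Rightarrow>
   real \<times> 'm \<Rightarrow> (real \<times> (('m, 'b) tangent \<Rightarrow> real)) set" where
  "superdifferential A u p =
     {D. \<exists>g. C1_function A g \<and> (\<forall>\<^sub>F q in nhds p. u q - g q \<le> u p - g p) \<and>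
             represents_differential A g p D}"

definition viscosity_subsolution ::
  "('m::topological_space, 'b::real_normed_vector) chart set \<Rightarrow>
   ('m \<Rightarrow> ('m, 'b) tangent \<Rightarrow> real) \<Rightarrow>
   (real \<times> 'm \<times> real \<Rightarrow> real) \<Rightarrow> ('m \<Rightarrow> real) \<Rightarrow> (real \<times> 'm \<Rightarrow> real) \<Rightarrow> bool" where
  "viscosity_subsolution A F H h u \<longleftrightarrow>
     upper_semicontinuous_on ({0..} \<times> UNIV) u \<and>
     (\<forall>t>0. \<forall>x. \<forall>(\<alpha>, \<Delta>) \<in> superdifferential A u (t, x). \<alpha> + H (t, x, dual_norm A F x \<Delta>) \<le> 0) \<and>
     (\<forall>x. u (0, x) \<le> h x)"

definition viscosity_supersolution ::
  "('m::topological_space, 'b::real_normed_vector) chart set \<Rightarrow>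
   ('m \<Rightarrow> ('m, 'b) tangent \<Rightarrow> real) \<Rightarrow>
   (real \<times> 'm \<times> real \<Rightarrow> real) \<Rightarrow> ('m \<Rightarrow> real) \<Rightarrow> (real \<times> 'm \<Rightarrow> real) \<Rightarrow> bool" where
  "viscosity_supersolution A F H h u \<longleftrightarrow>
     lower_semicontinuous_on ({0..} \<times> UNIV) u \<and>
     (\<forall>t>0. \<forall>x. \<forall>(\<alpha>, \<Delta>) \<in> subdifferential A u (t, x). \<alpha> + H (t, x, dual_norm A F x \<Delta>) \<ge> 0) \<and>
     (\<forall>x. u (0, x) \<ge> h x)"

definition condition_A ::
  "('m::topological_space, 'b::real_normed_vector) chart set \<Rightarrow>
   ('m \<Rightarrow> ('m, 'b) tangent \<Rightarrow> real) \<Rightarrow> (real \<times> 'm \<times> real \<Rightarrow> real) \<Rightarrow> bool" where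
  "condition_A A F H \<longleftrightarrow>
     (\<exists>C\<ge>0. \<exists>\<omega> :: real \<times> real \<times> real \<Rightarrow> real.
        continuous_on ({0..} \<times> UNIV \<times> UNIV) \<omega> \<and> \<omega> (0, 0, 0) = 0 \<and>
        (\<forall>t\<^sub>1\<ge>0. \<forall>t\<^sub>2\<ge>0. \<forall>x\<^sub>1 x\<^sub>2 r\<^sub>1 r\<^sub>2.
           \<bar>H (t\<^sub>1, x\<^sub>1, r\<^sub>1) - H (t\<^sub>2, x\<^sub>2, r\<^sub>2)\<bar> \<le>
             \<omega> (\<bar>t\<^sub>1 - t\<^sub>2\<bar>, finsler_dist A F x\<^sub>1 x\<^sub>2, r\<^sub>1 - r\<^sub>2) +
             C * max \<bar>r\<^sub>1\<bar> \<bar>r\<^sub>2\<bar> * (\<bar>t\<^sub>1 - t\<^sub>2\<bar> + finsler_dist A F x\<^sub>1 x\<^sub>2)))"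

end

theory Submission
  imports Defs
begin

text \<open>Since \<open>H\<^sub>1 \<le> H\<^sub>2\<close>, the function u is also a subsolution for \<open>H\<^sub>1\<close>, and since the supremum of
  \<open>H\<^sub>2 - H\<^sub>1\<close> is nonnegative it suffices to bound \<open>u - v\<close> by the supremum of \<open>h\<^sub>2 - h\<^sub>1\<close>. If this
  fails, then for small \<open>\<delta>\<close> the function \<open>v - u + \<delta> / (T - t)\<close> is smaller at some point than on the
  slices at time 0 and at times close to T. Ekeland's principle for the complete Finsler metric yields an
  interior point at which this function attains its minimum up to a term \<open>\<epsilon> (\<bar>t - t\<^sub>0\<bar> + d(x\<^sub>0, x))\<close>.
  Everything else happens in one chart around this point, where d is dominated by twice the norm of the
  tangent space at \<open>x\<^sub>0\<close>: a fuzzy sum rule in the Banach space \<open>\<real> \<times> X\<close>, based on bump functions, provides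
  elements of the subdifferential of v and the superdifferential of u at nearby points whose difference
  is controlled by \<open>\<epsilon>\<close> and \<open>-\<delta> / T\<^sup>2\<close>. One of u and v being locally Lipschitz, the covectors stay
  bounded, so that their dual norms at the two points are close, and condition (A) gives a contradiction.
  Applying the nonsmooth principle globally and smooth perturbations only in a chart avoids any
  uniformity of bump functions over the manifold.\<close>

section \<open>Calculus of C1 maps\<close>

text \<open>Without local compactness minima need not exist, and \<open>d\<close> is in general not
  smooth, so it cannot serve as a test function. Ekeland's principle removes the first obstacle but
  leaves a nonsmooth term; this is why the sum rule has three summands: v, -u, and a Lipschitz
  remainder made of that term and \<delta> / (T - t), whose derivative is known up to a multiple of
  \<epsilon>. Decoupling v from -u needs one of them to be Lipschitz, since otherwise values at
  neighbouring points could not be compared. The order of the constants is decisive. The chart, its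
  comparison constants and the local Lipschitz constant are known only after the Ekeland point, so
  \<epsilon> may depend on nothing but \<delta> / T^2 and the function \<omega> of condition (A),
  and the estimates by \<epsilon> are made in the Finsler norm at that point, where no chart
  constant enters. The other term of condition (A) carries the size of the covectors as a factor; it
  is made small by the distance of the two points alone, which the sum rule allows to shrink
  last.\<close>

lemma C1_onE:
  assumes "C1_on f S"
  obtains f' where "\<And>x. x \<in> S \<Longrightarrow> (f has_derivative blinfun_apply (f' x)) (at x)"
    "continuous_on S f'"
  using assms unfolding C1_on_def by blast

lemma C1_on_continuous_on: "C1_on f S \<Longrightarrow> continuous_on S f"
  by (metis C1_onE continuous_at_imp_continuous_on has_derivative_continuous)

lemma C1_on_const: "C1_on (\<lambda>x. c) S"
  unfolding C1_on_def by (rule exI[of _ "\<lambda>_. 0"]) (auto simp: zero_blinfun.rep_eq)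

lemma C1_on_bounded_linear:
  assumes "bounded_linear f" shows "C1_on f S"
  unfolding C1_on_def using assms
  by (intro exI[of _ "\<lambda>_. Blinfun f"])
     (auto simp: bounded_linear_Blinfun_apply bounded_linear_imp_has_derivative)

lemma C1_on_id: "C1_on (\<lambda>x. x) S"
  by (rule C1_on_bounded_linear) (rule bounded_linear_ident)

lemma C1_on_compose:
  assumes f: "C1_on f T" and g: "C1_on g S" and sub: "\<And>x. x \<in> S \<Longrightarrow> g x \<in> T"
  shows "C1_on (\<lambda>x. f (g x)) S"
proof -
  obtain f' where f': "\<And>x. x \<in> T \<Longrightarrow> (f has_derivative blinfun_apply (f' x)) (at x)"
    "continuous_on T f'" using f unfolding C1_on_def by blast
  obtain g' where g': "\<And>x. x \<in> S \<Longrightarrow> (g has_derivative blinfun_apply (g' x)) (at x)"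
    "continuous_on S g'" using g unfolding C1_on_def by blast
  have "continuous_on S (\<lambda>x. f' (g x))"
    by (rule continuous_on_compose2[OF f'(2) C1_on_continuous_on[OF g]]) (use sub in auto)
  moreover have "((\<lambda>x. f (g x)) has_derivative blinfun_apply (f' (g x) o\<^sub>L g' x)) (at x)" if "x \<in> S" for x
    using has_derivative_compose[OF g'(1)[OF that] f'(1)[OF sub[OF that]]]
    by (simp add: blinfun_compose.rep_eq o_def)
  ultimately show ?thesis
    unfolding C1_on_def using g'(2) by (intro exI[of _ "\<lambda>x. f' (g x) o\<^sub>L g' x"]) (auto intro!: continuous_intros)
qed

lemma C1_on_add: "C1_on f S \<Longrightarrow> C1_on g S \<Longrightarrow> C1_on (\<lambda>x. f x + g x) S"
  unfolding C1_on_def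
  apply (elim exE conjE)
  subgoal for f' g'
    by (rule exI[of _ "\<lambda>x. f' x + g' x"])
       (auto simp: plus_blinfun.rep_eq intro!: has_derivative_add continuous_intros)
  done

lemma C1_on_cmult: "C1_on f S \<Longrightarrow> C1_on (\<lambda>x. c * f x :: real) S"
  by (rule C1_on_compose[where f="\<lambda>y. c * y" and T=UNIV])
     (auto intro: C1_on_bounded_linear bounded_linear_mult_right)

lemma C1_on_uminus: "C1_on f S \<Longrightarrow> C1_on (\<lambda>x. - f x :: real) S"
  using C1_on_cmult[of f S "-1"] by simp

lemma C1_on_diff: "C1_on f S \<Longrightarrow> C1_on g S \<Longrightarrow> C1_on (\<lambda>x. f x - g x :: real) S"
  using C1_on_add[OF _ C1_on_uminus, of f S g] by simp

lemma C1_on_mult: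
  fixes f g :: "'a::real_normed_vector \<Rightarrow> real"
  shows "C1_on f S \<Longrightarrow> C1_on g S \<Longrightarrow> C1_on (\<lambda>x. f x * g x) S"
proof -
  assume a: "C1_on f S" "C1_on g S"
  obtain f' where f': "\<And>x. x \<in> S \<Longrightarrow> (f has_derivative blinfun_apply (f' x)) (at x)"
    "continuous_on S f'" using a(1) unfolding C1_on_def by blast
  obtain g' where g': "\<And>x. x \<in> S \<Longrightarrow> (g has_derivative blinfun_apply (g' x)) (at x)"
    "continuous_on S g'" using a(2) unfolding C1_on_def by blast
  show ?thesis
    unfolding C1_on_def
  proof (intro exI[of _ "\<lambda>x. f x *\<^sub>R g' x + g x *\<^sub>R f' x"] conjI ballI)
    fix x assume "x \<in> S"
    have "((\<lambda>x. f x * g x) has_derivative (\<lambda>h. f x * g' x h + f' x h * g x)) (at x)"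
      by (rule has_derivative_mult[OF f'(1) g'(1)]) fact+
    then show "((\<lambda>x. f x * g x) has_derivative blinfun_apply (f x *\<^sub>R g' x + g x *\<^sub>R f' x)) (at x)"
      by (simp add: plus_blinfun.rep_eq scaleR_blinfun.rep_eq mult.commute)
  qed (intro continuous_intros C1_on_continuous_on a f' g')
qed

lemma C1_on_Pair:
  assumes "C1_on f S" "C1_on g S" shows "C1_on (\<lambda>x. (f x, g x)) S"
proof -
  have "C1_on (\<lambda>x. (f x, 0)) S"
    by (rule C1_on_compose[where f="\<lambda>y. (y, 0)" and T=UNIV, OF C1_on_bounded_linear assms(1)])
       (auto intro!: bounded_linear_Pair bounded_linear_ident bounded_linear_zero)
  moreover have "C1_on (\<lambda>x. (0, g x)) S"
    by (rule C1_on_compose[where f="\<lambda>y. (0, y)" and T=UNIV, OF C1_on_bounded_linear assms(2)])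
       (auto intro!: bounded_linear_Pair bounded_linear_ident bounded_linear_zero)
  ultimately show ?thesis using C1_on_add by fastforce
qed

lemma C1_on_fst: "C1_on fst S" and C1_on_snd: "C1_on snd S"
  by (auto intro: C1_on_bounded_linear bounded_linear_fst bounded_linear_snd)

lemma C1_on_cong_open:
  assumes "C1_on f S" "open S" "\<And>x. x \<in> S \<Longrightarrow> f x = g x"
  shows "C1_on g S"
proof -
  obtain f' where f': "\<And>x. x \<in> S \<Longrightarrow> (f has_derivative blinfun_apply (f' x)) (at x)"
    "continuous_on S f'" using assms(1) unfolding C1_on_def by blast
  have "(g has_derivative blinfun_apply (f' x)) (at x)" if "x \<in> S" for x
    by (rule has_derivative_transform_within_open[OF f'(1)[OF that] assms(2) that assms(3)])
  with f'(2) show ?thesis unfolding C1_on_def by blast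
qed

text \<open>Uniqueness of derivatives turns the existential witness into a canonical one that no
  longer depends on the set.\<close>

lemma C1_on_frechet:
  assumes "C1_on f S"
  shows "x \<in> S \<Longrightarrow> (f has_derivative frechet_derivative f (at x)) (at x)"
    and "continuous_on S (\<lambda>x. Blinfun (frechet_derivative f (at x)))"
proof -
  obtain f' where f': "\<And>x. x \<in> S \<Longrightarrow> (f has_derivative blinfun_apply (f' x)) (at x)"
    "continuous_on S f'" using assms unfolding C1_on_def by blast
  have eq: "frechet_derivative f (at x) = blinfun_apply (f' x)" if "x \<in> S" for x
    using frechet_derivative_at[OF f'(1)[OF that]] by simp
  then show "x \<in> S \<Longrightarrow> (f has_derivative frechet_derivative f (at x)) (at x)"
    using f'(1) by simp
  show "continuous_on S (\<lambda>x. Blinfun (frechet_derivative f (at x)))"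
    using f'(2) by (rule continuous_on_eq) (simp add: eq blinfun_apply_inverse)
qed

text \<open>The canonical derivative does not depend on the neighbourhood, so local witnesses glue.
  This permits test functions defined by cases on a manifold.\<close>

lemma C1_on_local:
  assumes "\<And>x. x \<in> S \<Longrightarrow> \<exists>T. open T \<and> x \<in> T \<and> C1_on f T"
  shows "C1_on f S"
  unfolding C1_on_def
proof (intro exI[of _ "\<lambda>x. Blinfun (frechet_derivative f (at x))"] conjI ballI)
  fix x assume "x \<in> S"
  then obtain T where T: "open T" "x \<in> T" "C1_on f T" using assms by blast
  have "(f has_derivative frechet_derivative f (at x)) (at x)" by (rule C1_on_frechet(1)[OF T(3,2)])
  then show "(f has_derivative blinfun_apply (Blinfun (frechet_derivative f (at x)))) (at x)"
    by (simp add: bounded_linear_Blinfun_apply has_derivative_bounded_linear)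
next
  show "continuous_on S (\<lambda>x. Blinfun (frechet_derivative f (at x)))"
  proof (rule continuous_at_imp_continuous_on, rule ballI)
    fix x assume "x \<in> S"
    then obtain T where T: "open T" "x \<in> T" "C1_on f T" using assms by blast
    show "isCont (\<lambda>x. Blinfun (frechet_derivative f (at x))) x"
      using C1_on_frechet(2)[OF T(3)] T by (simp add: continuous_on_eq_continuous_at)
  qed
qed

lemma C1_on_real:
  fixes f :: "real \<Rightarrow> real"
  assumes "\<And>x. x \<in> S \<Longrightarrow> (f has_real_derivative f' x) (at x)" "continuous_on S f'"
  shows "C1_on f S"
  unfolding C1_on_def
proof (intro exI[of _ "\<lambda>x. f' x *\<^sub>R id_blinfun"] conjI ballI)
  fix x assume "x \<in> S"
  then show "(f has_derivative blinfun_apply (f' x *\<^sub>R id_blinfun)) (at x)"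
    using assms(1)[of x] by (simp add: has_field_derivative_def scaleR_blinfun.rep_eq)
qed (intro continuous_intros assms)

text \<open>First-order condition at a minimum of a nonsmooth function plus a smooth one; with
  \<open>\<phi> = -g\<close> it bounds the derivative of a Lipschitz function.\<close>

lemma derivative_ge_at_min:
  fixes g \<phi> :: "'a::real_normed_vector \<Rightarrow> real"
  assumes q: "(g has_derivative q) (at z)"
    and mn: "\<forall>\<^sub>F x in nhds z. \<phi> z + g z \<le> \<phi> x + g x"
    and lip: "\<forall>\<^sub>F x in nhds z. \<phi> x - \<phi> z \<le> K (x - z)"
    and hom: "\<And>a w. a \<ge> 0 \<Longrightarrow> K (a *\<^sub>R w) = a * K w"
  shows "- K w \<le> q w"
proof -
  interpret q: bounded_linear q using q by (rule has_derivative_bounded_linear)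
  have tn: "((\<lambda>a::real. z + a *\<^sub>R w) \<longlongrightarrow> z) (at_right 0)"
    by (auto intro!: tendsto_eq_intros)
  have "((\<lambda>a. g (z + a *\<^sub>R w)) has_vector_derivative q w) (at 0)"
  proof -
    have "((\<lambda>a. z + a *\<^sub>R w) has_derivative (\<lambda>a. a *\<^sub>R w)) (at 0)"
      by (auto intro!: derivative_eq_intros)
    moreover have "(g has_derivative q) (at (z + 0 *\<^sub>R w))" using q by simp
    ultimately have "((\<lambda>a. g (z + a *\<^sub>R w)) has_derivative (\<lambda>a. q (a *\<^sub>R w))) (at 0)"
      by (rule has_derivative_compose)
    then show ?thesis by (simp add: has_vector_derivative_def q.scaleR)
  qed
  then have "((\<lambda>a. g (z + a *\<^sub>R w)) has_real_derivative q w) (at 0)"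
    by (simp add: has_real_derivative_iff_has_vector_derivative)
  then have "((\<lambda>a. (g (z + a *\<^sub>R w) - g z) / a) \<longlongrightarrow> q w) (at 0)"
    by (simp add: has_field_derivative_iff)
  \<comment> \<open>The gauge \<open>K\<close> is only positively homogeneous, so the difference
    quotients are compared for positive \<open>a\<close>.\<close>
  then have lim: "((\<lambda>a. (g (z + a *\<^sub>R w) - g z) / a) \<longlongrightarrow> q w) (at_right 0)"
    by (rule filterlim_mono) (auto simp: at_le)
  show ?thesis
  proof (rule tendsto_lowerbound[OF lim])
    have e1: "\<forall>\<^sub>F a in at_right 0. \<phi> z + g z \<le> \<phi> (z + a *\<^sub>R w) + g (z + a *\<^sub>R w)"
      using mn tn by (rule eventually_compose_filterlim)
    have e2: "\<forall>\<^sub>F a in at_right 0. \<phi> (z + a *\<^sub>R w) - \<phi> z \<le> K (z + a *\<^sub>R w - z)"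
      using lip tn by (rule eventually_compose_filterlim)
    have e3: "\<forall>\<^sub>F a::real in at_right 0. a > 0" by (simp add: eventually_at_right_less)
    show "\<forall>\<^sub>F a in at_right 0. - K w \<le> (g (z + a *\<^sub>R w) - g z) / a"
      using e1 e2 e3
    proof eventually_elim
      case (elim a)
      then have "- (a * K w) \<le> g (z + a *\<^sub>R w) - g z" using hom[of a w] by simp
      with elim show ?case by (simp add: pos_le_divide_eq mult.commute)
    qed
  qed simp
qed

lemma Lipschitz_derivative_bound:
  fixes g :: "'a::real_normed_vector \<Rightarrow> real"
  assumes q: "(g has_derivative q) (at z)" and L: "\<And>x y. \<bar>g x - g y\<bar> \<le> L * norm (x - y)"
  shows "\<bar>q w\<bar> \<le> L * norm w"
proof -
  interpret q: bounded_linear q using q by (rule has_derivative_bounded_linear)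
  have "- (L * norm v) \<le> q v" for v
  proof (rule derivative_ge_at_min[OF q, of "\<lambda>x. - g x" "\<lambda>w. L * norm w"])
    show "\<forall>\<^sub>F x in nhds z. - g x - - g z \<le> L * norm (x - z)"
      using L by (intro always_eventually allI) (smt (verit))
  qed auto
  from this[of w] this[of "- w"] show ?thesis by (simp add: q.neg)
qed

section \<open>Bump functions\<close>

text \<open>Combinations of its shifts are C1 quadratic splines, for which monotonicity and
  Lipschitz bounds reduce to piecewise linear inequalities.\<close>

definition sq_pos :: "real \<Rightarrow> real" where "sq_pos s = (max 0 s)\<^sup>2"

lemma sq_pos_deriv: "(sq_pos has_real_derivative 2 * max 0 s) (at s)"
proof -
  consider "s > 0" | "s < 0" | "s = 0" by linarith
  then show ?thesis
  proof cases
    case 1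
    have "((\<lambda>s. s\<^sup>2) has_real_derivative 2 * max 0 s) (at s)"
      using 1 by (auto intro!: derivative_eq_intros)
    moreover have "\<forall>\<^sub>F x in nhds s. x\<^sup>2 = sq_pos x"
      by (rule eventually_mono[OF eventually_nhds_in_open[of "{0<..}" s]]) (use 1 in \<open>auto simp: sq_pos_def\<close>)
    ultimately show ?thesis by (rule DERIV_cong_ev[OF refl _ refl, THEN iffD1, rotated])
  next
    case 2
    have "((\<lambda>s::real. 0) has_real_derivative 2 * max 0 s) (at s)"
      using 2 by (auto intro!: derivative_eq_intros)
    moreover have "\<forall>\<^sub>F x in nhds s. 0 = sq_pos x"
      by (rule eventually_mono[OF eventually_nhds_in_open[of "{..<0}" s]]) (use 2 in \<open>auto simp: sq_pos_def\<close>)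
    ultimately show ?thesis by (rule DERIV_cong_ev[OF refl _ refl, THEN iffD1, rotated])
  next
    case 3
    have "((\<lambda>y. (sq_pos y - sq_pos 0) / (y - 0)) \<longlongrightarrow> 0) (at 0)"
    proof (rule Lim_null_comparison)
      show "\<forall>\<^sub>F y in at 0. norm ((sq_pos y - sq_pos 0) / (y - 0)) \<le> \<bar>y\<bar>"
        by (rule always_eventually) (auto simp: sq_pos_def power2_eq_square max_def)
    qed (auto intro!: tendsto_eq_intros)
    then show ?thesis using 3 by (simp add: has_field_derivative_iff)
  qed
qed

text \<open>The double primitive of a step function with values 16, -16, 0 on successive intervals of
  length 1/4, hence a spline rising from 0 to 1 on the interval from 0 to 1/2.\<close>

definition smooth_step :: "real \<Rightarrow> real" where
  "smooth_step s = 2 * sq_pos (2 * s) - 4 * sq_pos (2 * s - 1/2) + 2 * sq_pos (2 * s - 1)"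

lemma smooth_step_deriv:
  "(smooth_step has_real_derivative
     8 * max 0 (2 * s) - 16 * max 0 (2 * s - 1/2) + 8 * max 0 (2 * s - 1)) (at s)"
proof -
  have *: "((\<lambda>s. sq_pos (2 * s - c)) has_real_derivative 2 * max 0 (2 * s - c) * 2) (at s)" for c
    by (rule DERIV_chain2[OF sq_pos_deriv]) (auto intro!: derivative_eq_intros)
  show ?thesis unfolding smooth_step_def[abs_def]
    by (rule DERIV_cong[OF DERIV_add[OF DERIV_diff[OF DERIV_cmult[OF *[of 0, simplified]]
            DERIV_cmult[OF *[of "1/2"]]] DERIV_cmult[OF *[of 1]]]]) simp
qed

lemma C1_on_smooth_step: "C1_on smooth_step S"
  by (rule C1_on_real[OF smooth_step_deriv]) (intro continuous_intros)

lemma smooth_step_eq_0: "s \<le> 0 \<Longrightarrow> smooth_step s = 0"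
  by (simp add: smooth_step_def sq_pos_def)

lemma smooth_step_eq_1: "s \<ge> 1/2 \<Longrightarrow> smooth_step s = 1"
  by (simp add: smooth_step_def sq_pos_def power2_eq_square algebra_simps)

lemma smooth_step_mono: "x \<le> y \<Longrightarrow> smooth_step x \<le> smooth_step y"
proof (rule DERIV_nonneg_imp_nondecreasing, assumption)
  fix s :: real
  have "0 \<le> 8 * max 0 (2 * s) - 16 * max 0 (2 * s - 1/2) + 8 * max 0 (2 * s - 1)"
    by (simp add: max_def)
  with smooth_step_deriv show "\<exists>z. (smooth_step has_real_derivative z) (at s) \<and> 0 \<le> z" by blast
qed

lemma smooth_step_bounds: "0 \<le> smooth_step s" "smooth_step s \<le> 1"
  using smooth_step_mono[of "min s 0" s] smooth_step_mono[of s "max s 1"]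
  by (simp_all add: smooth_step_eq_0 smooth_step_eq_1)

lemma smooth_step_Lipschitz: "\<bar>smooth_step x - smooth_step y\<bar> \<le> 4 * \<bar>x - y\<bar>"
proof -
  have "norm (smooth_step x - smooth_step y) \<le> 4 * norm (x - y)"
  proof (rule field_differentiable_bound[where S=UNIV])
    fix z :: real
    show "(smooth_step has_real_derivative
      8 * max 0 (2 * z) - 16 * max 0 (2 * z - 1/2) + 8 * max 0 (2 * z - 1)) (at z within UNIV)"
      by (rule smooth_step_deriv)
    show "norm (8 * max 0 (2 * z) - 16 * max 0 (2 * z - 1/2) + 8 * max 0 (2 * z - 1)) \<le> 4"
      by (simp add: max_def)
  qed auto
  then show ?thesis by simp
qed

text \<open>The plateau around 0 is for cutting off test functions; the value 1 at 0 and the support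
  in the unit ball make rescaled copies usable as perturbations and penalties.\<close>

definition normalized_bump :: "('a::real_normed_vector \<Rightarrow> real) \<Rightarrow> bool" where
  "normalized_bump h \<longleftrightarrow> C1_on h UNIV \<and> (\<exists>L\<ge>0. \<forall>x y. \<bar>h x - h y\<bar> \<le> L * norm (x - y)) \<and>
     (\<forall>x. 0 \<le> h x \<and> h x \<le> 1) \<and> (\<forall>x. norm x \<ge> 1 \<longrightarrow> h x = 0) \<and> (\<exists>r>0. \<forall>x. norm x < r \<longrightarrow> h x = 1)"

text \<open>The bump is recentred at a point \<open>a\<close> with \<open>b a\<close> nonzero,
  divided by \<open>b a\<close> and composed with \<open>smooth_step\<close>, which truncates the
  values to [0, 1] and, being 1 from 1/2 on, creates the plateau by continuity.\<close>

lemma normalized_bump_exists: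
  fixes b :: "'a::real_normed_vector \<Rightarrow> real"
  assumes "C1_Lipschitz_bump b"
  obtains h :: "'a \<Rightarrow> real" where "normalized_bump h"
proof -
  obtain L where b: "C1_on b UNIV" "L-lipschitz_on UNIV b" "bounded (closure (support_on UNIV b))"
    "support_on UNIV b \<noteq> {}" using assms unfolding C1_Lipschitz_bump_def by blast
  then obtain a where a: "b a \<noteq> 0" by (auto simp: support_on_def)
  have "bounded (support_on UNIV b)" using b(3) bounded_subset closure_subset by blast
  then obtain B where B: "\<And>x. b x \<noteq> 0 \<Longrightarrow> norm x \<le> B" unfolding bounded_iff support_on_def by auto
  \<comment> \<open>With this scale, \<open>norm x \<ge> 1\<close> gives
    \<open>norm (a + l *\<^sub>R x) \<ge> l - norm a = B + 1\<close>, which is outside the support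
    of \<open>b\<close>.\<close>
  define l where "l = B + norm a + 1"
  have l: "l > 0" using B[OF a] norm_ge_zero[of a] unfolding l_def by linarith
  define h0 where "h0 x = b (a + l *\<^sub>R x) / b a" for x
  define h where "h x = smooth_step (h0 x)" for x
  have lip0: "\<bar>h0 x - h0 y\<bar> \<le> (L * l / \<bar>b a\<bar>) * norm (x - y)" for x y
  proof -
    have "\<bar>b (a + l *\<^sub>R x) - b (a + l *\<^sub>R y)\<bar> \<le> L * norm (l *\<^sub>R x - l *\<^sub>R y)"
      using lipschitz_onD[OF b(2), of "a + l *\<^sub>R x" "a + l *\<^sub>R y"] by (simp add: dist_norm)
    also have "norm (l *\<^sub>R x - l *\<^sub>R y) = l * norm (x - y)"
      using l by (simp flip: scaleR_diff_right)
    finally show ?thesis using a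
      by (simp add: h0_def divide_simps mult.assoc flip: diff_divide_distrib)
  qed
  have L0: "L \<ge> 0" using b(2) lipschitz_on_nonneg by blast
  have C1: "C1_on (\<lambda>x. a + l *\<^sub>R x) UNIV"
    by (intro C1_on_add C1_on_const C1_on_bounded_linear bounded_linear_scaleR_right)
  have "C1_on h0 UNIV"
    using C1_on_cmult[OF C1_on_compose[OF b(1) C1], of "1 / b a"] by (simp add: h0_def[abs_def])
  then have "C1_on h UNIV" unfolding h_def by (rule C1_on_compose[OF C1_on_smooth_step[of UNIV]]) simp
  moreover have "\<exists>K\<ge>0. \<forall>x y. \<bar>h x - h y\<bar> \<le> K * norm (x - y)"
  proof (intro exI[of _ "4 * (L * l / \<bar>b a\<bar>)"] conjI allI)
    show "0 \<le> 4 * (L * l / \<bar>b a\<bar>)" using L0 l by simp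
    show "\<bar>h x - h y\<bar> \<le> 4 * (L * l / \<bar>b a\<bar>) * norm (x - y)" for x y
      using smooth_step_Lipschitz[of "h0 x" "h0 y"] lip0[of x y] by (simp add: h_def)
  qed
  moreover have "h x = 0" if "norm x \<ge> 1" for x
  proof -
    have "l \<le> norm (l *\<^sub>R x)" using that l by simp
    also have "\<dots> \<le> norm (a + l *\<^sub>R x) + norm a" using norm_triangle_ineq4[of "a + l *\<^sub>R x" a] by simp
    finally have "norm (a + l *\<^sub>R x) > B" unfolding l_def by simp
    then have "b (a + l *\<^sub>R x) = 0" using B by force
    then show ?thesis by (simp add: h_def h0_def smooth_step_eq_0)
  qed
  moreover have "\<exists>r>0. \<forall>x. norm x < r \<longrightarrow> h x = 1"
  proof -
    have "continuous_on UNIV h0" using \<open>C1_on h0 UNIV\<close> by (rule C1_on_continuous_on)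
    then have "isCont h0 0" by (simp add: continuous_on_eq_continuous_at)
    then have "(h0 \<longlongrightarrow> 1) (at 0)" using a by (simp add: isCont_def h0_def)
    then have "(h0 \<longlongrightarrow> 1) (nhds 0)" using a using tendsto_at_iff_tendsto_nhds[of h0 0] by (simp add: h0_def)
    then have "\<forall>\<^sub>F x in nhds 0. h0 x > 1/2" by (rule order_tendstoD) simp
    then obtain r where "r > 0" "\<And>x. dist x 0 < r \<Longrightarrow> h0 x > 1/2"
      unfolding eventually_nhds_metric by blast
    then show ?thesis by (intro exI[of _ r]) (auto simp: h_def intro!: smooth_step_eq_1 less_imp_le)
  qed
  moreover have "0 \<le> h x \<and> h x \<le> 1" for x by (simp add: h_def smooth_step_bounds)
  ultimately have "normalized_bump h" unfolding normalized_bump_def by simp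
  then show ?thesis by (rule that)
qed

text \<open>Serves the time variable, which is not part of the model space.\<close>

lemma normalized_bump_real: obtains h :: "real \<Rightarrow> real" where "normalized_bump h"
proof -
  define h0 where "h0 t = (1::real) - t\<^sup>2" for t
  \<comment> \<open>The square is Lipschitz only on bounded sets. Clamping the argument to [-1, 1]
    changes nothing after \<open>smooth_step\<close>, since \<open>h0\<close> is nonpositive outside
    that interval; the Lipschitz bound is read off this form, C1 off the unclamped one.\<close>
  define h where "h t = smooth_step (h0 (max (-1) (min 1 t)))" for t
  have h_eq: "h t = smooth_step (h0 t)" for t
  proof -
    have "h0 t \<le> 0" if "\<bar>t\<bar> \<ge> 1" using abs_le_square_iff[of 1 t] that by (simp add: h0_def)
    moreover have "h0 (max (-1) (min 1 t)) = 0" if "\<bar>t\<bar> \<ge> 1" using that by (cases "1 \<le> t") (simp_all add: h0_def min_absorb2 max_absorb1)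
    ultimately show ?thesis
      by (cases "\<bar>t\<bar> \<ge> 1") (simp_all add: h_def smooth_step_eq_0 max_def min_def)
  qed
  have "C1_on h0 UNIV" unfolding h0_def power2_eq_square
    by (intro C1_on_diff C1_on_const C1_on_mult C1_on_id)
  then have C: "C1_on (\<lambda>t. smooth_step (h0 t)) UNIV"
    by (rule C1_on_compose[OF C1_on_smooth_step[of UNIV]]) simp
  have lip: "\<bar>h x - h y\<bar> \<le> 8 * norm (x - y)" for x y
  proof -
    let ?p = "\<lambda>t::real. max (-1) (min 1 t)"
    have "\<bar>h0 (?p x) - h0 (?p y)\<bar> = \<bar>?p x - ?p y\<bar> * \<bar>?p x + ?p y\<bar>"
    proof -
      have "h0 a - h0 b = (b - a) * (a + b)" for a b :: real
        by (simp add: h0_def power2_eq_square algebra_simps)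
      then show ?thesis by (simp only: abs_mult abs_minus_commute)
    qed
    also have "\<dots> \<le> \<bar>x - y\<bar> * 2" by (rule mult_mono) auto
    finally show ?thesis using smooth_step_Lipschitz[of "h0 (?p x)" "h0 (?p y)"] by (simp add: h_def)
  qed
  have one: "h x = 1" if "norm x < 1/2" for x
  proof -
    have "x\<^sup>2 \<le> (1/2)\<^sup>2" using that by (intro abs_le_square_iff[THEN iffD1]) simp
    then show ?thesis unfolding h_eq by (intro smooth_step_eq_1) (simp add: h0_def power2_eq_square)
  qed
  have zero: "h x = 0" if "norm x \<ge> 1" for x
    unfolding h_eq using abs_le_square_iff[of 1 x] that by (intro smooth_step_eq_0) (simp add: h0_def)
  have "normalized_bump h"
    unfolding normalized_bump_def
  proof (intro conjI)
    show "C1_on h UNIV" using C by (simp add: h_eq[abs_def])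
    show "\<exists>L\<ge>0. \<forall>x y. \<bar>h x - h y\<bar> \<le> L * norm (x - y)" using lip by (intro exI[of _ 8]) auto
    show "\<exists>r>0. \<forall>x. norm x < r \<longrightarrow> h x = 1" using one by (intro exI[of _ "1/2"]) auto
    show "\<forall>x. 0 \<le> h x \<and> h x \<le> 1" by (simp add: h_def smooth_step_bounds)
    show "\<forall>x. 1 \<le> norm x \<longrightarrow> h x = 0" using zero by blast
  qed
  then show ?thesis by (rule that)
qed

text \<open>The factors 2 are there because a pair of norm at least 1 has a component of norm at
  least 1/2, so that one factor vanishes.\<close>

lemma normalized_bump_prod:
  fixes h1 :: "'a::real_normed_vector \<Rightarrow> real" and h2 :: "'b::real_normed_vector \<Rightarrow> real"
  assumes "normalized_bump h1" "normalized_bump h2"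
  shows "normalized_bump (\<lambda>(x, y). h1 (2 *\<^sub>R x) * h2 (2 *\<^sub>R y))"
proof -
  note h = assms[unfolded normalized_bump_def]
  obtain L1 L2 r1 r2 where L: "L1 \<ge> 0" "L2 \<ge> 0" "r1 > 0" "r2 > 0"
    and l1: "\<And>x y. \<bar>h1 x - h1 y\<bar> \<le> L1 * norm (x - y)"
    and l2: "\<And>x y. \<bar>h2 x - h2 y\<bar> \<le> L2 * norm (x - y)"
    and r1: "\<And>x. norm x < r1 \<Longrightarrow> h1 x = 1" and r2: "\<And>x. norm x < r2 \<Longrightarrow> h2 x = 1"
    using h by blast
  have b1: "0 \<le> h1 x" "h1 x \<le> 1" and b2: "0 \<le> h2 y" "h2 y \<le> 1" for x y using h by auto
  define k where "k z = h1 (2 *\<^sub>R fst z) * h2 (2 *\<^sub>R snd z)" for z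
  have n: "norm (fst z) \<le> norm z" "norm (snd z) \<le> norm z" for z :: "'a \<times> 'b"
    using norm_fst_le[of "fst z" "snd z"] norm_snd_le[of "snd z" "fst z"] by simp_all
  have n2: "norm z \<le> norm (fst z) + norm (snd z)" for z :: "'a \<times> 'b"
    using norm_Pair_le[of "fst z" "snd z"] by simp
  have "C1_on (\<lambda>z::'a \<times> 'b. h1 (2 *\<^sub>R fst z)) UNIV" "C1_on (\<lambda>z::'a \<times> 'b. h2 (2 *\<^sub>R snd z)) UNIV"
    using C1_on_compose[of h1 UNIV "\<lambda>z::'a \<times> 'b. 2 *\<^sub>R fst z" UNIV]
      C1_on_compose[of h2 UNIV "\<lambda>z::'a \<times> 'b. 2 *\<^sub>R snd z" UNIV] h
    by (simp_all add: C1_on_bounded_linear bounded_linear_const_scaleR bounded_linear_fst bounded_linear_snd)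
  then have "C1_on k UNIV" unfolding k_def by (rule C1_on_mult)
  moreover have klip: "\<bar>k z - k z'\<bar> \<le> (2 * L1 + 2 * L2) * norm (z - z')" for z z'
  proof -
    let ?a = "h1 (2 *\<^sub>R fst z)" and ?a' = "h1 (2 *\<^sub>R fst z')"
    let ?c = "h2 (2 *\<^sub>R snd z)" and ?c' = "h2 (2 *\<^sub>R snd z')"
    have "k z - k z' = (?a - ?a') * ?c + ?a' * (?c - ?c')" by (simp add: k_def algebra_simps)
    also have "\<bar>\<dots>\<bar> \<le> \<bar>?a - ?a'\<bar> * \<bar>?c\<bar> + \<bar>?a'\<bar> * \<bar>?c - ?c'\<bar>"
      using abs_triangle_ineq[of "(?a - ?a') * ?c" "?a' * (?c - ?c')"] by (simp only: abs_mult)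
    also have "\<dots> \<le> \<bar>?a - ?a'\<bar> * 1 + 1 * \<bar>?c - ?c'\<bar>"
      by (intro add_mono mult_left_mono mult_right_mono) (use b1 b2 in auto)
    also have "\<dots> \<le> L1 * norm (2 *\<^sub>R fst (z - z')) + L2 * norm (2 *\<^sub>R snd (z - z'))"
      using l1[of "2 *\<^sub>R fst z" "2 *\<^sub>R fst z'"] l2[of "2 *\<^sub>R snd z" "2 *\<^sub>R snd z'"]
      by (simp add: scaleR_diff_right)
    also have "\<dots> \<le> L1 * (2 * norm (z - z')) + L2 * (2 * norm (z - z'))"
      by (intro add_mono mult_left_mono) (use n[of "z - z'"] L in auto)
    finally show ?thesis by (simp add: algebra_simps)
  qed
  moreover have "0 \<le> k z \<and> k z \<le> 1" for z unfolding k_def using b1 b2 by (simp add: mult_le_one)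
  moreover have "k z = 0" if "norm z \<ge> 1" for z
  proof -
    have "norm (2 *\<^sub>R fst z) \<ge> 1 \<or> norm (2 *\<^sub>R snd z) \<ge> 1" using that n2[of z] by auto
    then show ?thesis using h unfolding k_def by auto
  qed
  moreover have "\<exists>K\<ge>0. \<forall>x y. \<bar>k x - k y\<bar> \<le> K * norm (x - y)"
    using klip L by (intro exI[of _ "2 * L1 + 2 * L2"]) simp
  moreover have k1: "k z = 1" if "norm z < min r1 r2 / 2" for z
    unfolding k_def using r1[of "2 *\<^sub>R fst z"] r2[of "2 *\<^sub>R snd z"] that n[of z] by simp
  moreover have "\<exists>r>0. \<forall>x. norm x < r \<longrightarrow> k x = 1"
    using L k1 by (intro exI[of _ "min r1 r2 / 2"]) simp
  ultimately have "normalized_bump k" unfolding normalized_bump_def by simp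
  then show ?thesis by (simp add: k_def[abs_def] case_prod_unfold)
qed

text \<open>A Lipschitz constant bounds the operator norm of the derivative, so \<open>K\<close> is
  a Weierstrass majorant for the series of derivatives; its uniform limit is continuous and is the
  derivative of the sum.\<close>

lemma C1_on_suminf:
  fixes f :: "nat \<Rightarrow> 'a::real_normed_vector \<Rightarrow> real"
  assumes C1: "\<And>n. C1_on (f n) UNIV"
    and M: "\<And>n x. \<bar>f n x\<bar> \<le> M n" "summable M"
    and K: "\<And>n x y. \<bar>f n x - f n y\<bar> \<le> K n * norm (x - y)" "\<And>n. 0 \<le> K n" "summable K"
  shows "C1_on (\<lambda>x. \<Sum>n. f n x) UNIV"
proof -
  have "\<forall>n. \<exists>f'. (\<forall>x. (f n has_derivative blinfun_apply (f' x)) (at x)) \<and> continuous_on UNIV f'"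
    using C1 unfolding C1_on_def by simp
  then obtain f' where f': "\<And>n x. (f n has_derivative blinfun_apply (f' n x)) (at x)"
    "\<And>n. continuous_on UNIV (f' n)" by metis
  have nf': "norm (f' n x) \<le> K n" for n x
  proof (rule norm_blinfun_bound)
    show "norm (blinfun_apply (f' n x) w) \<le> K n * norm w" for w
      using Lipschitz_derivative_bound[OF f'(1)[of n x] K(1)[of n]] by simp
  qed (rule K(2))
  define g' where "g' x = (\<Sum>n. f' n x)" for x
  have ul: "uniform_limit UNIV (\<lambda>n x. \<Sum>i<n. f' i x) g' sequentially"
    unfolding g'_def[abs_def] by (rule Weierstrass_m_test[OF nf' K(3)])
  have cont: "continuous_on UNIV g'"
    by (rule uniform_limit_theorem[OF _ ul]) (auto intro!: always_eventually continuous_intros f'(2))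
  have sm: "(\<lambda>n. f n x) sums (\<Sum>n. f n x)" for x
    by (rule summable_sums, rule summable_comparison_test'[OF M(2)]) (use M(1) in simp)
  have "\<exists>g. \<forall>x\<in>UNIV. (\<lambda>n. f n x) sums g x \<and> (g has_derivative blinfun_apply (g' x)) (at x within UNIV)"
  proof (rule has_derivative_series[where f=f and f'="\<lambda>n x. blinfun_apply (f' n x)" and x=0])
    show "(\<lambda>n. f n 0) sums (\<Sum>n. f n 0)" by (rule sm)
    fix e :: real assume "e > 0"
    then have "\<forall>\<^sub>F n in sequentially. \<forall>x\<in>UNIV. dist (\<Sum>i<n. f' i x) (g' x) < e"
      using ul unfolding uniform_limit_iff by blast
    then show "\<forall>\<^sub>F n in sequentially. \<forall>x\<in>UNIV. \<forall>h. norm ((\<Sum>i<n. blinfun_apply (f' i x) h) - blinfun_apply (g' x) h) \<le> e * norm h"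
    proof eventually_elim
      case (elim n)
      show ?case
      proof (intro ballI allI)
        fix x h
        have "norm (((\<Sum>i<n. f' i x) - g' x) h) \<le> norm ((\<Sum>i<n. f' i x) - g' x) * norm h"
          by (rule norm_blinfun)
        also have "\<dots> \<le> e * norm h"
          using elim by (intro mult_right_mono) (auto simp: dist_norm less_imp_le)
        finally show "norm ((\<Sum>i<n. blinfun_apply (f' i x) h) - blinfun_apply (g' x) h) \<le> e * norm h"
          by (simp add: blinfun.diff_left blinfun.sum_left)
      qed
    qed
  qed (simp_all add: f'(1))
  then obtain g where g: "\<And>x. (\<lambda>n. f n x) sums g x"
    "\<And>x. (g has_derivative blinfun_apply (g' x)) (at x)" by auto
  have "g = (\<lambda>x. \<Sum>n. f n x)" using g(1) by (auto simp: sums_iff)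
  with g(2) cont show ?thesis unfolding C1_on_def by blast
qed

section \<open>Variational principles\<close>

text \<open>Stated with sequences because in the end it is applied along the convergent sequences of
  almost minimizers that the variational principles construct.\<close>

definition seq_lsc :: "'a::topological_space set \<Rightarrow> ('a \<Rightarrow> real) \<Rightarrow> bool" where
  "seq_lsc S f \<longleftrightarrow> (\<forall>\<sigma> l r. (\<forall>n::nat. \<sigma> n \<in> S) \<longrightarrow> l \<in> S \<longrightarrow> \<sigma> \<longlonglongrightarrow> l \<longrightarrow> r < f l \<longrightarrow>
     (\<forall>\<^sub>F n in sequentially. r < f (\<sigma> n)))"

lemma seq_lscD:
  "seq_lsc S f \<Longrightarrow> (\<And>n. \<sigma> n \<in> S) \<Longrightarrow> l \<in> S \<Longrightarrow> \<sigma> \<longlonglongrightarrow> l \<Longrightarrow> r < f l \<Longrightarrow>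
     \<forall>\<^sub>F n in sequentially. r < f (\<sigma> n)"
  unfolding seq_lsc_def by blast

lemma seq_lsc_subset: "seq_lsc S f \<Longrightarrow> T \<subseteq> S \<Longrightarrow> seq_lsc T f"
  unfolding seq_lsc_def by blast

lemma seq_lsc_continuous: "continuous_on S f \<Longrightarrow> seq_lsc S f"
  unfolding seq_lsc_def
proof (intro allI impI)
  fix \<sigma> l r assume f: "continuous_on S f" and *: "\<forall>n::nat. \<sigma> n \<in> S" "l \<in> S" "\<sigma> \<longlonglongrightarrow> l" "r < f l"
  have "(\<lambda>n. f (\<sigma> n)) \<longlonglongrightarrow> f l"
    by (rule continuous_on_tendsto_compose[OF f *(3,2)]) (use * in auto)
  then show "\<forall>\<^sub>F n in sequentially. r < f (\<sigma> n)" using *(4) by (rule order_tendstoD(1))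
qed

lemma seq_lsc_compose:
  assumes "seq_lsc T f" "continuous_on S g" "g ` S \<subseteq> T" shows "seq_lsc S (\<lambda>x. f (g x))"
  unfolding seq_lsc_def
proof (intro allI impI)
  fix \<sigma> l r assume *: "\<forall>n::nat. \<sigma> n \<in> S" "l \<in> S" "\<sigma> \<longlonglongrightarrow> l" "r < f (g l)"
  have "(\<lambda>n. g (\<sigma> n)) \<longlonglongrightarrow> g l"
    by (rule continuous_on_tendsto_compose[OF assms(2) *(3,2)]) (use * in auto)
  then show "\<forall>\<^sub>F n in sequentially. r < f (g (\<sigma> n))"
    by (intro seq_lscD[OF assms(1)]) (use * assms(3) in auto)
qed

lemma seq_lsc_add:
  assumes "seq_lsc S f" "seq_lsc S g" shows "seq_lsc S (\<lambda>x. f x + g x)"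
  unfolding seq_lsc_def
proof (intro allI impI)
  fix \<sigma> l r assume *: "\<forall>n::nat. \<sigma> n \<in> S" "l \<in> S" "\<sigma> \<longlonglongrightarrow> l" "r < f l + g l"
  define e where "e = (f l + g l - r) / 2"
  have e: "e > 0" using * by (simp add: e_def)
  have "\<forall>\<^sub>F n in sequentially. f l - e < f (\<sigma> n)"
    by (rule seq_lscD[OF assms(1)]) (use * e in auto)
  moreover have "\<forall>\<^sub>F n in sequentially. g l - e < g (\<sigma> n)"
    by (rule seq_lscD[OF assms(2)]) (use * e in auto)
  ultimately show "\<forall>\<^sub>F n in sequentially. r < f (\<sigma> n) + g (\<sigma> n)"
    by eventually_elim (simp add: e_def field_simps)
qed

text \<open>The hypothesis \<open>compl\<close> bundles completeness with lower semicontinuity: a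
  \<open>d\<close>-Cauchy sequence has a limit at which \<open>f\<close> respects every eventual
  upper bound. This keeps the principle independent of how a topology on the space is related to
  \<open>d\<close>.\<close>

lemma ekeland_variational_principle:
  fixes d :: "'a \<Rightarrow> 'a \<Rightarrow> real" and f :: "'a \<Rightarrow> real"
  assumes nonneg: "\<And>x y. 0 \<le> d x y" and refl: "\<And>x. d x x = 0"
    and tri: "\<And>x y z. d x z \<le> d x y + d y z"
    and bdd: "\<And>x. x \<in> S \<Longrightarrow> B \<le> f x"
    and compl: "\<And>\<sigma>. (\<And>n::nat. \<sigma> n \<in> S) \<Longrightarrow>
       (\<And>e. e > 0 \<Longrightarrow> \<exists>N. \<forall>m\<ge>N. \<forall>n\<ge>m. d (\<sigma> m) (\<sigma> n) < e) \<Longrightarrow>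
       \<exists>l\<in>S. ((\<lambda>n. d (\<sigma> n) l) \<longlonglongrightarrow> 0) \<and> (\<forall>c. (\<forall>\<^sub>F n in sequentially. f (\<sigma> n) \<le> c) \<longrightarrow> f l \<le> c)"
    and x: "x \<in> S" and e: "e > 0"
  obtains x0 where "x0 \<in> S" "f x0 \<le> f x" "\<And>y. y \<in> S \<Longrightarrow> f x0 \<le> f y + e * d x0 y"
proof -
  \<comment> \<open>Ekeland's order: \<open>q\<close> lies below \<open>p\<close> if the decrease of
    \<open>f\<close> pays for the distance at rate \<open>e\<close>. The conclusion asks essentially
    for a minimal element.\<close>
  define R where "R p = {q \<in> S. f q + e * d p q \<le> f p}" for p
  have self: "p \<in> R p" if "p \<in> S" for p using that refl by (simp add: R_def)
  have trans: "R q \<subseteq> R p" if "q \<in> R p" for p q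
  proof
    fix s assume "s \<in> R q"
    then have "s \<in> S" "f s + e * d q s \<le> f q" by (auto simp: R_def)
    moreover have "e * d p s \<le> e * d p q + e * d q s"
      using tri[of p s q] e by (simp flip: distrib_left)
    ultimately show "s \<in> R p" using that by (auto simp: R_def)
  qed
  have ex: "\<exists>q. q \<in> R p \<and> (\<forall>s\<in>R p. f q \<le> f s + (1/2)^n)" if "p \<in> S" for p and n :: nat
  proof -
    have bb: "bdd_below (f ` R p)" using bdd by (intro bdd_belowI2[of _ B]) (auto simp: R_def)
    have ne: "f ` R p \<noteq> {}" using self[OF that] by auto
    have "Inf (f ` R p) < Inf (f ` R p) + (1/2)^n" by simp
    then obtain q where "q \<in> R p" "f q < Inf (f ` R p) + (1/2)^n"
      using cInf_lessD[OF ne] by (metis (no_types, lifting) imageE)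
    moreover have "Inf (f ` R p) \<le> f s" if "s \<in> R p" for s
      using that bb by (simp add: cINF_lower)
    ultimately show ?thesis by (smt (verit))
  qed
  obtain \<sigma> where \<sigma>0: "\<sigma> 0 = x" and \<sigma>S: "\<And>n. \<sigma> n \<in> S"
    and \<sigma>: "\<And>n. \<sigma> (Suc n) \<in> R (\<sigma> n) \<and> (\<forall>s\<in>R (\<sigma> n). f (\<sigma> (Suc n)) \<le> f s + (1/2)^n)"
  proof -
    have "\<exists>\<sigma>. \<forall>n. (\<sigma> n \<in> S \<and> (n = 0 \<longrightarrow> \<sigma> n = x)) \<and>
      (\<sigma> (Suc n) \<in> R (\<sigma> n) \<and> (\<forall>s\<in>R (\<sigma> n). f (\<sigma> (Suc n)) \<le> f s + (1/2)^n))"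
    proof (rule dependent_nat_choice)
      show "\<exists>p. p \<in> S \<and> ((0::nat) = 0 \<longrightarrow> p = x)" using x by blast
    next
      fix p and n :: nat assume p: "p \<in> S \<and> (n = 0 \<longrightarrow> p = x)"
      then show "\<exists>q. (q \<in> S \<and> (Suc n = 0 \<longrightarrow> q = x)) \<and> q \<in> R p \<and> (\<forall>s\<in>R p. f q \<le> f s + (1/2)^n)"
        using ex[of p n] by (auto simp: R_def)
    qed
    then show ?thesis using that by metis
  qed
  have anti: "\<sigma> n \<in> R (\<sigma> m)" if "m \<le> n" for m n
    using that
  proof (induction rule: dec_induct)
    case base show ?case using self \<sigma>S by blast
  next
    case (step n) then show ?case using trans[OF step.IH] \<sigma> by blast
  qed
  \<comment> \<open>Both \<open>\<sigma> (Suc m)\<close> and \<open>q\<close> lie in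
    \<open>R (\<sigma> m)\<close>, where \<open>\<sigma> (Suc m)\<close> is minimal up to
    \<open>(1/2)^m\<close>; so only that much decrease is left to pay for the distance.\<close>
  have dist: "e * d (\<sigma> (Suc m)) q \<le> (1/2)^m" if "q \<in> R (\<sigma> (Suc m))" for m q
  proof -
    have "q \<in> R (\<sigma> m)" using that trans \<sigma> by blast
    then have "f (\<sigma> (Suc m)) \<le> f q + (1/2)^m" using \<sigma> by blast
    moreover have "f q + e * d (\<sigma> (Suc m)) q \<le> f (\<sigma> (Suc m))" using that by (simp add: R_def)
    ultimately show ?thesis by simp
  qed
  have "\<exists>N. \<forall>m\<ge>N. \<forall>n\<ge>m. d (\<sigma> m) (\<sigma> n) < c" if "c > 0" for c
  proof -
    have "e * c > 0" using e that by simp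
    then obtain k where k: "(1/2)^k < e * c" using real_arch_pow_inv[of "e * c" "1/2"] by auto
    have "d (\<sigma> m) (\<sigma> n) < c" if m: "m \<ge> Suc k" and n: "n \<ge> m" for m n
    proof -
      obtain m' where m': "m = Suc m'" "m' \<ge> k" using m by (metis Suc_le_D Suc_le_mono)
      have "e * d (\<sigma> m) (\<sigma> n) \<le> (1/2)^m'" using dist anti[OF n] m' by blast
      also have "\<dots> \<le> (1/2)^k" using m' by (intro power_decreasing) auto
      also have "\<dots> < e * c" by (rule k)
      finally show ?thesis using e by simp
    qed
    then show ?thesis by blast
  qed
  from compl[of \<sigma>, OF \<sigma>S this] obtain l where l: "l \<in> S" "(\<lambda>n. d (\<sigma> n) l) \<longlonglongrightarrow> 0"
    and lf: "\<And>c. \<forall>\<^sub>F n in sequentially. f (\<sigma> n) \<le> c \<Longrightarrow> f l \<le> c" by blast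
  have lR: "l \<in> R (\<sigma> m)" for m
  proof -
    have "f l \<le> f (\<sigma> m) - e * d (\<sigma> m) l + c" if "c > 0" for c
    proof (rule lf)
      have "\<forall>\<^sub>F n in sequentially. d (\<sigma> n) l < c / e"
        using l(2) that e by (intro order_tendstoD(2)) auto
      then show "\<forall>\<^sub>F n in sequentially. f (\<sigma> n) \<le> f (\<sigma> m) - e * d (\<sigma> m) l + c"
        using eventually_ge_at_top[of m]
      proof eventually_elim
        case (elim n)
        have "f (\<sigma> n) + e * d (\<sigma> m) (\<sigma> n) \<le> f (\<sigma> m)" using anti[OF elim(2)] by (simp add: R_def)
        moreover have "e * d (\<sigma> m) l \<le> e * d (\<sigma> m) (\<sigma> n) + e * d (\<sigma> n) l"
          using tri[of "\<sigma> m" l "\<sigma> n"] e by (simp flip: distrib_left)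
        moreover have "e * d (\<sigma> n) l < c" using elim(1) e by (simp add: pos_less_divide_eq mult.commute)
        ultimately show ?case by linarith
      qed
    qed
    then have "f l \<le> f (\<sigma> m) - e * d (\<sigma> m) l" by (rule field_le_epsilon)
    then show ?thesis using l(1) by (simp add: R_def)
  qed
  show ?thesis
  proof (rule that[OF l(1)])
    show "f l \<le> f x" using lR[of 0] mult_nonneg_nonneg[OF less_imp_le[OF e] nonneg[of x l]] by (simp add: R_def \<sigma>0)
    fix y assume y: "y \<in> S"
    show "f l \<le> f y + e * d l y"
    proof (rule ccontr)
      assume "\<not> ?thesis"
      \<comment> \<open>A violating \<open>y\<close> lies below \<open>l\<close>, hence below every
        \<open>\<sigma> n\<close>, so that almost minimality forces \<open>f l \<le> f y\<close> in
        the limit.\<close>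
      then have yR: "y \<in> R l" using y by (simp add: R_def)
      have "f (\<sigma> (Suc n)) \<le> f y + (1/2)^n" for n
        using \<sigma> trans[OF lR[of n]] yR by blast
      have "f l \<le> f y + c" if "c > 0" for c
      proof (rule lf)
        obtain k where k: "(1/2)^k < c" using real_arch_pow_inv[of c "1/2"] \<open>c > 0\<close> by auto
        show "\<forall>\<^sub>F n in sequentially. f (\<sigma> n) \<le> f y + c"
        proof (rule eventually_sequentiallyI)
          fix n assume "n \<ge> Suc k"
          then obtain m where m: "n = Suc m" "m \<ge> k" by (metis Suc_le_D Suc_le_mono)
          have "(1/2)^m \<le> (1/2::real)^k" using m by (intro power_decreasing) auto
          moreover have "f (\<sigma> n) \<le> f y + (1/2)^m" using \<sigma> trans[OF lR[of m]] yR m by blast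
          ultimately show "f (\<sigma> n) \<le> f y + c" using k by linarith
        qed
      qed
      then have "f l \<le> f y" by (rule field_le_epsilon)
      with \<open>\<not> ?thesis\<close> show False using mult_nonneg_nonneg[OF less_imp_le[OF e] nonneg[of l y]] by linarith
    qed
  qed
qed

text \<open>The perturbation is a series of bumps of height \<open>\<epsilon> / 8 ^ n\<close> and width \<open>1 / 2 ^ n\<close>, the n-th of
  them centred at an almost minimizer of the function perturbed by the previous ones. The next
  almost minimizers all lie in the support of the bump, hence form a Cauchy sequence.\<close>

lemma smooth_variational_principle:
  fixes f :: "'a::banach \<Rightarrow> real"
  assumes h: "normalized_bump (h :: 'a \<Rightarrow> real)"
    and S: "closed S" "S \<noteq> {}" and lsc: "seq_lsc S f" and bdd: "\<And>x. x \<in> S \<Longrightarrow> B \<le> f x" and e: "e > 0"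
  obtains z g where "z \<in> S" "C1_on g UNIV" "\<And>x. 0 \<le> g x \<and> g x \<le> e"
    "\<And>x y. \<bar>g x - g y\<bar> \<le> e * norm (x - y)" "\<And>x. x \<in> S \<Longrightarrow> f z - g z \<le> f x - g x"
proof -
  obtain L where hC: "C1_on h UNIV" and L: "L \<ge> 0" "\<And>x y. \<bar>h x - h y\<bar> \<le> L * norm (x - y)"
    and h01: "\<And>x. 0 \<le> h x" "\<And>x. h x \<le> 1" and h0: "\<And>x. norm x \<ge> 1 \<Longrightarrow> h x = 0" and h1: "h 0 = 1"
    using h unfolding normalized_bump_def by (metis norm_zero)
  \<comment> \<open>Makes \<open>2 * e0\<close> and \<open>2 * e0 * L\<close> at most
    \<open>e\<close>; the heights will add up to \<open>8/7 * e0\<close> and the Lipschitz constants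
    to \<open>4/3 * e0 * L\<close>.\<close>
  define e0 where "e0 = e / (2 * (L + 1))"
  have e0: "e0 > 0" "2 * e0 \<le> e" "2 * e0 * L \<le> e"
  proof -
    show "e0 > 0" using e L(1) by (simp add: e0_def)
    moreover have "2 * e0 * L + 2 * e0 = 2 * (L + 1) * (e / (2 * (L + 1)))"
      unfolding e0_def by (simp only: ring_distribs mult_1_left mult_1_right) simp
    then have "2 * e0 * L + 2 * e0 = e" using L(1) by simp
    moreover have "0 \<le> 2 * e0 * L" using \<open>e0 > 0\<close> L(1) by simp
    ultimately show "2 * e0 \<le> e" "2 * e0 * L \<le> e" by linarith+
  qed
  define \<epsilon> where "\<epsilon> n = e0 / 8 ^ n" for n :: nat
  have \<epsilon>: "\<epsilon> n > 0" "\<epsilon> (Suc n) = \<epsilon> n / 8" for n using e0 by (auto simp: \<epsilon>_def)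
  have ex: "\<exists>z. z \<in> S \<and> (\<forall>x\<in>S. \<phi> z \<le> \<phi> x + \<epsilon> n / 2)" if "\<And>x. x \<in> S \<Longrightarrow> C \<le> \<phi> x" for \<phi> C n
  proof -
    have bb: "bdd_below (\<phi> ` S)" using that by (intro bdd_belowI2[of _ C])
    have ne: "\<phi> ` S \<noteq> {}" using S by auto
    have "Inf (\<phi> ` S) < Inf (\<phi> ` S) + \<epsilon> n / 2" using \<epsilon> by simp
    then obtain q where "q \<in> S" "\<phi> q < Inf (\<phi> ` S) + \<epsilon> n / 2"
      using cInf_lessD[OF ne] by (metis (no_types, lifting) imageE)
    moreover have "Inf (\<phi> ` S) \<le> \<phi> s" if "s \<in> S" for s
      using that bb by (simp add: cINF_lower)
    ultimately show ?thesis by (smt (verit))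
  qed
  define zsel where "zsel n \<phi> = (SOME z. z \<in> S \<and> (\<forall>x\<in>S. \<phi> z \<le> \<phi> x + \<epsilon> n / 2))" for n \<phi>
  \<comment> \<open>The recursion runs through the perturbed functions themselves, since the centre
    of the next bump is selected from the current one.\<close>
  define \<Phi> where "\<Phi> = rec_nat f (\<lambda>n \<phi> x. \<phi> x - \<epsilon> n * h (2 ^ n *\<^sub>R (x - zsel n \<phi>)))"
  define z where "z n = zsel n (\<Phi> n)" for n
  define b where "b n x = \<epsilon> n * h (2 ^ n *\<^sub>R (x - z n))" for n x
  have \<Phi>0: "\<Phi> 0 = f" and \<Phi>S: "\<Phi> (Suc n) x = \<Phi> n x - b n x" for n x
    by (simp_all add: \<Phi>_def b_def z_def)
  have b: "0 \<le> b n x" "b n x \<le> \<epsilon> n" for n x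
    using h01 \<epsilon>(1)[of n] by (auto simp: b_def mult_left_le)
  have \<Phi>: "\<Phi> n x = f x - (\<Sum>i<n. b i x)" for n x by (induction n) (simp_all add: \<Phi>0 \<Phi>S)
  have z: "z n \<in> S" "x \<in> S \<Longrightarrow> \<Phi> n (z n) \<le> \<Phi> n x + \<epsilon> n / 2" for n x
  proof -
    have "B - (\<Sum>i<n. \<epsilon> i) \<le> \<Phi> n x" if "x \<in> S" for x
      unfolding \<Phi> by (rule diff_mono[OF bdd[OF that] sum_mono[OF b(2)]])
    from ex[of "B - (\<Sum>i<n. \<epsilon> i)" "\<Phi> n" n, OF this]
    have "zsel n (\<Phi> n) \<in> S \<and> (\<forall>x\<in>S. \<Phi> n (zsel n (\<Phi> n)) \<le> \<Phi> n x + \<epsilon> n / 2)"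
      unfolding zsel_def by (rule someI_ex) blast
    then show "z n \<in> S" "x \<in> S \<Longrightarrow> \<Phi> n (z n) \<le> \<Phi> n x + \<epsilon> n / 2" by (auto simp: z_def)
  qed
  \<comment> \<open>The factor 8/7 is the geometric series with ratio 1/8: the heights of the bumps
    \<open>m\<close> to \<open>n - 1\<close> add up to exactly
    \<open>(8/7) * (\<epsilon> m - \<epsilon> n)\<close>.\<close>
  have tail: "\<Phi> m x - (8/7) * (\<epsilon> m - \<epsilon> n) \<le> \<Phi> n x \<and> \<Phi> n x \<le> \<Phi> m x" if "m \<le> n" for m n x
    using that
  proof (induction rule: dec_induct)
    case base show ?case using \<epsilon> by simp
  next
    case (step n)
    note * = b[of n x] \<Phi>S[of n x] \<epsilon>(2)[of n] conjunct1[OF step.IH] conjunct2[OF step.IH]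
    have "\<Phi> m x - 8 / 7 * (\<epsilon> m - \<epsilon> (Suc n)) \<le> \<Phi> (Suc n) x" using * by (simp add: field_simps)
    moreover have "\<Phi> (Suc n) x \<le> \<Phi> m x" using * by simp
    ultimately show ?case by (rule conjI)
  qed
  \<comment> \<open>Outside the \<open>n\<close>-th bump \<open>z k\<close> would forgo its height
    \<open>\<epsilon> n\<close>. The tolerances \<open>\<epsilon> n / 2\<close> and
    \<open>\<epsilon> k / 2\<close>, the latter at most \<open>\<epsilon> n / 16\<close>, and the
    later bumps, at most \<open>\<epsilon> n / 7\<close> in total, cannot compensate for
    that.\<close>
  have close: "norm (z k - z n) < 1 / 2 ^ n" if "n < k" for n k
  proof (rule ccontr)
    assume "\<not> ?thesis"
    then have "norm (2 ^ n *\<^sub>R (z k - z n)) \<ge> 1" by (simp add: divide_simps mult.commute)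
    then have "b n (z k) = 0" by (simp add: b_def h0)
    then have "\<Phi> (Suc n) (z k) = \<Phi> n (z k)" by (simp add: \<Phi>S)
    moreover have "\<Phi> n (z n) \<le> \<Phi> n (z k) + \<epsilon> n / 2" by (rule z)+
    moreover have "\<Phi> (Suc n) (z k) - (8/7) * (\<epsilon> (Suc n) - \<epsilon> k) \<le> \<Phi> k (z k)"
      using tail[of "Suc n" k "z k"] that by simp
    moreover have "\<Phi> k (z k) \<le> \<Phi> k (z n) + \<epsilon> k / 2" by (rule z)+
    moreover have "\<Phi> k (z n) \<le> \<Phi> (Suc n) (z n)" using tail[of "Suc n" k "z n"] that by simp
    moreover have "\<Phi> (Suc n) (z n) = \<Phi> n (z n) - \<epsilon> n" by (simp add: \<Phi>S b_def h1)
    moreover have "\<epsilon> k \<le> \<epsilon> n / 8"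
    proof -
      have "(8::real) ^ Suc n \<le> 8 ^ k" using that by (intro power_increasing) auto
      then show ?thesis using e0 by (simp add: \<epsilon>_def divide_simps)
    qed
    ultimately show False using \<epsilon>[of n] \<epsilon>(1)[of k] by (simp add: field_simps)
  qed
  have "Cauchy z"
  proof (rule metric_CauchyI)
    fix c :: real assume "c > 0"
    then obtain N where N: "(1/2) ^ N < c / 2" using real_arch_pow_inv[of "c/2" "1/2"] by auto
    have "dist (z m) (z n) < c" if "m > N" "n > N" for m n
      using close[OF that(1)] close[OF that(2)] N dist_triangle2[of "z m" "z n" "z N"]
      by (simp add: dist_norm power_one_over)
    then show "\<exists>M. \<forall>m\<ge>M. \<forall>n\<ge>M. dist (z m) (z n) < c" by (meson Suc_le_lessD)
  qed
  then obtain l where l: "z \<longlonglongrightarrow> l" by (meson Cauchy_convergent_iff convergent_def)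
  have lS: "l \<in> S" using S(1) z(1) l closed_sequentially by blast
  define g where "g x = (\<Sum>n. b n x)" for x
  have s8: "(\<lambda>n. (1/8::real) ^ n) sums (8/7)" using geometric_sums[of "1/8::real"] by simp
  have s\<epsilon>: "\<epsilon> sums (e0 * (8/7))"
    using sums_mult[OF s8, of e0] by (simp add: \<epsilon>_def[abs_def] power_one_over)
  \<comment> \<open>A bump of height \<open>e0 / 8 ^ n\<close> and width \<open>1 / 2 ^ n\<close>
    has Lipschitz constant \<open>e0 * L / 4 ^ n\<close>.\<close>
  define K where "K n = e0 * L * (1/4) ^ n" for n :: nat
  have sK: "K sums (e0 * L * (4/3))"
    unfolding K_def using sums_mult[OF geometric_sums[of "1/4::real"], of "e0 * L"] by simp
  have sb: "summable (\<lambda>n. b n x)" for x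
    by (rule summable_comparison_test'[OF sums_summable[OF s\<epsilon>]]) (use b in simp)
  have bL: "\<bar>b n x - b n y\<bar> \<le> K n * norm (x - y)" for n x y
  proof -
    have "\<bar>b n x - b n y\<bar> = \<epsilon> n * \<bar>h (2 ^ n *\<^sub>R (x - z n)) - h (2 ^ n *\<^sub>R (y - z n))\<bar>"
      using \<epsilon>(1)[of n] by (simp add: b_def abs_mult flip: right_diff_distrib)
    also have "\<dots> \<le> \<epsilon> n * (L * norm (2 ^ n *\<^sub>R (x - z n) - 2 ^ n *\<^sub>R (y - z n)))"
      using \<epsilon>(1)[of n] by (intro mult_left_mono L) auto
    also have "norm (2 ^ n *\<^sub>R (x - z n) - 2 ^ n *\<^sub>R (y - z n)) = 2 ^ n * norm (x - y)"
      by (simp flip: scaleR_diff_right)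
    also have "\<epsilon> n * (L * (2 ^ n * norm (x - y))) = K n * norm (x - y)"
    proof -
      have "(8::real) ^ n = 2 ^ n * 4 ^ n" by (simp flip: power_mult_distrib)
      then show ?thesis by (simp add: \<epsilon>_def K_def power_one_over)
    qed
    finally show ?thesis .
  qed
  have bC: "C1_on (b n) UNIV" for n
  proof -
    have "C1_on (\<lambda>x. 2 ^ n *\<^sub>R (x - z n)) UNIV"
      using C1_on_add[OF C1_on_bounded_linear[OF bounded_linear_scaleR_right[of "2 ^ n"]] C1_on_const[of "- (2 ^ n *\<^sub>R z n)" UNIV]]
      by (simp add: scaleR_diff_right)
    from C1_on_compose[OF hC this] have "C1_on (\<lambda>x. h (2 ^ n *\<^sub>R (x - z n))) UNIV" by simp
    then show ?thesis unfolding b_def by (rule C1_on_cmult)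
  qed
  have gC: "C1_on g UNIV" unfolding g_def[abs_def]
  proof (rule C1_on_suminf[OF bC _ sums_summable[OF s\<epsilon>] bL _ sums_summable[OF sK]])
    show "\<bar>b n x\<bar> \<le> \<epsilon> n" for n x using b by simp
    show "0 \<le> K n" for n using e0 L by (simp add: K_def)
  qed
  have g0: "0 \<le> g x" "g x \<le> e" for x
  proof -
    show "0 \<le> g x" unfolding g_def by (intro suminf_nonneg sb b)
    have "g x \<le> e0 * (8/7)" unfolding g_def
      using suminf_le[OF b(2)[of _ x] sb sums_summable[OF s\<epsilon>]] s\<epsilon> by (simp add: sums_iff)
    then show "g x \<le> e" using e0 by linarith
  qed
  have gL: "\<bar>g x - g y\<bar> \<le> e * norm (x - y)" for x y
  proof -
    have sd: "summable (\<lambda>n. b n x - b n y)" by (intro summable_diff sb)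
    have sKn: "summable (\<lambda>n. K n * norm (x - y))" by (intro summable_mult2 sums_summable[OF sK])
    have sda: "summable (\<lambda>n. \<bar>b n x - b n y\<bar>)"
      by (rule summable_comparison_test'[OF sKn]) (use bL in simp)
    have "g x - g y = (\<Sum>n. b n x - b n y)" unfolding g_def by (rule suminf_diff) (rule sb)+
    also have "\<bar>\<dots>\<bar> \<le> (\<Sum>n. \<bar>b n x - b n y\<bar>)" by (rule summable_rabs[OF sda])
    also have "\<dots> \<le> (\<Sum>n. K n * norm (x - y))" by (rule suminf_le[OF bL sda sKn])
    also have "\<dots> = e0 * L * (4/3) * norm (x - y)"
      using sums_mult2[OF sK, of "norm (x - y)"] by (simp add: sums_iff)
    also have "\<dots> \<le> e * norm (x - y)"
      using e0 L mult_nonneg_nonneg[of e0 L] by (intro mult_right_mono) auto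
    finally show ?thesis .
  qed
  have lim: "(\<lambda>n. \<Phi> n x) \<longlonglongrightarrow> f x - g x" for x
    unfolding \<Phi> g_def using summable_LIMSEQ[OF sb[of x]] by (intro tendsto_intros)
  have le: "f x - g x \<le> \<Phi> n x" for x n
    using lim[of x] by (rule LIMSEQ_le_const2) (use tail in blast)
  \<comment> \<open>The almost minimality of \<open>z n\<close> for \<open>\<Phi> n\<close> passes
    to the limit: \<open>\<Phi> n\<close> lies above \<open>f - g\<close>, which is lower
    semicontinuous along \<open>z\<close>, and \<open>\<Phi> n x\<close> converges to
    \<open>f x - g x\<close>.\<close>
  have "f l - g l \<le> f x - g x" if x: "x \<in> S" for x
  proof (rule ccontr)
    assume neg: "\<not> f l - g l \<le> f x - g x"
    define c where "c = (f x - g x + (f l - g l)) / 2"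
    have c: "f x - g x < c" "c < f l - g l" using neg by (auto simp: c_def)
    have "seq_lsc S (\<lambda>x. f x + - g x)"
      by (intro seq_lsc_add lsc seq_lsc_continuous continuous_on_minus
          continuous_on_subset[OF C1_on_continuous_on[OF gC]]) simp
    then have "\<forall>\<^sub>F n in sequentially. c < f (z n) + - g (z n)"
      by (rule seq_lscD[OF _ z(1) lS l]) (use c in simp)
    then have "\<forall>\<^sub>F n in sequentially. c \<le> \<Phi> n x + \<epsilon> n / 2"
    proof eventually_elim
      case (elim n) then show ?case using z(2)[OF x, of n] le[of "z n" n] by simp
    qed
    moreover have "(\<lambda>n. \<Phi> n x + \<epsilon> n / 2) \<longlonglongrightarrow> (f x - g x) + 0 / 2"
      by (intro tendsto_intros lim summable_LIMSEQ_zero[OF sums_summable[OF s\<epsilon>]]) simp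
    ultimately have "c \<le> f x - g x" using tendsto_lowerbound by fastforce
    with c show False by simp
  qed
  then show ?thesis using that[OF lS gC] g0 gL by blast
qed

text \<open>A fuzzy sum rule: the three variables are decoupled by a penalty which is a single bump of
  small width. Its steepness does no harm, as its derivatives cancel in the sum.\<close>

lemma fuzzy_sum_rule:
  fixes f1 f2 f3 :: "'a::banach \<Rightarrow> real"
  assumes h: "normalized_bump (h :: 'a \<Rightarrow> real)" and R: "R > 0"
    and lsc: "seq_lsc (cball z0 R) f2" and bdd: "\<And>x. x \<in> cball z0 R \<Longrightarrow> B \<le> f2 x"
    and lip1: "\<And>x y. x \<in> cball z0 R \<Longrightarrow> y \<in> cball z0 R \<Longrightarrow> \<bar>f1 x - f1 y\<bar> \<le> K1 * norm (x - y)"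
    and lip3: "\<And>x y. x \<in> cball z0 R \<Longrightarrow> y \<in> cball z0 R \<Longrightarrow> \<bar>f3 x - f3 y\<bar> \<le> K3 * norm (x - y)"
    and K: "K1 \<ge> 0" "K3 \<ge> 0"
    and min: "\<And>x. x \<in> cball z0 R \<Longrightarrow> f1 z0 + f2 z0 + f3 z0 + c * norm (x - z0) \<le> f1 x + f2 x + f3 x"
    and c: "c > 0" and \<eta>: "\<eta> > 0"
  obtains z1 z2 z3 g1 g2 g3 q1 q2 q3 where
    "norm (z1 - z0) < \<eta>" "norm (z2 - z0) < \<eta>" "norm (z3 - z0) < \<eta>"
    "norm (z1 - z0) < R" "norm (z2 - z0) < R" "norm (z3 - z0) < R"
    "C1_on g1 UNIV" "C1_on g2 UNIV" "C1_on g3 UNIV"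
    "(g1 has_derivative q1) (at z1)" "(g2 has_derivative q2) (at z2)" "(g3 has_derivative q3) (at z3)"
    "\<And>x. x \<in> cball z0 R \<Longrightarrow> f1 z1 + g1 z1 \<le> f1 x + g1 x"
    "\<And>x. x \<in> cball z0 R \<Longrightarrow> f2 z2 + g2 z2 \<le> f2 x + g2 x"
    "\<And>x. x \<in> cball z0 R \<Longrightarrow> f3 z3 + g3 z3 \<le> f3 x + g3 x"
    "\<And>w. \<bar>q1 w + q2 w + q3 w\<bar> \<le> \<eta> * norm w"
proof -
  define S where "S = cball z0 R"
  have z0S: "z0 \<in> S" using R by (simp add: S_def)
  have hC: "C1_on h UNIV" and h01: "\<And>x. 0 \<le> h x" "\<And>x. h x \<le> 1"
    and h0: "\<And>x. norm x \<ge> 1 \<Longrightarrow> h x = 0"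
    using h unfolding normalized_bump_def by blast+
  have h1: "h 0 = 1"
  proof -
    obtain r where "r > 0" "\<forall>x. norm x < r \<longrightarrow> h x = 1" using h unfolding normalized_bump_def by blast
    then show ?thesis by simp
  qed
  define m where "m = f1 z0 + f2 z0 + f3 z0"
  define Bl where "Bl = (f1 z0 - K1 * R) + B + (f3 z0 - K3 * R)"
  \<comment> \<open>\<open>J\<close> will be at most \<open>m + 1\<close> at the minimizer and is at
    least \<open>Bl\<close> plus the penalties, so neither penalty can reach the full height
    \<open>Kp\<close>; below full height its argument has norm less than \<open>r\<close>.\<close>
  define Kp where "Kp = m - Bl + 2"
  have low1: "f1 z0 - K1 * R \<le> f1 x" and low3: "f3 z0 - K3 * R \<le> f3 x" if "x \<in> S" for x
  proof -
    have "norm (x - z0) \<le> R" using that by (simp add: S_def dist_norm norm_minus_commute)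
    then have "K1 * norm (x - z0) \<le> K1 * R" "K3 * norm (x - z0) \<le> K3 * R"
      using K by (auto intro: mult_left_mono)
    with lip1[of x z0] lip3[of x z0] that z0S show "f1 z0 - K1 * R \<le> f1 x" "f3 z0 - K3 * R \<le> f3 x"
      by (auto simp: S_def)
  qed
  have low2: "B \<le> f2 x" if "x \<in> S" for x using bdd that by (simp add: S_def)
  have Kp: "Kp > 0" using low1[OF z0S] low2[OF z0S] low3[OF z0S] by (simp add: Kp_def Bl_def m_def)
  define \<eta>' where "\<eta>' = min R \<eta>"
  have \<eta>': "\<eta>' > 0" "\<eta>' \<le> R" "\<eta>' \<le> \<eta>" using R \<eta> by (auto simp: \<eta>'_def)
  \<comment> \<open>The first bound keeps the three points within \<open>\<eta>'\<close> of
    \<open>z0\<close>; the second makes the cost of moving the arguments of \<open>f1\<close> and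
    \<open>f3\<close> to \<open>z2\<close>, at most \<open>(K1 + K3) * r\<close>, small against the
    growth \<open>c * \<eta>'\<close>.\<close>
  define r where "r = min (\<eta>' / 2) (c * \<eta>' / (8 * (K1 + K3 + 1)))"
  have r: "r > 0" "r \<le> \<eta>' / 2"
    using \<eta>' c K unfolding r_def by (simp, intro min.cobounded1)
  have rK: "(K1 + K3) * r \<le> c * \<eta>' / 8"
  proof -
    have "r \<le> c * \<eta>' / (8 * (K1 + K3 + 1))" by (simp add: r_def)
    then have "(K1 + K3 + 1) * r \<le> (K1 + K3 + 1) * (c * \<eta>' / (8 * (K1 + K3 + 1)))"
      using K by (intro mult_left_mono) auto
    also have "\<dots> = c * \<eta>' / 8" using K by (simp add: field_simps)
    finally show ?thesis using r by (simp add: distrib_right)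
  qed
  \<comment> \<open>In this order: \<open>J\<close> stays at most \<open>m + 1\<close>, the
    derivative of the perturbation at \<open>(w, w, w)\<close> stays below
    \<open>\<eta> * norm w\<close>, and the perturbation is small against the growth rate
    \<open>c\<close>.\<close>
  define e where "e = min 1 (min (\<eta> / 3) (c * \<eta>' / 8))"
  have e: "e > 0" "e \<le> 1" "3 * e \<le> \<eta>" "e \<le> c * \<eta>' / 8" using \<eta> \<eta>' c by (auto simp: e_def)
  define pen where "pen w = Kp * (1 - h ((1 / r) *\<^sub>R w))" for w
  have penC: "C1_on pen UNIV"
  proof -
    have "C1_on (\<lambda>w. h ((1 / r) *\<^sub>R w)) UNIV"
      using C1_on_compose[of h UNIV "\<lambda>w. (1 / r) *\<^sub>R w" UNIV] hC
        C1_on_bounded_linear[OF bounded_linear_scaleR_right[of "1 / r"]] by blast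
    then show ?thesis unfolding pen_def by (intro C1_on_cmult C1_on_diff C1_on_const)
  qed
  have pen: "0 \<le> pen w" "pen 0 = 0" for w
    using Kp h01[of "(1 / r) *\<^sub>R w"] by (simp_all add: pen_def h1)
  have pen_small: "norm w < r" if "pen w < Kp" for w
  proof (rule ccontr)
    assume "\<not> ?thesis"
    then have "norm ((1 / r) *\<^sub>R w) \<ge> 1" using r by simp
    then have "h ((1 / r) *\<^sub>R w) = 0" by (rule h0)
    with that show False by (simp add: pen_def)
  qed
  \<comment> \<open>The merely semicontinuous \<open>f2\<close> is in the middle of the chain, so
    that both Lipschitz functions are coupled directly to its argument and only their values are
    ever compared at different points.\<close>
  define J where "J z = f1 (fst z) + (f2 (fst (snd z)) + (f3 (snd (snd z)) +
      (pen (fst z - fst (snd z)) + pen (fst (snd z) - snd (snd z)))))" for z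
  have J: "J (x, y, w) = f1 x + (f2 y + (f3 w + (pen (x - y) + pen (y - w))))" for x y w
    by (simp add: J_def)
  define S3 where "S3 = S \<times> S \<times> S"
  have S3: "closed S3" "S3 \<noteq> {}" using z0S by (auto simp: S3_def S_def intro!: closed_Times)
  have cont_lip: "continuous_on S f" if "\<And>x y. x \<in> S \<Longrightarrow> y \<in> S \<Longrightarrow> \<bar>f x - f y\<bar> \<le> K * norm (x - y)" "K \<ge> 0"
    for f :: "'a \<Rightarrow> real" and K
  proof -
    have "K-lipschitz_on S f" using that by (intro lipschitz_onI) (auto simp: dist_norm)
    then show ?thesis by (rule lipschitz_on_continuous_on)
  qed
  have lsc3: "seq_lsc S3 J" unfolding J_def
  proof (intro seq_lsc_add)
    show "seq_lsc S3 (\<lambda>z. f1 (fst z))"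
      by (rule seq_lsc_compose[OF seq_lsc_continuous[OF cont_lip[of f1 K1]]])
         (use lip1 K in \<open>auto simp: S3_def S_def intro!: continuous_intros\<close>)
    show "seq_lsc S3 (\<lambda>z. f3 (snd (snd z)))"
      by (rule seq_lsc_compose[OF seq_lsc_continuous[OF cont_lip[of f3 K3]]])
         (use lip3 K in \<open>auto simp: S3_def S_def intro!: continuous_intros\<close>)
    show "seq_lsc S3 (\<lambda>z. f2 (fst (snd z)))"
      by (rule seq_lsc_compose[OF lsc]) (auto simp: S3_def S_def intro!: continuous_intros)
    show "seq_lsc S3 (\<lambda>z. pen (fst z - fst (snd z)))"
      by (rule seq_lsc_continuous, rule continuous_on_compose2[OF C1_on_continuous_on[OF penC]])
         (auto intro!: continuous_intros)
    show "seq_lsc S3 (\<lambda>z. pen (fst (snd z) - snd (snd z)))"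
      by (rule seq_lsc_continuous, rule continuous_on_compose2[OF C1_on_continuous_on[OF penC]])
         (auto intro!: continuous_intros)
  qed
  have Jlow: "Bl + pen (x - y) + pen (y - w) \<le> J (x, y, w)" if "x \<in> S" "y \<in> S" "w \<in> S" for x y w
    using low1[OF that(1)] low2[OF that(2)] low3[OF that(3)] unfolding J Bl_def by linarith
  have Jbdd: "Bl \<le> J z" if "z \<in> S3" for z
  proof -
    obtain x y w where z: "z = (x, y, w)" by (cases z) auto
    show ?thesis using Jlow[of x y w] that pen(1)[of "x - y"] pen(1)[of "y - w"] unfolding z S3_def by auto
  qed
  obtain z g where zS: "z \<in> S3" and gC: "C1_on g UNIV" and g0: "\<And>x. 0 \<le> g x \<and> g x \<le> e"
    and gL: "\<And>x y. \<bar>g x - g y\<bar> \<le> e * norm (x - y)" and zmin: "\<And>x. x \<in> S3 \<Longrightarrow> J z - g z \<le> J x - g x"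
    using smooth_variational_principle[OF normalized_bump_prod[OF h normalized_bump_prod[OF h h]]
        S3 lsc3 Jbdd e(1)] by metis
  obtain z1 z2 z3 where z: "z = (z1, z2, z3)" by (cases z) auto
  have zS: "z1 \<in> S" "z2 \<in> S" "z3 \<in> S" using zS by (auto simp: z S3_def)
  have "J z \<le> J (z0, z0, z0) + e"
    using zmin[of "(z0, z0, z0)"] g0[of z] g0[of "(z0, z0, z0)"] z0S by (simp add: S3_def)
  then have Jz: "J (z1, z2, z3) \<le> m + e" by (simp add: z J[of z0] pen m_def)
  have "pen (z1 - z2) < Kp" "pen (z2 - z3) < Kp"
    using Jlow[OF zS] Jz e pen(1)[of "z1 - z2"] pen(1)[of "z2 - z3"] by (auto simp: Kp_def)
  then have near: "norm (z1 - z2) < r" "norm (z2 - z3) < r" by (auto intro: pen_small)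
  have d2: "norm (z2 - z0) \<le> \<eta>' / 4"
  proof -
    have "m + c * norm (z2 - z0) \<le> f1 z2 + f2 z2 + f3 z2"
      using min[of z2] zS by (simp add: S_def m_def)
    also have "\<dots> \<le> f1 z1 + K1 * r + f2 z2 + (f3 z3 + K3 * r)"
    proof -
      have "K1 * norm (z1 - z2) \<le> K1 * r" "K3 * norm (z2 - z3) \<le> K3 * r"
        using near K by (auto intro: mult_left_mono)
      then show ?thesis using lip1[of z1 z2] lip3[of z2 z3] zS by (auto simp: S_def)
    qed
    also have "\<dots> \<le> J (z1, z2, z3) + (K1 + K3) * r"
      using pen(1)[of "z1 - z2"] pen(1)[of "z2 - z3"] by (simp add: J distrib_right)
    also have "\<dots> \<le> m + e + c * \<eta>' / 8" using Jz rK by linarith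
    finally have "c * norm (z2 - z0) \<le> c * (\<eta>' / 4)" using e by simp
    then show ?thesis using c by simp
  qed
  have d1: "norm (z1 - z0) < \<eta>'"
    using norm_triangle_ineq[of "z1 - z2" "z2 - z0"] near d2 r \<eta>' by simp
  have d3: "norm (z3 - z0) < \<eta>'"
    using norm_triangle_ineq[of "z3 - z2" "z2 - z0"] near d2 r \<eta>' by (simp add: norm_minus_commute)
  obtain P12 where P12: "(pen has_derivative P12) (at (z1 - z2))" using C1_on_frechet(1)[OF penC] by blast
  obtain P23 where P23: "(pen has_derivative P23) (at (z2 - z3))" using C1_on_frechet(1)[OF penC] by blast
  obtain G where G: "(g has_derivative G) (at (z1, z2, z3))" using C1_on_frechet(1)[OF gC] by blast
  interpret P12: bounded_linear P12 using P12 by (rule has_derivative_bounded_linear)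
  interpret P23: bounded_linear P23 using P23 by (rule has_derivative_bounded_linear)
  interpret G: bounded_linear G using G by (rule has_derivative_bounded_linear)
  \<comment> \<open>Freezing two of the three variables at the joint minimizer leaves a minimum of
    one \<open>f\<close> plus a C1 function of the remaining variable.\<close>
  define g1 where "g1 x = pen (x - z2) - g (x, z2, z3)" for x
  define g2 where "g2 x = pen (z1 - x) + pen (x - z3) - g (z1, x, z3)" for x
  define g3 where "g3 x = pen (z2 - x) - g (z1, z2, x)" for x
  have shift: "C1_on (\<lambda>x. pen (x - a)) UNIV" "C1_on (\<lambda>x. pen (a - x)) UNIV" for a
  proof -
    have "C1_on (\<lambda>x. x - a) UNIV" using C1_on_add[OF C1_on_id C1_on_const[of "- a"]] by simp
    then show "C1_on (\<lambda>x. pen (x - a)) UNIV" using C1_on_compose[OF penC] by simp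
    have "C1_on (\<lambda>x. a - x) UNIV"
      using C1_on_add[OF C1_on_const[of a] C1_on_bounded_linear[OF bounded_linear_minus[OF bounded_linear_ident]]] by simp
    then show "C1_on (\<lambda>x. pen (a - x)) UNIV" using C1_on_compose[OF penC] by simp
  qed
  have sect: "C1_on (\<lambda>x. g (x, z2, z3)) UNIV" "C1_on (\<lambda>x. g (z1, x, z3)) UNIV" "C1_on (\<lambda>x. g (z1, z2, x)) UNIV"
    using C1_on_compose[OF gC C1_on_Pair[OF C1_on_id C1_on_const[of "(z2, z3)"]]]
      C1_on_compose[OF gC C1_on_Pair[OF C1_on_const[of z1] C1_on_Pair[OF C1_on_id C1_on_const[of z3]]]]
      C1_on_compose[OF gC C1_on_Pair[OF C1_on_const[of z1] C1_on_Pair[OF C1_on_const[of z2] C1_on_id]]]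
    by simp_all
  have C: "C1_on g1 UNIV" "C1_on g2 UNIV" "C1_on g3 UNIV"
    unfolding g1_def g2_def g3_def by (intro C1_on_diff C1_on_add shift sect)+
  have q1: "(g1 has_derivative (\<lambda>w. P12 w - G (w, 0, 0))) (at z1)"
    unfolding g1_def
  proof (rule has_derivative_diff)
    show "((\<lambda>x. pen (x - z2)) has_derivative P12) (at z1)"
      by (rule has_derivative_compose[of "\<lambda>x. x - z2" "\<lambda>w. w" z1 UNIV pen P12, OF _ P12]) (auto intro!: derivative_eq_intros)
    show "((\<lambda>x. g (x, z2, z3)) has_derivative (\<lambda>w. G (w, 0, 0))) (at z1)"
      by (rule has_derivative_compose[of "\<lambda>x. (x, z2, z3)" "\<lambda>w. (w, 0, 0)" z1 UNIV g G, OF _ G]) (intro has_derivative_Pair has_derivative_ident has_derivative_const)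
  qed
  have q2: "(g2 has_derivative (\<lambda>w. P12 (- w) + P23 w - G (0, w, 0))) (at z2)"
    unfolding g2_def
  proof (intro has_derivative_diff has_derivative_add)
    show "((\<lambda>x. pen (z1 - x)) has_derivative (\<lambda>w. P12 (- w))) (at z2)"
      by (rule has_derivative_compose[of "\<lambda>x. z1 - x" "\<lambda>w. - w" z2 UNIV pen P12, OF _ P12]) (auto intro!: derivative_eq_intros)
    show "((\<lambda>x. pen (x - z3)) has_derivative P23) (at z2)"
      by (rule has_derivative_compose[of "\<lambda>x. x - z3" "\<lambda>w. w" z2 UNIV pen P23, OF _ P23]) (auto intro!: derivative_eq_intros)
    show "((\<lambda>x. g (z1, x, z3)) has_derivative (\<lambda>w. G (0, w, 0))) (at z2)"
      by (rule has_derivative_compose[of "\<lambda>x. (z1, x, z3)" "\<lambda>w. (0, w, 0)" z2 UNIV g G, OF _ G]) (intro has_derivative_Pair has_derivative_ident has_derivative_const)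
  qed
  have q3: "(g3 has_derivative (\<lambda>w. P23 (- w) - G (0, 0, w))) (at z3)"
    unfolding g3_def
  proof (rule has_derivative_diff)
    show "((\<lambda>x. pen (z2 - x)) has_derivative (\<lambda>w. P23 (- w))) (at z3)"
      by (rule has_derivative_compose[of "\<lambda>x. z2 - x" "\<lambda>w. - w" z3 UNIV pen P23, OF _ P23]) (auto intro!: derivative_eq_intros)
    show "((\<lambda>x. g (z1, z2, x)) has_derivative (\<lambda>w. G (0, 0, w))) (at z3)"
      by (rule has_derivative_compose[of "\<lambda>x. (z1, z2, x)" "\<lambda>w. (0, 0, w)" z3 UNIV g G, OF _ G]) (intro has_derivative_Pair has_derivative_ident has_derivative_const)
  qed
  \<comment> \<open>In the diagonal direction \<open>(w, w, w)\<close> both penalties are constant,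
    so only the small perturbation contributes.\<close>
  have sum: "\<bar>(P12 w - G (w, 0, 0)) + (P12 (- w) + P23 w - G (0, w, 0)) + (P23 (- w) - G (0, 0, w))\<bar> \<le> \<eta> * norm w" for w
  proof -
    have "G (w, 0, 0) + G (0, w, 0) + G (0, 0, w) = G (w, w, w)" by (simp flip: G.add)
    then have "(P12 w - G (w, 0, 0)) + (P12 (- w) + P23 w - G (0, w, 0)) + (P23 (- w) - G (0, 0, w)) = - G (w, w, w)"
      by (simp add: P12.neg P23.neg)
    then have "\<bar>(P12 w - G (w, 0, 0)) + (P12 (- w) + P23 w - G (0, w, 0)) + (P23 (- w) - G (0, 0, w))\<bar> = \<bar>G (w, w, w)\<bar>"
      by simp
    also have "\<dots> \<le> e * norm (w, w, w)" by (rule Lipschitz_derivative_bound[OF G gL])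
    also have "\<dots> \<le> e * (3 * norm w)"
      using norm_Pair_le[of w "(w, w)"] norm_Pair_le[of w w] e(1) by (intro mult_left_mono) auto
    also have "\<dots> \<le> \<eta> * norm w" using mult_right_mono[OF e(3), of "norm w"] by simp
    finally show ?thesis .
  qed
  have m1: "f1 z1 + g1 z1 \<le> f1 x + g1 x" if "x \<in> cball z0 R" for x
    using zmin[of "(x, z2, z3)"] that zS by (simp add: z J g1_def S3_def S_def)
  have m2: "f2 z2 + g2 z2 \<le> f2 x + g2 x" if "x \<in> cball z0 R" for x
    using zmin[of "(z1, x, z3)"] that zS by (simp add: z J g2_def S3_def S_def)
  have m3: "f3 z3 + g3 z3 \<le> f3 x + g3 x" if "x \<in> cball z0 R" for x
    using zmin[of "(z1, z2, x)"] that zS by (simp add: z J g3_def S3_def S_def)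
  have d: "norm (z1 - z0) < \<eta>" "norm (z2 - z0) < \<eta>" "norm (z3 - z0) < \<eta>"
    "norm (z1 - z0) < R" "norm (z2 - z0) < R" "norm (z3 - z0) < R"
    using d1 d2 d3 \<eta>' by linarith+
  show ?thesis
    by (rule that[OF d C q1 q2 q3 m1 m2 m3 sum])
qed

section \<open>Charts and tangent vectors\<close>

definition dT :: "('m, 'b::real_normed_vector) chart \<Rightarrow> ('m, 'b) chart \<Rightarrow> 'm \<Rightarrow> 'b \<Rightarrow> 'b" where
  "dT c c' x = frechet_derivative (transition c c') (at (snd c x))"

context C1_Finsler_manifold begin

lemma chart_facts:
  assumes "c \<in> A"
  shows "open (fst c)" "open (snd c ` fst c)"
    "homeomorphism (fst c) (snd c ` fst c) (snd c) (chart_inv c)"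
  using C1_structure assms unfolding C1_structure_def is_chart_def by blast+

lemma charts_atD: "c \<in> charts_at A x \<Longrightarrow> c \<in> A" "c \<in> charts_at A x \<Longrightarrow> x \<in> fst c"
  by (auto simp: charts_at_def)

lemma charts_at_nonempty: obtains c where "c \<in> charts_at A x"
proof -
  have "x \<in> (\<Union>c\<in>A. fst c)" using C1_structure unfolding C1_structure_def by simp
  then show ?thesis using that by (auto simp: charts_at_def)
qed

lemma chart_inv_left: "c \<in> A \<Longrightarrow> x \<in> fst c \<Longrightarrow> chart_inv c (snd c x) = x"
  by (rule homeomorphism_apply1[OF chart_facts(3)])

lemma chart_inv_right: "c \<in> A \<Longrightarrow> y \<in> snd c ` fst c \<Longrightarrow> snd c (chart_inv c y) = y"
  using chart_facts(3) by (rule homeomorphism_apply2)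

lemma chart_inv_in: "c \<in> A \<Longrightarrow> y \<in> snd c ` fst c \<Longrightarrow> chart_inv c y \<in> fst c"
  by (metis chart_inv_left imageE)

lemma continuous_on_chart: "c \<in> A \<Longrightarrow> continuous_on (fst c) (snd c)"
  using chart_facts(3) by (rule homeomorphism_cont1)

lemma continuous_on_chart_inv: "c \<in> A \<Longrightarrow> continuous_on (snd c ` fst c) (chart_inv c)"
  using chart_facts(3) by (rule homeomorphism_cont2)

lemma open_chart_image: "c \<in> A \<Longrightarrow> open W \<Longrightarrow> W \<subseteq> fst c \<Longrightarrow> open (snd c ` W)"
proof -
  assume c: "c \<in> A" "open W" "W \<subseteq> fst c"
  have "openin (top_of_set (snd c ` fst c)) (snd c ` W)"
    using chart_facts(3)[OF c(1)]
    by (rule homeomorphism_imp_open_map) (use c chart_facts(1)[OF c(1)] in \<open>simp add: openin_open_eq\<close>)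
  then show ?thesis using chart_facts(2)[OF c(1)] by (simp add: openin_open_eq)
qed

lemma open_chart_vimage: "c \<in> A \<Longrightarrow> open V \<Longrightarrow> open (fst c \<inter> snd c -` V)"
  using continuous_open_preimage[OF continuous_on_chart] chart_facts(1) by blast

lemma transition_apply: "c \<in> A \<Longrightarrow> x \<in> fst c \<Longrightarrow> transition c c' (snd c x) = snd c' x"
  by (simp add: transition_def chart_inv_left)

lemma C1_on_transition: "c \<in> A \<Longrightarrow> c' \<in> A \<Longrightarrow> C1_on (transition c c') (snd c ` (fst c \<inter> fst c'))"
  using C1_structure unfolding C1_structure_def C1_compatible_def by blast

lemma dT_has_derivative:
  assumes "c \<in> charts_at A x" "c' \<in> charts_at A x"
  shows "(transition c c' has_derivative dT c c' x) (at (snd c x))"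
  unfolding dT_def using assms
  by (intro C1_on_frechet(1)[OF C1_on_transition]) (auto simp: charts_at_def)

lemma bounded_linear_dT:
  "c \<in> charts_at A x \<Longrightarrow> c' \<in> charts_at A x \<Longrightarrow> bounded_linear (dT c c' x)"
  using dT_has_derivative by (rule has_derivative_bounded_linear)

lemma dT_comp:
  assumes "c \<in> charts_at A x" "c' \<in> charts_at A x" "c'' \<in> charts_at A x"
  shows "dT c' c'' x (dT c c' x v) = dT c c'' x v"
proof -
  let ?W = "snd c ` (fst c \<inter> fst c' \<inter> fst c'')"
  have W: "open ?W" "snd c x \<in> ?W"
  proof -
    have "open (fst c \<inter> fst c' \<inter> fst c'')"
      by (intro open_Int chart_facts(1) charts_atD(1)[OF assms(1)] charts_atD(1)[OF assms(2)] charts_atD(1)[OF assms(3)])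
    then show "open ?W" by (rule open_chart_image[OF charts_atD(1)[OF assms(1)]]) blast
    show "snd c x \<in> ?W" by (rule imageI) (use assms in \<open>simp add: charts_at_def\<close>)
  qed
  have c: "c \<in> A" "c' \<in> A" "x \<in> fst c" using assms by (simp_all add: charts_at_def)
  have "(transition c' c'' has_derivative dT c' c'' x) (at (transition c c' (snd c x)))"
    using dT_has_derivative[OF assms(2,3)] c by (simp add: transition_apply)
  from has_derivative_compose[OF dT_has_derivative[OF assms(1,2)] this]
  have "((\<lambda>y. transition c' c'' (transition c c' y)) has_derivative (\<lambda>v. dT c' c'' x (dT c c' x v))) (at (snd c x))" .
  then have "(transition c c'' has_derivative (\<lambda>v. dT c' c'' x (dT c c' x v))) (at (snd c x))"
  proof (rule has_derivative_transform_within_open[OF _ W])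
    fix y assume "y \<in> ?W"
    then show "transition c' c'' (transition c c' y) = transition c c'' y"
      using c by (auto simp: transition_apply)
  qed
  from has_derivative_unique[OF this dT_has_derivative[OF assms(1,3)]] show ?thesis by (rule fun_cong)
qed

lemma dT_self:
  assumes "c \<in> charts_at A x" shows "dT c c x v = v"
proof -
  have c: "c \<in> A" "x \<in> fst c" using assms by (auto simp: charts_at_def)
  have "(transition c c has_derivative (\<lambda>v. v)) (at (snd c x))"
    by (rule has_derivative_transform_within_open[OF has_derivative_ident chart_facts(2)[OF c(1)]])
       (use c in \<open>auto simp: transition_apply\<close>)
  then show ?thesis using has_derivative_unique[OF _ dT_has_derivative[OF assms assms]] by metis
qed

section \<open>Tangent vectors and their norms in coordinates\<close>

lemma tangent_of_apply: "c' \<in> charts_at A x \<Longrightarrow> tangent_of A c x v c' = dT c c' x v"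
  by (simp add: tangent_of_def dT_def)

lemma tangent_of_in:
  assumes "c \<in> charts_at A x" shows "tangent_of A c x v \<in> tangent_space A x"
  unfolding tangent_space_def
proof (intro CollectI conjI ballI allI impI)
  fix c' c'' assume *: "c' \<in> charts_at A x" "c'' \<in> charts_at A x"
  show "tangent_of A c x v c'' = frechet_derivative (transition c' c'') (at (snd c' x)) (tangent_of A c x v c')"
    using dT_comp[OF assms *] by (simp add: tangent_of_apply * flip: dT_def)
qed (simp add: tangent_of_def)

text \<open>The transition rule recovers all coordinates from a single one, so each chart identifies
  the tangent space with the model space, where norms and covectors may be computed.\<close>

lemma tangent_of_eq:
  assumes "c \<in> charts_at A x" "\<xi> \<in> tangent_space A x" shows "tangent_of A c x (\<xi> c) = \<xi>"
proof
  fix c' show "tangent_of A c x (\<xi> c) c' = \<xi> c'"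
  proof (cases "c' \<in> charts_at A x")
    case True
    then have "\<xi> c' = dT c c' x (\<xi> c)" using assms unfolding tangent_space_def dT_def by blast
    with True show ?thesis by (simp only: tangent_of_apply)
  next
    case False
    with assms(2) have "\<xi> c' = 0" unfolding tangent_space_def by blast
    with False show ?thesis by (simp add: tangent_of_def)
  qed
qed

text \<open>Fixing the chart puts the norms of all tangent spaces over its domain on one Banach
  space, where P2 compares them.\<close>

definition cnorm :: "('m, 'b) chart \<Rightarrow> 'm \<Rightarrow> 'b \<Rightarrow> real" where
  "cnorm c x v = F x (tangent_of A c x v)"

lemma cnorm_change:
  assumes "c \<in> charts_at A x" "c' \<in> charts_at A x"
  shows "cnorm c' x (dT c c' x v) = cnorm c x v"
proof -
  have "tangent_of A c' x (dT c c' x v) = tangent_of A c x v"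
    using tangent_of_eq[OF assms(2) tangent_of_in[OF assms(1)]] by (simp add: tangent_of_apply assms)
  then show ?thesis by (simp add: cnorm_def)
qed

lemma
  assumes c: "c \<in> charts_at A x"
  shows cnorm_nonneg: "0 \<le> cnorm c x v" and cnorm_scale: "cnorm c x (r *\<^sub>R v) = \<bar>r\<bar> * cnorm c x v"
    and cnorm_triangle: "cnorm c x (v + w) \<le> cnorm c x v + cnorm c x w"
proof -
  note P = P1_norm[of x, unfolded norm_on_tangent_space_def]
  have lin: "tangent_of A c x (r *\<^sub>R v) = (\<lambda>c'. r *\<^sub>R tangent_of A c x v c')" for r v
  proof
    fix c' show "tangent_of A c x (r *\<^sub>R v) c' = r *\<^sub>R tangent_of A c x v c'"
      using linear_cmul[OF bounded_linear.linear[OF bounded_linear_dT[OF c]], of c']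
      by (cases "c' \<in> charts_at A x") (simp_all add: tangent_of_def flip: dT_def)
  qed
  have add: "tangent_of A c x (v + w) = (\<lambda>c'. tangent_of A c x v c' + tangent_of A c x w c')"
  proof
    fix c' show "tangent_of A c x (v + w) c' = tangent_of A c x v c' + tangent_of A c x w c'"
      using linear_add[OF bounded_linear.linear[OF bounded_linear_dT[OF c]], of c']
      by (cases "c' \<in> charts_at A x") (simp_all add: tangent_of_def flip: dT_def)
  qed
  show "0 \<le> cnorm c x v" "cnorm c x (r *\<^sub>R v) = \<bar>r\<bar> * cnorm c x v"
    "cnorm c x (v + w) \<le> cnorm c x v + cnorm c x w"
    using P tangent_of_in[OF c] by (simp_all add: cnorm_def lin add)
qed

lemma cnorm_minus: "c \<in> charts_at A x \<Longrightarrow> cnorm c x (- v) = cnorm c x v"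
  using cnorm_scale[of c x "-1" v] by simp

lemma cnorm_equiv:
  assumes "c \<in> charts_at A x"
  obtains k K where "k > 0" "K > 0" "\<And>v. k * norm v \<le> cnorm c x v" "\<And>v. cnorm c x v \<le> K * norm v"
  using P1_equivalent[OF assms] unfolding equivalent_norm_def cnorm_def by blast

lemma cnorm_P2:
  assumes "e > 0" "c \<in> charts_at A x0"
  obtains W where "open W" "x0 \<in> W" "W \<subseteq> fst c"
    "\<And>x v. x \<in> W \<Longrightarrow> cnorm c x0 v \<le> (1 + e) * cnorm c x v"
    "\<And>x v. x \<in> W \<Longrightarrow> cnorm c x v \<le> (1 + e) * cnorm c x0 v"
proof -
  from P2[OF assms] obtain W where W: "open W" "x0 \<in> W" "W \<subseteq> fst c"
    "\<And>x v. x \<in> W \<Longrightarrow> 1 / (1 + e) * cnorm c x0 v \<le> cnorm c x v \<and> cnorm c x v \<le> (1 + e) * cnorm c x0 v"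
    unfolding cnorm_def by blast
  have "cnorm c x0 v \<le> (1 + e) * cnorm c x v" if "x \<in> W" for x v
    using W(4)[OF that, of v] assms(1) by (simp add: pos_divide_le_eq mult.commute)
  then show ?thesis using that W by blast
qed

text \<open>Two errors are separated: P2 moves the base point at a factor
  \<open>1 + \<delta>\<close>, and the equivalence of norms at the fixed base point
  \<open>\<gamma> t0\<close> controls the change of the vector.\<close>

lemma continuous_on_cnorm:
  fixes D :: "'a::topological_space \<Rightarrow> 'b"
  assumes c: "c \<in> A" and \<gamma>: "continuous_on S \<gamma>" "\<gamma> ` S \<subseteq> fst c" and D: "continuous_on S D"
  shows "continuous_on S (\<lambda>t. cnorm c (\<gamma> t) (D t))"
  unfolding continuous_on_def
proof (intro ballI tendstoI)
  fix t0 e assume t0: "t0 \<in> S" and e: "(e::real) > 0"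
  have c0: "c \<in> charts_at A (\<gamma> t0)" using c \<gamma> t0 by (auto simp: charts_at_def)
  obtain k K where K: "K > 0" "\<And>v. cnorm c (\<gamma> t0) v \<le> K * norm v" using cnorm_equiv[OF c0] by metis
  let ?n = "cnorm c (\<gamma> t0)"
  \<comment> \<open>Every norm that gets multiplied by \<open>\<delta>\<close> below is less than
    \<open>?n (D t0) + e\<close>, so the multiplicative error is at most
    \<open>e / 2\<close>.\<close>
  define \<delta> where "\<delta> = e / (2 * (?n (D t0) + e + 1))"
  have n0: "?n (D t0) \<ge> 0" by (rule cnorm_nonneg[OF c0])
  have \<delta>: "\<delta> > 0" using e n0 by (simp add: \<delta>_def)
  obtain W where W: "open W" "\<gamma> t0 \<in> W" "W \<subseteq> fst c"
    "\<And>x v. x \<in> W \<Longrightarrow> ?n v \<le> (1 + \<delta>) * cnorm c x v"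
    "\<And>x v. x \<in> W \<Longrightarrow> cnorm c x v \<le> (1 + \<delta>) * ?n v"
    using cnorm_P2[OF \<delta> c0] by metis
  have e1: "\<forall>\<^sub>F t in at t0 within S. \<gamma> t \<in> W"
    using \<gamma>(1) t0 W by (auto simp: continuous_on_def intro: topological_tendstoD)
  have "\<forall>\<^sub>F t in at t0 within S. dist (D t) (D t0) < e / (2 * K)"
    using D t0 e K by (auto simp: continuous_on_def intro!: tendstoD)
  with e1 show "\<forall>\<^sub>F t in at t0 within S. dist (cnorm c (\<gamma> t) (D t)) (?n (D t0)) < e"
  proof eventually_elim
    case (elim t)
    have "?n (D t - D t0) \<le> K * norm (D t - D t0)" by (rule K)
    also have "\<dots> < e / 2" using elim(2) K(1) by (simp add: dist_norm pos_less_divide_eq field_simps)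
    finally have d: "?n (D t - D t0) < e / 2" .
    have d': "?n (D t0 - D t) < e / 2" using d cnorm_minus[OF c0, of "D t - D t0"] by simp
    have t1: "?n (D t) \<le> ?n (D t - D t0) + ?n (D t0)"
      using cnorm_triangle[OF c0, of "D t - D t0" "D t0"] by simp
    have t2: "?n (D t0) \<le> ?n (D t0 - D t) + ?n (D t)"
      using cnorm_triangle[OF c0, of "D t0 - D t" "D t"] by simp
    have nD: "?n (D t) < ?n (D t0) + e" using t1 d e by linarith
    have cc: "c \<in> charts_at A (\<gamma> t)" using elim(1) W c by (auto simp: charts_at_def)
    have b1: "cnorm c (\<gamma> t) (D t) \<le> ?n (D t) + \<delta> * ?n (D t)" using W(5)[OF elim(1), of "D t"] by (simp add: algebra_simps)
    have b2: "?n (D t) \<le> cnorm c (\<gamma> t) (D t) + \<delta> * cnorm c (\<gamma> t) (D t)" using W(4)[OF elim(1), of "D t"] by (simp add: algebra_simps)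
    have \<delta>2: "\<delta> * (?n (D t0) + e + 1) = e / 2"
    proof -
      have "e / (2 * s) * s = e / 2" if "s > 0" for s using that by simp
      then show ?thesis unfolding \<delta>_def by this (use n0 e in linarith)
    qed
    have b3: "\<delta> * ?n (D t) \<le> \<delta> * (?n (D t0) + e + 1)" using nD \<delta> by (intro mult_left_mono) auto
    have u: "cnorm c (\<gamma> t) (D t) < ?n (D t0) + e" using b1 b3 \<delta>2 t1 d by linarith
    have "\<delta> * cnorm c (\<gamma> t) (D t) \<le> \<delta> * (?n (D t0) + e + 1)"
      using u \<delta> by (intro mult_left_mono) auto
    then have "?n (D t0) - e < cnorm c (\<gamma> t) (D t)" using b2 \<delta>2 t2 d' by linarith
    with u show ?case by (simp add: dist_real_def abs_less_iff)
  qed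
qed

section \<open>Paths and their lengths\<close>

lemma has_vector_derivative_chart_change:
  fixes \<gamma> :: "real \<Rightarrow> 'm"
  assumes \<gamma>: "(\<gamma> \<longlongrightarrow> \<gamma> t) (at t within S)" "t \<in> S"
    and c: "c \<in> charts_at A (\<gamma> t)" "c' \<in> charts_at A (\<gamma> t)"
    and d: "((snd c \<circ> \<gamma>) has_vector_derivative v) (at t within S)"
  shows "((snd c' \<circ> \<gamma>) has_vector_derivative dT c c' (\<gamma> t) v) (at t within S)"
proof -
  interpret bounded_linear "dT c c' (\<gamma> t)" by (rule bounded_linear_dT[OF c])
  note cA = charts_atD[OF c(1)] charts_atD[OF c(2)]
  have 1: "((snd c \<circ> \<gamma>) has_derivative (\<lambda>h. h *\<^sub>R v)) (at t within S)"
    using d by (simp add: has_vector_derivative_def)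
  have "(transition c c' has_derivative dT c c' (\<gamma> t)) (at ((snd c \<circ> \<gamma>) t))"
    using dT_has_derivative[OF c] by simp
  from has_derivative_compose[OF 1 this]
  have 2: "((\<lambda>s. transition c c' ((snd c \<circ> \<gamma>) s)) has_derivative (\<lambda>h. h *\<^sub>R dT c c' (\<gamma> t) v)) (at t within S)"
    by (simp add: scaleR)
  have "open (fst c)" by (rule chart_facts(1)[OF cA(1)])
  from topological_tendstoD[OF \<gamma>(1) this cA(2)]
  have "\<forall>\<^sub>F s in at t within S. transition c c' ((snd c \<circ> \<gamma>) s) = (snd c' \<circ> \<gamma>) s"
    by eventually_elim (simp add: transition_apply cA)
  from has_derivative_transform_eventually[OF 2 this _ \<gamma>(2)]
  show ?thesis by (simp add: has_vector_derivative_def transition_apply cA o_def)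
qed

definition speed :: "(real \<Rightarrow> 'm) \<Rightarrow> real \<Rightarrow> real" where
  "speed \<gamma> t = F (\<gamma> t) (velocity A \<gamma> t)"

lemma speed_eq:
  assumes \<gamma>: "isCont \<gamma> t" and c: "c \<in> charts_at A (\<gamma> t)"
    and d: "((snd c \<circ> \<gamma>) has_vector_derivative v) (at t)"
  shows "speed \<gamma> t = cnorm c (\<gamma> t) v"
proof -
  have "velocity A \<gamma> t c' = tangent_of A c (\<gamma> t) v c'" for c'
  proof (cases "c' \<in> charts_at A (\<gamma> t)")
    case True
    have "((snd c' \<circ> \<gamma>) has_vector_derivative dT c c' (\<gamma> t) v) (at t)"
      using has_vector_derivative_chart_change[of \<gamma> t UNIV, OF _ UNIV_I c True d] \<gamma> by (simp add: isCont_def)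
    with True show ?thesis by (simp add: velocity_def tangent_of_apply vector_derivative_at)
  qed (simp add: velocity_def tangent_of_def)
  then have "velocity A \<gamma> t = tangent_of A c (\<gamma> t) v" by (rule ext)
  then show ?thesis by (simp add: speed_def cnorm_def)
qed

definition diff_at :: "(real \<Rightarrow> 'm) \<Rightarrow> real \<Rightarrow> bool" where
  "diff_at \<gamma> t \<longleftrightarrow> (\<exists>c\<in>charts_at A (\<gamma> t). \<exists>v. ((snd c \<circ> \<gamma>) has_vector_derivative v) (at t))"

text \<open>What integration needs from a piecewise C1 path, in a form stable under concatenation:
  at break points the two-sided derivative may be missing, hence the finite exceptional set.\<close>

definition admissible :: "(real \<Rightarrow> 'm) \<Rightarrow> real \<Rightarrow> real \<Rightarrow> bool" where
  "admissible \<gamma> a b \<longleftrightarrow> a < b \<and> continuous_on {a..b} \<gamma> \<and> speed \<gamma> integrable_on {a..b} \<and>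
     (\<exists>S. finite S \<and> (\<forall>t\<in>{a<..<b} - S. diff_at \<gamma> t))"

lemma C1_path_admissible:
  assumes p: "C1_path A \<gamma> a b" and ab: "a < b"
  shows "admissible \<gamma> a b"
proof -
  have cont: "continuous_on {a..b} \<gamma>" using p by (simp add: C1_path_def)
  have "\<forall>c. \<exists>D. c \<in> A \<longrightarrow> (\<forall>t \<in> {a..b} \<inter> \<gamma> -` fst c.
           ((snd c \<circ> \<gamma>) has_vector_derivative D t) (at t within {a..b})) \<and>
        continuous_on ({a..b} \<inter> \<gamma> -` fst c) D"
    using p unfolding C1_path_def by blast
  from choice[OF this] obtain D where D: "\<And>c t. c \<in> A \<Longrightarrow> t \<in> {a..b} \<Longrightarrow> \<gamma> t \<in> fst c \<Longrightarrow>
      ((snd c \<circ> \<gamma>) has_vector_derivative D c t) (at t within {a..b})"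
    "\<And>c. c \<in> A \<Longrightarrow> continuous_on ({a..b} \<inter> \<gamma> -` fst c) (D c)" by blast
  have lim: "(\<gamma> \<longlongrightarrow> \<gamma> t) (at t within {a..b})" if "t \<in> {a..b}" for t
    using cont that by (simp add: continuous_on_def)
  have change: "D c' t = dT c c' (\<gamma> t) (D c t)"
    if t: "t \<in> {a..b}" and c: "c \<in> charts_at A (\<gamma> t)" "c' \<in> charts_at A (\<gamma> t)" for c c' t
  proof -
    have 1: "((snd c' \<circ> \<gamma>) has_vector_derivative D c' t) (at t within {a..b})"
      by (rule D(1)[OF charts_atD(1)[OF c(2)] t charts_atD(2)[OF c(2)]])
    have 2: "((snd c' \<circ> \<gamma>) has_vector_derivative dT c c' (\<gamma> t) (D c t)) (at t within {a..b})"
      by (rule has_vector_derivative_chart_change[OF lim[OF t] t c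
            D(1)[OF charts_atD(1)[OF c(1)] t charts_atD(2)[OF c(1)]]])
    show ?thesis
      using vector_derivative_unique_within_closed_interval[of a b t "snd c' \<circ> \<gamma>"] ab t 1 2 by simp
  qed
  define c0 where "c0 t = (SOME c. c \<in> charts_at A (\<gamma> t))" for t
  have c0: "c0 t \<in> charts_at A (\<gamma> t)" for t
  proof -
    obtain c where "c \<in> charts_at A (\<gamma> t)" by (rule charts_at_nonempty)
    then show ?thesis unfolding c0_def by (rule someI)
  qed
  \<comment> \<open>The speed formed with the one-sided derivatives, which is continuous up to the
    end points. By \<open>Gc\<close> the selected chart is immaterial, so near each point one fixed
    chart can be used; \<open>speed\<close> differs from \<open>G\<close> at most at
    \<open>a\<close> and \<open>b\<close>.\<close>
  define G where "G t = cnorm (c0 t) (\<gamma> t) (D (c0 t) t)" for t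
  have Gc: "G t = cnorm c (\<gamma> t) (D c t)" if "t \<in> {a..b}" "c \<in> charts_at A (\<gamma> t)" for t c
    unfolding G_def change[OF that(1,2) c0] by (rule cnorm_change[OF that(2) c0])
  have contG: "continuous_on {a..b} G"
    unfolding continuous_on_def
  proof
    fix t assume t: "t \<in> {a..b}"
    let ?c = "c0 t"
    have cA: "?c \<in> A" "\<gamma> t \<in> fst ?c" using c0[of t] by (auto simp: charts_at_def)
    let ?S = "{a..b} \<inter> \<gamma> -` fst ?c"
    have "continuous_on ?S (\<lambda>t. cnorm ?c (\<gamma> t) (D ?c t))"
      by (rule continuous_on_cnorm[OF cA(1) continuous_on_subset[OF cont] _ D(2)[OF cA(1)]]) auto
    then have "continuous_on ?S G"
      by (rule continuous_on_eq) (use cA(1) in \<open>auto simp: Gc charts_at_def\<close>)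
    then have 1: "(G \<longlongrightarrow> G t) (at t within ?S)" using t cA by (simp add: continuous_on_def)
    have "openin (top_of_set {a..b}) ?S"
      by (rule continuous_openin_preimage_gen[OF cont chart_facts(1)[OF cA(1)]])
    then obtain T where T: "open T" "?S = {a..b} \<inter> T" by (auto simp: openin_open)
    have "t \<in> T" using T(2) t cA by blast
    then have "at t within {a..b} = at t within ?S"
      by (rule at_within_nhd[OF _ T(1)]) (use T(2) in auto)
    with 1 show "(G \<longlongrightarrow> G t) (at t within {a..b})" by simp
  qed
  have int: "isCont \<gamma> t" "diff_at \<gamma> t" "speed \<gamma> t = G t" if t: "t \<in> {a<..<b}" for t
  proof -
    have t': "t \<in> {a..b}" "at t within {a..b} = at t" using t by (auto simp: at_within_Icc_at)
    show 1: "isCont \<gamma> t" using lim[OF t'(1)] t'(2) by (simp add: isCont_def)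
    have d: "((snd (c0 t) \<circ> \<gamma>) has_vector_derivative D (c0 t) t) (at t)"
      using D(1)[OF charts_atD(1)[OF c0[of t]] t'(1) charts_atD(2)[OF c0[of t]]] t'(2) by simp
    show "diff_at \<gamma> t" unfolding diff_at_def using c0 d by blast
    show "speed \<gamma> t = G t" unfolding G_def by (rule speed_eq[OF 1 c0 d])
  qed
  have "speed \<gamma> integrable_on {a..b}"
    by (rule integrable_spike_finite[of "{a, b}" _ _ G])
       (use int(3) contG in \<open>auto intro: integrable_continuous_real\<close>)
  then show ?thesis unfolding admissible_def using ab cont int(2) by blast
qed

lemma admissible_combine:
  assumes "admissible \<gamma> a b" "admissible \<gamma> b c" shows "admissible \<gamma> a c"
proof -
  obtain S where S: "finite S" "\<forall>t\<in>{a<..<b} - S. diff_at \<gamma> t" using assms(1) unfolding admissible_def by blast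
  obtain T where T: "finite T" "\<forall>t\<in>{b<..<c} - T. diff_at \<gamma> t" using assms(2) unfolding admissible_def by blast
  have ab: "a < b" "b < c" using assms by (auto simp: admissible_def)
  have "diff_at \<gamma> t" if "t \<in> {a<..<c} - (S \<union> T \<union> {b})" for t
    using S(2) T(2) that by (cases "t < b") auto
  moreover have "finite (S \<union> T \<union> {b})" using S T by simp
  moreover have "continuous_on ({a..b} \<union> {b..c}) \<gamma>"
    using assms by (intro continuous_on_closed_Un) (auto simp: admissible_def)
  then have "continuous_on {a..c} \<gamma>" using ab by (simp add: ivl_disj_un_two_touch)
  moreover have "speed \<gamma> integrable_on {a..c}"
    using Henstock_Kurzweil_Integration.integrable_combine[of a b c "speed \<gamma>"] assms ab by (simp add: admissible_def)
  ultimately show ?thesis unfolding admissible_def using ab by (meson less_trans)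
qed

lemma piecewise_C1_path_admissible:
  assumes "piecewise_C1_path A \<gamma> a b" shows "admissible \<gamma> a b"
proof -
  obtain n s where s: "s 0 = a" "s n = b" "\<And>i. i < n \<Longrightarrow> s i < s (Suc i) \<and> C1_path A \<gamma> (s i) (s (Suc i))"
    and ab: "a < b" using assms unfolding piecewise_C1_path_def by blast
  have "k < n \<Longrightarrow> admissible \<gamma> (s 0) (s (Suc k))" for k
  proof (induction k)
    case 0 then show ?case using s(3)[of 0] C1_path_admissible by blast
  next
    case (Suc k)
    then show ?case using admissible_combine[of \<gamma> "s 0" "s (Suc k)"] s(3)[of "Suc k"] C1_path_admissible by simp
  qed
  moreover have "n \<noteq> 0" using s ab by (metis less_irrefl)
  ultimately show ?thesis using s(1,2) by (metis lessI not0_implies_Suc)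
qed

lemma admissible_isCont: "admissible \<gamma> a b \<Longrightarrow> t \<in> {a<..<b} \<Longrightarrow> isCont \<gamma> t"
  unfolding admissible_def by (metis continuous_on_interior interior_atLeastAtMost_real)

lemma speed_nonneg:
  assumes "isCont \<gamma> t" "diff_at \<gamma> t" shows "speed \<gamma> t \<ge> 0"
  using assms unfolding diff_at_def by (metis cnorm_nonneg speed_eq)

lemma path_length_eq: "path_length A F \<gamma> a b = integral {a..b} (speed \<gamma>)"
  unfolding path_length_def by (rule arg_cong[of _ _ "integral {a..b}"], rule ext) (simp add: speed_def)

section \<open>Reversal, translation and concatenation of paths\<close>

lemma C1_path_cong:
  assumes p: "C1_path A \<gamma> a b" and eq: "\<And>t. t \<in> {a..b} \<Longrightarrow> \<gamma>' t = \<gamma> t"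
  shows "C1_path A \<gamma>' a b"
proof -
  have S: "{a..b} \<inter> \<gamma>' -` U = {a..b} \<inter> \<gamma> -` U" for U using eq by auto
  have "continuous_on {a..b} \<gamma>'" using p eq unfolding C1_path_def by (metis continuous_on_cong)
  moreover have "((snd c \<circ> \<gamma>') has_vector_derivative v) (at t within {a..b})"
    if "((snd c \<circ> \<gamma>) has_vector_derivative v) (at t within {a..b})" "t \<in> {a..b}" for c v t
    by (rule has_vector_derivative_transform_within[OF that(1) zero_less_one that(2)]) (simp add: eq)
  ultimately show ?thesis using p unfolding C1_path_def S by (meson IntD1)
qed

lemma C1_path_reparam:
  assumes p: "C1_path A \<gamma> a b" and m: "\<And>t. t \<in> {a'..b'} \<Longrightarrow> m * t + k \<in> {a..b}"
  shows "C1_path A (\<lambda>t. \<gamma> (m * t + k)) a' b'"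
  unfolding C1_path_def
proof (intro conjI ballI)
  let ?\<rho> = "\<lambda>t. m * t + k"
  have \<rho>: "continuous_on S ?\<rho>" for S by (intro continuous_intros)
  show "continuous_on {a'..b'} (\<lambda>t. \<gamma> (?\<rho> t))"
    by (rule continuous_on_compose2[OF _ \<rho>, of "{a..b}"]) (use p m in \<open>auto simp: C1_path_def\<close>)
  fix c assume "c \<in> A"
  then obtain D where D: "\<And>t. t \<in> {a..b} \<inter> \<gamma> -` fst c \<Longrightarrow>
     ((snd c \<circ> \<gamma>) has_vector_derivative D t) (at t within {a..b})"
    "continuous_on ({a..b} \<inter> \<gamma> -` fst c) D" using p unfolding C1_path_def by blast
  show "\<exists>D. (\<forall>t\<in>{a'..b'} \<inter> (\<lambda>t. \<gamma> (?\<rho> t)) -` fst c.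
          ((snd c \<circ> (\<lambda>t. \<gamma> (?\<rho> t))) has_vector_derivative D t) (at t within {a'..b'})) \<and>
        continuous_on ({a'..b'} \<inter> (\<lambda>t. \<gamma> (?\<rho> t)) -` fst c) D"
  proof (intro exI[of _ "\<lambda>t. m *\<^sub>R D (?\<rho> t)"] conjI ballI)
    fix t assume t: "t \<in> {a'..b'} \<inter> (\<lambda>t. \<gamma> (?\<rho> t)) -` fst c"
    have 1: "(?\<rho> has_vector_derivative m) (at t within {a'..b'})"
      by (auto intro!: derivative_eq_intros simp flip: has_real_derivative_iff_has_vector_derivative)
    have "?\<rho> t \<in> {a..b} \<inter> \<gamma> -` fst c" using t m by auto
    from D(1)[OF this] have "((snd c \<circ> \<gamma>) has_vector_derivative D (?\<rho> t)) (at (?\<rho> t) within ?\<rho> ` {a'..b'})"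
      by (rule has_vector_derivative_within_subset) (use m in auto)
    from vector_diff_chain_within[OF 1 this]
    show "((snd c \<circ> (\<lambda>t. \<gamma> (?\<rho> t))) has_vector_derivative m *\<^sub>R D (?\<rho> t)) (at t within {a'..b'})"
      by (simp add: o_def)
  next
    have "continuous_on ({a'..b'} \<inter> (\<lambda>t. \<gamma> (?\<rho> t)) -` fst c) (\<lambda>t. D (?\<rho> t))"
      by (rule continuous_on_compose2[OF D(2) \<rho>]) (use m in auto)
    then show "continuous_on ({a'..b'} \<inter> (\<lambda>t. \<gamma> (?\<rho> t)) -` fst c) (\<lambda>t. m *\<^sub>R D (?\<rho> t))"
      by (intro continuous_intros)
  qed
qed

lemma speed_reparam:
  assumes \<gamma>: "isCont \<gamma> (m * t + k)" "diff_at \<gamma> (m * t + k)"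
  shows "speed (\<lambda>t. \<gamma> (m * t + k)) t = \<bar>m\<bar> * speed \<gamma> (m * t + k)"
proof -
  obtain c v where c: "c \<in> charts_at A (\<gamma> (m * t + k))"
    and v: "((snd c \<circ> \<gamma>) has_vector_derivative v) (at (m * t + k))"
    using \<gamma>(2) unfolding diff_at_def by blast
  have 1: "((\<lambda>t. m * t + k) has_vector_derivative m) (at t)"
    by (auto intro!: derivative_eq_intros simp flip: has_real_derivative_iff_has_vector_derivative)
  have "((snd c \<circ> \<gamma>) has_vector_derivative v) (at (m * t + k) within range (\<lambda>t. m * t + k))"
    using v by (rule has_vector_derivative_at_within)
  from vector_diff_chain_within[OF 1 this]
  have d: "((snd c \<circ> (\<lambda>t. \<gamma> (m * t + k))) has_vector_derivative m *\<^sub>R v) (at t)" by (simp add: o_def)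
  have cont: "isCont (\<lambda>t. \<gamma> (m * t + k)) t"
    using isCont_o2[where f="\<lambda>t. m * t + k" and g=\<gamma> and a=t] \<gamma>(1) by simp
  show ?thesis
    using speed_eq[OF cont _ d] speed_eq[OF \<gamma>(1) c v] c cnorm_scale[OF c] by simp
qed

text \<open>Forgets the path and keeps its length, so that the metric axioms reduce to rules for
  combining lengths before infima are taken.\<close>

definition joined :: "'m \<Rightarrow> 'm \<Rightarrow> real \<Rightarrow> bool" where
  "joined p q l \<longleftrightarrow>
     (\<exists>\<gamma> a b. piecewise_C1_path A \<gamma> a b \<and> \<gamma> a = p \<and> \<gamma> b = q \<and> path_length A F \<gamma> a b = l)"

lemma finsler_dist_eq: "finsler_dist A F p q = Inf {l. joined p q l}"
  unfolding finsler_dist_def joined_def by (rule arg_cong[of _ _ Inf]) blast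

lemma piecewise_length:
  assumes "piecewise_C1_path A \<gamma> a b"
  shows "(speed \<gamma> has_integral path_length A F \<gamma> a b) {a..b}"
  using piecewise_C1_path_admissible[OF assms] unfolding admissible_def path_length_eq
  by (simp add: has_integral_integral)

lemma joined_nonneg: assumes "joined p q l" shows "0 \<le> l"
proof -
  obtain \<gamma> a b where \<gamma>: "piecewise_C1_path A \<gamma> a b" "path_length A F \<gamma> a b = l"
    using assms unfolding joined_def by blast
  note adm = piecewise_C1_path_admissible[OF \<gamma>(1)]
  obtain S where S: "finite S" "\<forall>t\<in>{a<..<b} - S. diff_at \<gamma> t" using adm unfolding admissible_def by blast
  \<comment> \<open>At exceptional points \<open>velocity\<close> need not be a tangent vector, and
    \<open>F\<close> need not be nonnegative there; the value 0 is substituted without changing the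
    integral.\<close>
  have "((\<lambda>t. if t \<in> S \<union> {a, b} then 0 else speed \<gamma> t) has_integral l) {a..b}"
    by (rule has_integral_spike_finite[OF _ _ piecewise_length[OF \<gamma>(1), unfolded \<gamma>(2)], of "S \<union> {a, b}"])
       (use S in auto)
  then show ?thesis
  proof (rule has_integral_nonneg)
    fix t assume t: "t \<in> {a..b}"
    show "0 \<le> (if t \<in> S \<union> {a, b} then 0 else speed \<gamma> t)"
      using S(2) t speed_nonneg[OF admissible_isCont[OF adm]] by auto
  qed
qed

lemma joined_sym: assumes "joined p q l" shows "joined q p l"
proof -
  obtain \<gamma> a b where \<gamma>: "piecewise_C1_path A \<gamma> a b" "\<gamma> a = p" "\<gamma> b = q" "path_length A F \<gamma> a b = l"
    using assms unfolding joined_def by blast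
  obtain n s where s: "s 0 = a" "s n = b" "\<And>i. i < n \<Longrightarrow> s i < s (Suc i) \<and> C1_path A \<gamma> (s i) (s (Suc i))"
    and ab: "a < b" using \<gamma>(1) unfolding piecewise_C1_path_def by blast
  \<comment> \<open>The reversal is spelled as an affine map \<open>m * t + k\<close> so that the
    reparametrization lemmas match it.\<close>
  let ?\<gamma> = "\<lambda>t. \<gamma> (- 1 * t + 0)"
  define s' where "s' i = - s (n - i)" for i
  have pc: "s' i < s' (Suc i) \<and> C1_path A ?\<gamma> (s' i) (s' (Suc i))" if "i < n" for i
  proof -
    have j: "n - i = Suc (n - Suc i)" "n - Suc i < n" using that by auto
    have "C1_path A ?\<gamma> (- s (Suc (n - Suc i))) (- s (n - Suc i))"
      by (rule C1_path_reparam[OF conjunct2[OF s(3)[OF j(2)]]]) auto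
    then show ?thesis using s(3)[OF j(2)] unfolding s'_def j(1) by simp
  qed
  have pw: "piecewise_C1_path A ?\<gamma> (- b) (- a)"
    unfolding piecewise_C1_path_def using ab pc s by (intro conjI exI[of _ n] exI[of _ s']) (auto simp: s'_def)
  note adm = piecewise_C1_path_admissible[OF \<gamma>(1)]
  obtain S where S: "finite S" "\<forall>t\<in>{a<..<b} - S. diff_at \<gamma> t" using adm unfolding admissible_def by blast
  have "((\<lambda>t. speed \<gamma> (- t)) has_integral l) {- b..- a}"
    using piecewise_length[OF \<gamma>(1)] \<gamma>(4) by simp
  then have "(speed ?\<gamma> has_integral l) {- b..- a}"
  proof (rule has_integral_spike_finite[rotated 2])
    show "finite (uminus ` (S \<union> {a, b}))" using S by simp
    fix t assume t: "t \<in> {- b..- a} - uminus ` (S \<union> {a, b})"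
    have "- t \<notin> S \<union> {a, b}"
    proof
      assume "- t \<in> S \<union> {a, b}"
      then have "- (- t) \<in> uminus ` (S \<union> {a, b})" by (rule imageI)
      with t show False by simp
    qed
    with t have i: "- t \<in> {a<..<b} - S" by auto
    then have i': "- 1 * t + 0 \<in> {a<..<b} - S" by simp
    show "speed ?\<gamma> t = speed \<gamma> (- t)"
      using speed_reparam[where \<gamma>=\<gamma> and m="- 1" and t=t and k=0] admissible_isCont[OF adm, of "- 1 * t + 0"] S(2) i' by simp
  qed
  then have "path_length A F ?\<gamma> (- b) (- a) = l" unfolding path_length_eq by (rule integral_unique)
  then show ?thesis unfolding joined_def
    by (intro exI[of _ ?\<gamma>] exI[of _ "- b"] exI[of _ "- a"]) (use pw \<gamma> in simp)
qed

lemma speed_cong: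
  assumes "\<forall>\<^sub>F s in nhds t. \<gamma> s = \<gamma>' s" shows "speed \<gamma> t = speed \<gamma>' t"
proof -
  have t: "\<gamma> t = \<gamma>' t" using assms by (rule eventually_nhds_x_imp_x)
  have vd: "vector_derivative (snd c \<circ> \<gamma>) (at t) = vector_derivative (snd c \<circ> \<gamma>') (at t)" for c
    by (rule vector_derivative_cong_eq) (use assms in \<open>auto elim: eventually_mono\<close>)
  have "velocity A \<gamma> t = velocity A \<gamma>' t" unfolding velocity_def t vd by (rule refl)
  then show ?thesis by (simp add: speed_def t)
qed

lemma joined_trans: assumes 1: "joined p q l" and 2: "joined q r l'" shows "joined p r (l + l')"
proof -
  obtain \<gamma> a b where \<gamma>: "piecewise_C1_path A \<gamma> a b" "\<gamma> a = p" "\<gamma> b = q" "path_length A F \<gamma> a b = l"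
    using 1 unfolding joined_def by blast
  obtain n s where s: "s 0 = a" "s n = b" "\<And>i. i < n \<Longrightarrow> s i < s (Suc i) \<and> C1_path A \<gamma> (s i) (s (Suc i))"
    and ab: "a < b" using \<gamma>(1) unfolding piecewise_C1_path_def by blast
  obtain \<gamma>' a' b' where \<gamma>': "piecewise_C1_path A \<gamma>' a' b'" "\<gamma>' a' = q" "\<gamma>' b' = r" "path_length A F \<gamma>' a' b' = l'"
    using 2 unfolding joined_def by blast
  obtain n' s' where s': "s' 0 = a'" "s' n' = b'" "\<And>i. i < n' \<Longrightarrow> s' i < s' (Suc i) \<and> C1_path A \<gamma>' (s' i) (s' (Suc i))"
    and ab': "a' < b'" using \<gamma>'(1) unfolding piecewise_C1_path_def by blast
  define k where "k = a' - b"
  define \<mu> where "\<mu> t = (if t \<le> b then \<gamma> t else \<gamma>' (1 * t + k))" for t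
  \<comment> \<open>The index \<open>n\<close> is served by the first subdivision; the second would
    give the same value, as \<open>s n = b = s' 0 - k\<close>.\<close>
  define \<sigma> where "\<sigma> i = (if i \<le> n then s i else s' (i - n) - k)" for i
  have smono: "i \<le> n \<Longrightarrow> s i \<le> b" for i
  proof (induction rule: inc_induct)
    case base then show ?case by (simp add: s)
  next
    case (step i) then show ?case using s(3)[of i] by linarith
  qed
  have smono': "i \<le> n' \<Longrightarrow> a' \<le> s' i" for i
  proof (induction i)
    case (Suc i) then show ?case using s'(3)[of i] by simp
  qed (simp add: s')
  have pc: "\<sigma> i < \<sigma> (Suc i) \<and> C1_path A \<mu> (\<sigma> i) (\<sigma> (Suc i))" if i: "i < n + n'" for i
  proof (cases "i < n")
    case True
    then have e: "\<sigma> i = s i" "\<sigma> (Suc i) = s (Suc i)" by (auto simp: \<sigma>_def)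
    have "C1_path A \<mu> (s i) (s (Suc i))"
      by (rule C1_path_cong[OF conjunct2[OF s(3)[OF True]]]) (use smono[of "Suc i"] True in \<open>auto simp: \<mu>_def\<close>)
    then show ?thesis using s(3)[OF True] e by simp
  next
    case False
    define j where "j = i - n"
    have j: "j < n'" "i = n + j" using False i by (auto simp: j_def)
    have e: "\<sigma> i = s' j - k" "\<sigma> (Suc i) = s' (Suc j) - k"
      using s(2) s'(1) by (auto simp: \<sigma>_def j k_def)
    have "C1_path A (\<lambda>t. \<gamma>' (1 * t + k)) (s' j - k) (s' (Suc j) - k)"
      by (rule C1_path_reparam[OF conjunct2[OF s'(3)[OF j(1)]]]) auto
    then have "C1_path A \<mu> (s' j - k) (s' (Suc j) - k)"
    proof (rule C1_path_cong)
      fix t assume "t \<in> {s' j - k..s' (Suc j) - k}"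
      then have "b \<le> t" using smono'[of j] j by (simp add: k_def)
      then show "\<mu> t = \<gamma>' (1 * t + k)" using \<gamma> \<gamma>' by (cases "t = b") (auto simp: \<mu>_def k_def)
    qed
    then show ?thesis using s'(3)[OF j(1)] e by simp
  qed
  have bk: "b < b' - k" using ab' by (simp add: k_def)
  have pw: "piecewise_C1_path A \<mu> a (b' - k)"
    unfolding piecewise_C1_path_def
  proof (intro conjI exI[of _ "n + n'"] exI[of _ \<sigma>] allI impI)
    show "a < b' - k" using ab bk by simp
    show "\<sigma> 0 = a" by (simp add: \<sigma>_def s)
    show "\<sigma> (n + n') = b' - k"
    proof (cases "n' = 0")
      case True then show ?thesis using s'(1,2) ab' by simp
    next
      case False then show ?thesis by (simp add: \<sigma>_def s')
    qed
  qed (use pc in blast)+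
  note adm = piecewise_C1_path_admissible[OF \<gamma>'(1)]
  obtain S where S: "finite S" "\<forall>t\<in>{a'<..<b'} - S. diff_at \<gamma>' t" using adm unfolding admissible_def by blast
  have 1: "(speed \<mu> has_integral l) {a..b}"
  proof (rule has_integral_spike_finite[of "{b}" _ _ "speed \<gamma>"])
    show "(speed \<gamma> has_integral l) {a..b}" using piecewise_length[OF \<gamma>(1)] \<gamma>(4) by simp
    fix t assume "t \<in> {a..b} - {b}"
    then have "t \<in> {..<b}" by auto
    with eventually_nhds_in_open[of "{..<b}" t]
    have "\<forall>\<^sub>F s in nhds t. s \<in> {..<b}" by simp
    then have "\<forall>\<^sub>F s in nhds t. \<mu> s = \<gamma> s" by (rule eventually_mono) (simp add: \<mu>_def)
    then show "speed \<mu> t = speed \<gamma> t" by (rule speed_cong)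
  qed simp
  have "((\<lambda>t. speed \<gamma>' (t + k)) has_integral l') {a' - k..b' - k}"
    using has_integral_shift_real_ivl[OF piecewise_length[OF \<gamma>'(1)], of k] \<gamma>'(4) by simp
  then have "(speed \<mu> has_integral l') {a' - k..b' - k}"
  proof (rule has_integral_spike_finite[rotated 2])
    show "finite ((\<lambda>t. t - k) ` (S \<union> {a', b'}))" using S by simp
    fix t assume t: "t \<in> {a' - k..b' - k} - (\<lambda>t. t - k) ` (S \<union> {a', b'})"
    have "t + k \<notin> S \<union> {a', b'}"
    proof
      assume "t + k \<in> S \<union> {a', b'}"
      then have "t + k - k \<in> (\<lambda>t. t - k) ` (S \<union> {a', b'})" by (rule imageI)
      with t show False by simp
    qed
    with t have i: "1 * t + k \<in> {a'<..<b'} - S" by auto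
    then have "t \<in> {b<..}" by (simp add: k_def)
    with eventually_nhds_in_open[of "{b<..}" t]
    have "\<forall>\<^sub>F s in nhds t. s \<in> {b<..}" by simp
    then have "\<forall>\<^sub>F s in nhds t. \<mu> s = \<gamma>' (1 * s + k)" by (rule eventually_mono) (simp add: \<mu>_def)
    then have "speed \<mu> t = speed (\<lambda>s. \<gamma>' (1 * s + k)) t" by (rule speed_cong)
    also have "\<dots> = speed \<gamma>' (t + k)"
      using speed_reparam[where \<gamma>=\<gamma>' and m=1 and t=t and k=k] admissible_isCont[OF adm, of "1 * t + k"] S(2) i by simp
    finally show "speed \<mu> t = speed \<gamma>' (t + k)" .
  qed
  then have "(speed \<mu> has_integral l') {b..b' - k}" by (simp add: k_def)
  from has_integral_combine[OF _ _ 1 this] ab bk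
  have "(speed \<mu> has_integral (l + l')) {a..b' - k}" by simp
  then have "path_length A F \<mu> a (b' - k) = l + l'" unfolding path_length_eq by (rule integral_unique)
  moreover have "\<mu> a = p" "\<mu> (b' - k) = r" using ab bk \<gamma> \<gamma>' by (auto simp: \<mu>_def)
  ultimately show ?thesis unfolding joined_def using pw by blast
qed

section \<open>The Finsler metric\<close>

text \<open>In the chart the path has the constant velocity \<open>y' - y\<close>, so its speed is
  the Finsler norm of one coordinate vector at moving base points.\<close>

lemma joined_segment:
  assumes c: "c \<in> A" and seg: "\<And>t. t \<in> {0..1} \<Longrightarrow> y + t *\<^sub>R (y' - y) \<in> snd c ` fst c"
    and B: "\<And>t. t \<in> {0..1} \<Longrightarrow> cnorm c (chart_inv c (y + t *\<^sub>R (y' - y))) (y' - y) \<le> B"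
  obtains l where "l \<le> B" "joined (chart_inv c y) (chart_inv c y') l"
proof -
  define \<l> where "\<l> t = y + t *\<^sub>R (y' - y)" for t :: real
  define \<gamma> where "\<gamma> t = chart_inv c (\<l> t)" for t
  have l_cont: "continuous_on S \<l>" for S unfolding \<l>_def by (intro continuous_intros)
  have l_in: "\<l> t \<in> snd c ` fst c" if "t \<in> {0..1}" for t using seg that by (simp add: \<l>_def)
  have l_deriv: "(\<l> has_derivative (\<lambda>h. h *\<^sub>R (y' - y))) (at t within S)" for t S
    unfolding \<l>_def by (auto intro!: derivative_eq_intros)
  have \<gamma>_cont: "continuous_on {0..1} \<gamma>" unfolding \<gamma>_def
    by (rule continuous_on_compose2[OF continuous_on_chart_inv[OF c] l_cont]) (use l_in in blast)
  have \<gamma>_in: "\<gamma> t \<in> fst c" "snd c (\<gamma> t) = \<l> t" if "t \<in> {0..1}" for t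
    unfolding \<gamma>_def using l_in[OF that] c by (auto intro: chart_inv_in chart_inv_right)
  have "C1_path A \<gamma> 0 1"
    unfolding C1_path_def
  proof (intro conjI ballI \<gamma>_cont)
    fix c' assume c': "c' \<in> A"
    let ?f = "transition c c'" and ?Q = "snd c ` (fst c \<inter> fst c')" and ?I = "{0..1} \<inter> \<gamma> -` fst c'"
    have Q: "\<l> t \<in> ?Q" if "t \<in> ?I" for t
    proof -
      have "snd c (\<gamma> t) \<in> ?Q" using that \<gamma>_in[of t] by (intro imageI) auto
      then show ?thesis using \<gamma>_in(2)[of t] that by simp
    qed
    note C1 = C1_on_transition[OF c c']
    note fr = C1_on_frechet(1)[OF C1] and frc = C1_on_frechet(2)[OF C1]
    show "\<exists>D. (\<forall>t\<in>?I. ((snd c' \<circ> \<gamma>) has_vector_derivative D t) (at t within {0..1})) \<and> continuous_on ?I D"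
    proof (intro exI[of _ "\<lambda>t. frechet_derivative ?f (at (\<l> t)) (y' - y)"] conjI ballI)
      fix t assume t: "t \<in> ?I"
      interpret bounded_linear "frechet_derivative ?f (at (\<l> t))"
        using fr[OF Q[OF t]] by (rule has_derivative_bounded_linear)
      have "((\<lambda>s. ?f (\<l> s)) has_derivative (\<lambda>h. frechet_derivative ?f (at (\<l> t)) (h *\<^sub>R (y' - y)))) (at t within {0..1})"
        by (rule has_derivative_compose[OF l_deriv fr[OF Q[OF t]]])
      moreover have "(\<lambda>s. ?f (\<l> s)) = snd c' \<circ> \<gamma>" by (simp add: transition_def \<gamma>_def o_def)
      ultimately show "((snd c' \<circ> \<gamma>) has_vector_derivative frechet_derivative ?f (at (\<l> t)) (y' - y)) (at t within {0..1})"
        by (simp add: has_vector_derivative_def scaleR)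
    next
      have "continuous_on ?I (\<lambda>t. Blinfun (frechet_derivative ?f (at (\<l> t))))"
        by (rule continuous_on_compose2[OF frc l_cont]) (use Q in blast)
      then have "continuous_on ?I (\<lambda>t. blinfun_apply (Blinfun (frechet_derivative ?f (at (\<l> t)))) (y' - y))"
        by (intro continuous_intros)
      then show "continuous_on ?I (\<lambda>t. frechet_derivative ?f (at (\<l> t)) (y' - y))"
      proof (rule continuous_on_eq)
        fix t assume t: "t \<in> ?I"
        show "blinfun_apply (Blinfun (frechet_derivative ?f (at (\<l> t)))) (y' - y) = frechet_derivative ?f (at (\<l> t)) (y' - y)"
          by (simp add: bounded_linear_Blinfun_apply[OF has_derivative_bounded_linear[OF fr[OF Q[OF t]]]])
      qed
    qed
  qed
  then have pw: "piecewise_C1_path A \<gamma> 0 1"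
    unfolding piecewise_C1_path_def by (intro conjI exI[of _ 1] exI[of _ real]) simp_all
  have sp: "speed \<gamma> t \<le> B" if t: "t \<in> {0<..<1}" for t
  proof -
    have t': "t \<in> {0..1}" using t by simp
    have cont: "isCont \<gamma> t" using \<gamma>_cont t by (metis continuous_on_interior interior_atLeastAtMost_real)
    have "(\<l> has_vector_derivative (y' - y)) (at t)" using l_deriv by (simp add: has_vector_derivative_def)
    then have "((snd c \<circ> \<gamma>) has_vector_derivative (y' - y)) (at t)"
      by (rule has_vector_derivative_transform_within_open[where S="{0<..<1}"]) (use t \<gamma>_in(2) in simp_all)
    moreover have "c \<in> charts_at A (\<gamma> t)" using \<gamma>_in(1)[OF t'] c by (simp add: charts_at_def)
    ultimately have "speed \<gamma> t = cnorm c (\<gamma> t) (y' - y)" using speed_eq[OF cont] by blast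
    then show ?thesis using B[OF t'] by (simp add: \<gamma>_def \<l>_def)
  qed
  have "c \<in> charts_at A (\<gamma> 0)" using \<gamma>_in(1)[of 0] c by (simp add: charts_at_def)
  then have "0 \<le> cnorm c (\<gamma> 0) (y' - y)" by (rule cnorm_nonneg)
  also have "\<dots> \<le> B" using B[of 0] by (simp add: \<gamma>_def \<l>_def)
  finally have B0: "0 \<le> B" .
  have i: "((\<lambda>t. if t \<in> {0, 1} then 0 else speed \<gamma> t) has_integral path_length A F \<gamma> 0 1) {0..1}"
    by (rule has_integral_spike_finite[OF _ _ piecewise_length[OF pw], of "{0, 1}"]) auto
  have "path_length A F \<gamma> 0 1 \<le> B"
  proof (rule has_integral_le[OF i])
    show "((\<lambda>t. B) has_integral B) {0..1::real}" using has_integral_const_real[of B 0 "1::real"] by simp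
    fix t :: real assume "t \<in> {0..1}"
    then show "(if t \<in> {0, 1} then 0 else speed \<gamma> t) \<le> B" using sp[of t] B0 by auto
  qed
  moreover have "joined (chart_inv c y) (chart_inv c y') (path_length A F \<gamma> 0 1)"
    unfolding joined_def using pw by (intro exI[of _ \<gamma>] exI[of _ 0] exI[of _ 1]) (simp add: \<gamma>_def \<l>_def)
  ultimately show ?thesis using that by blast
qed

text \<open>A ball instead of the arbitrary neighbourhood of P2, because convexity keeps coordinate
  segments inside.\<close>

definition norm_ball :: "('m, 'b) chart \<Rightarrow> 'm \<Rightarrow> real \<Rightarrow> real \<Rightarrow> bool" where
  "norm_ball c x0 e \<rho> \<longleftrightarrow> \<rho> > 0 \<and> ball (snd c x0) \<rho> \<subseteq> snd c ` fst c \<and>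
     (\<forall>y\<in>ball (snd c x0) \<rho>. \<forall>v. cnorm c x0 v \<le> (1 + e) * cnorm c (chart_inv c y) v \<and>
        cnorm c (chart_inv c y) v \<le> (1 + e) * cnorm c x0 v)"

lemma norm_ball_exists:
  assumes e: "e > 0" and c: "c \<in> charts_at A x0" and V: "open V" "x0 \<in> V"
  obtains \<rho> where "norm_ball c x0 e \<rho>" "chart_inv c ` ball (snd c x0) \<rho> \<subseteq> V"
proof -
  have cA: "c \<in> A" "x0 \<in> fst c" using c by (auto simp: charts_at_def)
  obtain W where W: "open W" "x0 \<in> W" "W \<subseteq> fst c"
    "\<And>x v. x \<in> W \<Longrightarrow> cnorm c x0 v \<le> (1 + e) * cnorm c x v"
    "\<And>x v. x \<in> W \<Longrightarrow> cnorm c x v \<le> (1 + e) * cnorm c x0 v"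
    using cnorm_P2[OF e c] by blast
  have "open (snd c ` (W \<inter> V))" using W V by (intro open_chart_image[OF cA(1)] open_Int) auto
  moreover have "snd c x0 \<in> snd c ` (W \<inter> V)" using W V by (intro imageI) simp
  ultimately obtain \<rho> where \<rho>: "\<rho> > 0" "ball (snd c x0) \<rho> \<subseteq> snd c ` (W \<inter> V)"
    by (meson open_contains_ball)
  have inW: "chart_inv c y \<in> W \<inter> V" if "y \<in> ball (snd c x0) \<rho>" for y
  proof -
    from that \<rho>(2) have "y \<in> snd c ` (W \<inter> V)" by (rule rev_subsetD)
    then obtain x where x: "x \<in> W \<inter> V" "y = snd c x" by (auto elim: imageE)
    then have "chart_inv c y = x" using chart_inv_left[OF cA(1)] W(3) by blast
    with x show ?thesis by simp
  qed
  show ?thesis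
  proof (rule that)
    show "norm_ball c x0 e \<rho>" unfolding norm_ball_def
    proof (intro conjI ballI allI)
      show "ball (snd c x0) \<rho> \<subseteq> snd c ` fst c" using \<rho>(2) W(3) by blast
    qed (use \<rho>(1) W(4,5) inW in auto)
    show "chart_inv c ` ball (snd c x0) \<rho> \<subseteq> V" using inW by blast
  qed
qed

lemma norm_ball_exists_simple:
  assumes e: "e > 0" and c: "c \<in> charts_at A x0"
  obtains \<rho> where "norm_ball c x0 e \<rho>"
proof -
  obtain \<rho> where "norm_ball c x0 e \<rho>" "chart_inv c ` ball (snd c x0) \<rho> \<subseteq> UNIV"
    by (rule norm_ball_exists[OF e c open_UNIV UNIV_I])
  then show ?thesis by (intro that)
qed

lemma norm_ball_joined:
  assumes c: "c \<in> charts_at A x0" and nb: "norm_ball c x0 e \<rho>"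
    and y: "y \<in> ball (snd c x0) \<rho>" "y' \<in> ball (snd c x0) \<rho>"
  obtains l where "l \<le> (1 + e) * cnorm c x0 (y' - y)" "joined (chart_inv c y) (chart_inv c y') l"
proof -
  have seg: "y + t *\<^sub>R (y' - y) \<in> ball (snd c x0) \<rho>" if "t \<in> {0..1}" for t
  proof -
    have "(1 - t) *\<^sub>R y + t *\<^sub>R y' \<in> ball (snd c x0) \<rho>"
      using that y by (intro convexD_alt[OF convex_ball]) auto
    moreover have "(1 - t) *\<^sub>R y + t *\<^sub>R y' = y + t *\<^sub>R (y' - y)" by (simp add: algebra_simps)
    ultimately show ?thesis by simp
  qed
  show ?thesis
  proof (rule joined_segment[of c y y' "(1 + e) * cnorm c x0 (y' - y)"])
    show "c \<in> A" using c by (rule charts_atD)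
    fix t :: real assume t: "t \<in> {0..1}"
    show "y + t *\<^sub>R (y' - y) \<in> snd c ` fst c"
      using seg[OF t] nb unfolding norm_ball_def by blast
    show "cnorm c (chart_inv c (y + t *\<^sub>R (y' - y))) (y' - y) \<le> (1 + e) * cnorm c x0 (y' - y)"
      using seg[OF t] nb unfolding norm_ball_def by blast
  qed (rule that)
qed

lemma norm_ball_nhd:
  assumes c: "c \<in> charts_at A x0" and nb: "norm_ball c x0 e \<rho>"
  shows "open (fst c \<inter> snd c -` ball (snd c x0) \<rho>)" "x0 \<in> fst c \<inter> snd c -` ball (snd c x0) \<rho>"
  using open_chart_vimage[OF charts_atD(1)[OF c] open_ball] charts_atD(2)[OF c] nb
  by (auto simp: norm_ball_def)

lemma locally_joined:
  obtains V where "open V" "x0 \<in> V" "\<And>q. q \<in> V \<Longrightarrow> \<exists>l. joined x0 q l"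
proof -
  obtain c where c: "c \<in> charts_at A x0" by (rule charts_at_nonempty)
  obtain \<rho> where nb: "norm_ball c x0 1 \<rho>" by (rule norm_ball_exists_simple[OF zero_less_one c])
  show ?thesis
  proof (rule that[OF norm_ball_nhd[OF c nb]])
    fix q assume q: "q \<in> fst c \<inter> snd c -` ball (snd c x0) \<rho>"
    have "snd c x0 \<in> ball (snd c x0) \<rho>" using nb by (simp add: norm_ball_def)
    moreover have "snd c q \<in> ball (snd c x0) \<rho>" using q by simp
    ultimately obtain l where "joined (chart_inv c (snd c x0)) (chart_inv c (snd c q)) l"
      using norm_ball_joined[OF c nb] by blast
    then show "\<exists>l. joined x0 q l"
      using q charts_atD[OF c] by (auto simp: chart_inv_left)
  qed
qed

text \<open>The points reachable from \<open>p\<close> form an open set with open complement,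
  because nearby points are joined by coordinate segments; connectedness concludes. Without a path,
  the infimum defining the metric would be taken over the empty set.\<close>

lemma joined_exists: "\<exists>l. joined p q l"
proof -
  define R where "R = {q. \<exists>l. joined p q l}"
  have "open R"
  proof (subst open_subopen, intro ballI)
    fix x assume "x \<in> R"
    then obtain l where l: "joined p x l" by (auto simp: R_def)
    obtain V where V: "open V" "x \<in> V" "\<And>q. q \<in> V \<Longrightarrow> \<exists>l. joined x q l" using locally_joined[of x] by blast
    have "q \<in> R" if "q \<in> V" for q using V(3)[OF that] joined_trans[OF l] unfolding R_def by blast
    with V show "\<exists>V. open V \<and> x \<in> V \<and> V \<subseteq> R" by blast
  qed
  moreover have "open (- R)"
  proof (subst open_subopen, intro ballI)
    fix x assume x: "x \<in> - R"
    obtain V where V: "open V" "x \<in> V" "\<And>q. q \<in> V \<Longrightarrow> \<exists>l. joined x q l" using locally_joined[of x] by blast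
    have "V \<subseteq> - R"
    proof
      fix q assume "q \<in> V"
      then obtain l where "joined q x l" using V(3) joined_sym by blast
      then show "q \<in> - R" using x joined_trans unfolding R_def by blast
    qed
    with V show "\<exists>V. open V \<and> x \<in> V \<and> V \<subseteq> - R" by blast
  qed
  moreover have "p \<in> R"
  proof -
    obtain V where V: "open V" "p \<in> V" "\<And>q. q \<in> V \<Longrightarrow> \<exists>l. joined p q l" using locally_joined[of p] by blast
    from V(3)[OF V(2)] show ?thesis by (simp add: R_def)
  qed
  ultimately have "- R = {}"
    using connectedD[OF connected, of R "- R"] by blast
  then have "R = UNIV" by blast
  then show ?thesis unfolding R_def by blast
qed

section \<open>Metric axioms and upper bounds in coordinates\<close>

abbreviation d :: "'m \<Rightarrow> 'm \<Rightarrow> real" where "d \<equiv> finsler_dist A F"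

lemma d_le: "joined p q l \<Longrightarrow> d p q \<le> l"
  unfolding finsler_dist_eq by (rule cInf_lower) (auto intro!: bdd_belowI[of _ 0] joined_nonneg)

lemma d_nonneg: "0 \<le> d p q"
  unfolding finsler_dist_eq by (rule cInf_greatest) (use joined_exists joined_nonneg in auto)

lemma d_less: assumes "d p q < r" obtains l where "joined p q l" "l < r"
  using cInf_lessD[of "{l. joined p q l}" r] assms joined_exists unfolding finsler_dist_eq by blast

lemma d_sym: "d p q = d q p"
proof -
  have "{l. joined p q l} = {l. joined q p l}" using joined_sym by blast
  then show ?thesis by (simp add: finsler_dist_eq)
qed

lemma d_triangle: "d p r \<le> d p q + d q r"
proof (rule field_le_epsilon)
  fix e :: real assume "e > 0"
  obtain l where l: "joined p q l" "l < d p q + e / 2" using d_less[of p q "d p q + e / 2"] \<open>e > 0\<close> by auto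
  obtain l' where l': "joined q r l'" "l' < d q r + e / 2" using d_less[of q r "d q r + e / 2"] \<open>e > 0\<close> by auto
  show "d p r \<le> d p q + d q r + e" using d_le[OF joined_trans[OF l(1) l'(1)]] l l' by linarith
qed

lemma norm_ball_d:
  assumes c: "c \<in> charts_at A x0" and nb: "norm_ball c x0 e \<rho>"
    and y: "y \<in> ball (snd c x0) \<rho>" "y' \<in> ball (snd c x0) \<rho>"
  shows "d (chart_inv c y) (chart_inv c y') \<le> (1 + e) * cnorm c x0 (y' - y)"
  using norm_ball_joined[OF assms] d_le by (metis order_trans)

lemma d_refl: "d x x = 0"
proof -
  obtain c where c: "c \<in> charts_at A x" by (rule charts_at_nonempty)
  obtain \<rho> where nb: "norm_ball c x 1 \<rho>" by (rule norm_ball_exists_simple[OF zero_less_one c])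
  have y: "snd c x \<in> ball (snd c x) \<rho>" using nb by (simp add: norm_ball_def)
  have "d x x \<le> 2 * cnorm c x 0" using norm_ball_d[OF c nb y y] charts_atD[OF c] by (simp add: chart_inv_left)
  also have "cnorm c x 0 = 0" using cnorm_scale[OF c, of 0 0] by simp
  finally show ?thesis using d_nonneg[of x x] by simp
qed

text \<open>Segments in a chart make the distance from \<open>x\<close> at most \<open>2 * K\<close>
  times the coordinate distance: the manifold topology is at least as fine as that of
  \<open>d\<close>.\<close>

lemma d_small_nhd:
  assumes "e > 0" obtains V where "open V" "x \<in> V" "\<And>q. q \<in> V \<Longrightarrow> d x q < e"
proof -
  obtain c where c: "c \<in> charts_at A x" by (rule charts_at_nonempty)
  obtain \<rho> where nb: "norm_ball c x 1 \<rho>" by (rule norm_ball_exists_simple[OF zero_less_one c])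
  obtain k K where K: "K > 0" "\<And>v. cnorm c x v \<le> K * norm v" using cnorm_equiv[OF c] by metis
  define r where "r = min \<rho> (e / (2 * K))"
  have r: "r > 0" using nb assms K by (simp add: r_def norm_ball_def)
  have cA: "c \<in> A" "x \<in> fst c" using c by (auto simp: charts_at_def)
  show ?thesis
  proof (rule that)
    show "open (fst c \<inter> snd c -` ball (snd c x) r)" by (rule open_chart_vimage[OF cA(1) open_ball])
    show "x \<in> fst c \<inter> snd c -` ball (snd c x) r" using cA r by simp
    fix q assume q: "q \<in> fst c \<inter> snd c -` ball (snd c x) r"
    have "d (chart_inv c (snd c x)) (chart_inv c (snd c q)) \<le> (1 + 1) * cnorm c x (snd c q - snd c x)"
      by (rule norm_ball_d[OF c nb]) (use q r in \<open>auto simp: r_def\<close>)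
    also have "\<dots> \<le> 2 * (K * norm (snd c q - snd c x))" using K(2) by simp
    also have "\<dots> < 2 * (K * (e / (2 * K)))"
      using q K(1) by (intro mult_strict_left_mono) (auto simp: r_def dist_norm norm_minus_commute)
    also have "\<dots> = e" using K(1) by simp
    finally show "d x q < e" using q cA by (simp add: chart_inv_left)
  qed
qed

section \<open>Lower bounds for lengths and the topology of the metric\<close>

lemma integral_speed_nonneg:
  assumes adm: "admissible \<gamma> a b" and st: "a \<le> s" "t \<le> b"
  shows "0 \<le> integral {s..t} (speed \<gamma>)"
proof -
  obtain S where S: "finite S" "\<forall>t\<in>{a<..<b} - S. diff_at \<gamma> t" using adm unfolding admissible_def by blast
  have "integral {s..t} (speed \<gamma>) = integral {s..t} (\<lambda>t. if t \<in> S \<union> {a, b} then 0 else speed \<gamma> t)"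
    by (rule integral_spike[of "S \<union> {a, b}"]) (use S in \<open>auto intro: negligible_finite\<close>)
  also have "\<dots> \<ge> 0"
  proof (cases "(\<lambda>t. if t \<in> S \<union> {a, b} then 0 else speed \<gamma> t) integrable_on {s..t}")
    case True
    then show ?thesis
    proof (rule integral_nonneg)
      fix x assume "x \<in> {s..t}"
      then show "0 \<le> (if x \<in> S \<union> {a, b} then 0 else speed \<gamma> x)"
        using S(2) st speed_nonneg[OF admissible_isCont[OF adm]] by auto
    qed
  qed (simp add: not_integrable_integral)
  finally show ?thesis .
qed

text \<open>Inside the ball the coordinate velocity is at most \<open>2 / k\<close> times the speed:
  the norm ball with factor \<open>1 + 1\<close> contributes the 2, the equivalence of norms at
  \<open>x0\<close> the \<open>1 / k\<close>. The fundamental theorem of calculus integrates this,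
  with the value 0 at the finitely many exceptional points.\<close>

lemma chart_displacement_le:
  assumes adm: "admissible \<gamma> a b" and st: "a \<le> s" "s \<le> t" "t \<le> b"
    and c: "c \<in> charts_at A x0" and nb: "norm_ball c x0 1 \<rho>"
    and k: "k > 0" "\<And>v. k * norm v \<le> cnorm c x0 v"
    and U: "\<gamma> ` {s..t} \<subseteq> fst c \<inter> snd c -` ball (snd c x0) \<rho>"
  shows "norm (snd c (\<gamma> t) - snd c (\<gamma> s)) \<le> 2 / k * integral {s..t} (speed \<gamma>)"
proof -
  obtain S where S: "finite S" "\<forall>t\<in>{a<..<b} - S. diff_at \<gamma> t" using adm unfolding admissible_def by blast
  have cA: "c \<in> A" by (rule charts_atD[OF c])
  let ?f = "snd c \<circ> \<gamma>" and ?Z = "S \<union> {a, b}"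
  define f' where "f' r = (if r \<in> ?Z then 0 else vector_derivative ?f (at r))" for r
  define g where "g r = (if r \<in> ?Z then 0 else 2 / k * speed \<gamma> r)" for r
  have cont: "continuous_on {s..t} ?f"
  proof (rule continuous_on_compose)
    show "continuous_on {s..t} \<gamma>" using adm st unfolding admissible_def by (auto elim: continuous_on_subset)
    show "continuous_on (\<gamma> ` {s..t}) (snd c)" by (rule continuous_on_subset[OF continuous_on_chart[OF cA]]) (use U in blast)
  qed
  have vd: "(?f has_vector_derivative f' r) (at r) \<and> norm (f' r) \<le> 2 / k * speed \<gamma> r"
    if r: "r \<in> {s..t} - ?Z" for r
  proof -
    have ri: "r \<in> {a<..<b}" using r st by auto
    have isc: "isCont \<gamma> r" by (rule admissible_isCont[OF adm ri])
    obtain c' v where c': "c' \<in> charts_at A (\<gamma> r)" and v: "((snd c' \<circ> \<gamma>) has_vector_derivative v) (at r)"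
      using S(2) r ri unfolding diff_at_def by blast
    have rU: "\<gamma> r \<in> fst c \<inter> snd c -` ball (snd c x0) \<rho>" using U r by blast
    have cr: "c \<in> charts_at A (\<gamma> r)" using rU cA by (simp add: charts_at_def)
    have "(?f has_vector_derivative dT c' c (\<gamma> r) v) (at r)"
      using has_vector_derivative_chart_change[of \<gamma> r UNIV c' c v] isc c' cr v by (simp add: isCont_def)
    then have 1: "(?f has_vector_derivative f' r) (at r)"
      using r by (simp add: f'_def vector_derivative_at)
    have "k * norm (f' r) \<le> cnorm c x0 (f' r)" by (rule k)
    also have "\<dots> \<le> (1 + 1) * cnorm c (chart_inv c (snd c (\<gamma> r))) (f' r)"
      using nb rU unfolding norm_ball_def by blast
    also have "cnorm c (chart_inv c (snd c (\<gamma> r))) (f' r) = speed \<gamma> r"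
      using speed_eq[OF isc cr 1] rU cA by (simp add: chart_inv_left)
    finally have "norm (f' r) \<le> 2 / k * speed \<gamma> r" using k(1) by (simp add: field_simps)
    with 1 show ?thesis by blast
  qed
  have fin: "finite ?Z" using S by simp
  have f'int: "(f' has_integral (?f t - ?f s)) {s..t}"
    by (rule fundamental_theorem_of_calculus_interior_strong[OF fin st(2) _ cont]) (use vd in auto)
  have sint: "speed \<gamma> integrable_on {s..t}"
  proof -
    have "speed \<gamma> integrable_on {a..b}" using adm by (simp add: admissible_def)
    then show ?thesis by (rule integrable_on_subinterval) (use st in auto)
  qed
  have gint: "(g has_integral (2 / k * integral {s..t} (speed \<gamma>))) {s..t}"
    by (rule has_integral_spike_finite[OF fin _ has_integral_mult_right[OF integrable_integral[OF sint]]])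
       (simp add: g_def)
  have "norm (integral {s..t} f') \<le> integral {s..t} g"
  proof (rule Henstock_Kurzweil_Integration.integral_norm_bound_integral)
    fix r assume "r \<in> {s..t}"
    then show "norm (f' r) \<le> g r" using vd[of r] by (cases "r \<in> ?Z") (simp_all add: g_def f'_def)
  qed (use f'int gint in blast)+
  then show ?thesis using f'int gint by (simp add: integral_unique)
qed

text \<open>If a path could leave the chart ball after a short length, its coordinates up to the exit time
  would be Cauchy with a limit inside the ball, and as M is Hausdorff this limit would be the exit
  point.\<close>

lemma joined_lower_bound:
  assumes c: "c \<in> charts_at A x0" and nb: "norm_ball c x0 1 \<rho>"
    and k: "k > 0" "\<And>v. k * norm v \<le> cnorm c x0 v"
    and j: "joined x0 q l" and l: "2 / k * l < \<rho>"
  shows "q \<in> fst c \<inter> snd c -` ball (snd c x0) \<rho>" "norm (snd c q - snd c x0) \<le> 2 / k * l"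
proof -
  obtain \<gamma> a b where \<gamma>: "piecewise_C1_path A \<gamma> a b" "\<gamma> a = x0" "\<gamma> b = q" "path_length A F \<gamma> a b = l"
    using j unfolding joined_def by blast
  note adm = piecewise_C1_path_admissible[OF \<gamma>(1)]
  have ab: "a < b" and cont: "continuous_on {a..b} \<gamma>" and int: "speed \<gamma> integrable_on {a..b}"
    using adm by (auto simp: admissible_def)
  have cA: "c \<in> A" "x0 \<in> fst c" using c by (auto simp: charts_at_def)
  define U where "U = fst c \<inter> snd c -` ball (snd c x0) \<rho>"
  have U: "open U" "x0 \<in> U" using norm_ball_nhd[OF c nb] by (auto simp: U_def)
  define J where "J t = integral {a..t} (speed \<gamma>)" for t
  have Jc: "continuous_on {a..b} J" unfolding J_def by (rule indefinite_integral_continuous_1[OF int])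
  have Jab: "integral {s..t} (speed \<gamma>) = J t - J s" if "a \<le> s" "s \<le> t" "t \<le> b" for s t
  proof -
    have "speed \<gamma> integrable_on {a..t}" by (rule integrable_on_subinterval[OF int]) (use that in auto)
    from Henstock_Kurzweil_Integration.integral_combine[OF that(1,2) this]
    show ?thesis by (simp add: J_def)
  qed
  have Jl: "J t \<le> l" if "a \<le> t" "t \<le> b" for t
    using Jab[of t b] integral_speed_nonneg[OF adm, of t b] that \<gamma>(4) by (simp add: J_def path_length_eq)
  have J0: "0 \<le> J t" if "a \<le> t" "t \<le> b" for t
    using integral_speed_nonneg[OF adm, of a t] that by (simp add: J_def)
  have disp: "norm (snd c (\<gamma> t) - snd c (\<gamma> s)) \<le> 2 / k * (J t - J s)"
    if "a \<le> s" "s \<le> t" "t \<le> b" "\<gamma> ` {s..t} \<subseteq> U" for s t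
    using chart_displacement_le[OF adm that(1-3) c nb k] that Jab by (simp add: U_def)
  have Ja: "J a = 0" by (simp add: J_def)
  have "\<gamma> ` {a..b} \<subseteq> U"
  proof (rule ccontr)
    assume neg: "\<not> \<gamma> ` {a..b} \<subseteq> U"
    define Bad where "Bad = {a..b} \<inter> \<gamma> -` (- U)"
    have "Bad \<noteq> {}" using neg by (auto simp: Bad_def)
    have "closed Bad" unfolding Bad_def
      by (rule continuous_closed_preimage[OF cont]) (use U in \<open>auto simp: closed_def\<close>)
    moreover have "bounded Bad" unfolding Bad_def by (rule bounded_subset[OF bounded_closed_interval[of a b]]) auto
    ultimately have "compact Bad" by (simp add: compact_eq_bounded_closed)
    from compact_attains_inf[OF this \<open>Bad \<noteq> {}\<close>] obtain t1 where t1: "t1 \<in> Bad" "\<And>t. t \<in> Bad \<Longrightarrow> t1 \<le> t" by blast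
    have t1ab: "a \<le> t1" "t1 \<le> b" using t1(1) by (auto simp: Bad_def)
    have "t1 \<noteq> a" using t1(1) U(2) \<gamma>(2) by (auto simp: Bad_def)
    then have at1: "a < t1" using t1ab by simp
    have before: "\<gamma> t \<in> U" if "a \<le> t" "t < t1" for t
      using t1(2)[of t] that t1ab by (fastforce simp: Bad_def)
    \<comment> \<open>A sequence in \<open>[a, t1)\<close> converging to the exit time
      \<open>t1\<close>, along which the path is still in \<open>U\<close>.\<close>
    define \<tau> where "\<tau> n = t1 - (t1 - a) * inverse (real (Suc n))" for n
    have \<tau>: "a \<le> \<tau> n" "\<tau> n < t1" for n
    proof -
      have "(t1 - a) * inverse (real (Suc n)) \<le> (t1 - a) * 1"
        using at1 by (intro mult_left_mono) (auto simp: inverse_le_1_iff)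
      then show "a \<le> \<tau> n" by (simp add: \<tau>_def)
      show "\<tau> n < t1" using at1 by (simp add: \<tau>_def)
    qed
    have "\<tau> \<longlonglongrightarrow> t1 - (t1 - a) * 0" unfolding \<tau>_def
      by (intro tendsto_intros LIMSEQ_inverse_real_of_nat)
    then have \<tau>lim: "\<tau> \<longlonglongrightarrow> t1" by simp
    have \<tau>ab: "\<forall>\<^sub>F n in sequentially. \<tau> n \<in> {a..b}"
    proof (intro always_eventually allI)
      fix n show "\<tau> n \<in> {a..b}" using \<tau>[of n] t1ab by simp
    qed
    have Jlim: "(\<lambda>n. J (\<tau> n)) \<longlonglongrightarrow> J t1"
      by (rule continuous_on_tendsto_compose[OF Jc \<tau>lim _ \<tau>ab]) (use t1ab in simp)
    have \<gamma>lim: "(\<lambda>n. \<gamma> (\<tau> n)) \<longlonglongrightarrow> \<gamma> t1"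
      by (rule continuous_on_tendsto_compose[OF cont \<tau>lim _ \<tau>ab]) (use t1ab in simp)
    define y where "y n = snd c (\<gamma> (\<tau> n))" for n
    have step: "norm (y m - y n) \<le> 2 / k * \<bar>J (\<tau> m) - J (\<tau> n)\<bar>" for m n
    proof -
      have *: "norm (y m - y n) \<le> 2 / k * \<bar>J (\<tau> m) - J (\<tau> n)\<bar>" if "\<tau> n \<le> \<tau> m" for m n
      proof -
        have "\<gamma> t \<in> U" if "t \<in> {\<tau> n..\<tau> m}" for t
          using before[of t] \<tau>[of n] \<tau>[of m] that by simp
        then have "\<gamma> ` {\<tau> n..\<tau> m} \<subseteq> U" by blast
        then have "norm (y m - y n) \<le> 2 / k * (J (\<tau> m) - J (\<tau> n))"
          unfolding y_def using disp[of "\<tau> n" "\<tau> m"] \<tau>[of n] \<tau>[of m] t1ab that by simp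
        also have "\<dots> \<le> 2 / k * \<bar>J (\<tau> m) - J (\<tau> n)\<bar>" using k(1) by (intro mult_left_mono) auto
        finally show ?thesis .
      qed
      show ?thesis using *[of n m] *[of m n] by (cases "\<tau> n \<le> \<tau> m") (auto simp: norm_minus_commute abs_minus_commute)
    qed
    have "Cauchy (\<lambda>n. J (\<tau> n))" using Jlim by (rule LIMSEQ_imp_Cauchy)
    have "Cauchy y"
    proof (rule CauchyI)
      fix e :: real assume "e > 0"
      then have "k / 2 * e > 0" using k(1) by simp
      then obtain M where M: "\<And>m n. m \<ge> M \<Longrightarrow> n \<ge> M \<Longrightarrow> norm (J (\<tau> m) - J (\<tau> n)) < k / 2 * e"
        using CauchyD[OF \<open>Cauchy (\<lambda>n. J (\<tau> n))\<close>] by blast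
      have "norm (y m - y n) < e" if "m \<ge> M" "n \<ge> M" for m n
      proof -
        have "2 / k * \<bar>J (\<tau> m) - J (\<tau> n)\<bar> < 2 / k * (k / 2 * e)"
          using M[OF that] k(1) by (intro mult_strict_left_mono) auto
        then show ?thesis using step[of m n] k(1) by simp
      qed
      then show "\<exists>M. \<forall>m\<ge>M. \<forall>n\<ge>M. norm (y m - y n) < e" by blast
    qed
    then obtain z where z: "y \<longlonglongrightarrow> z" by (meson Cauchy_convergent_iff convergent_def)
    \<comment> \<open>The displacement before the exit time is bounded by the total length, and the
      strict inequality \<open>2 / k * l < \<rho>\<close> puts the limit into the open ball.\<close>
    have "norm (z - snd c x0) \<le> 2 / k * l"
    proof (rule LIMSEQ_le_const2)
      show "(\<lambda>n. norm (y n - snd c x0)) \<longlonglongrightarrow> norm (z - snd c x0)" by (intro tendsto_intros z)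
      have "norm (y n - snd c x0) \<le> 2 / k * l" for n
      proof -
        have "\<gamma> ` {a..\<tau> n} \<subseteq> U" using before \<tau>[of n] by (fastforce intro: le_less_trans)
        then have "norm (y n - snd c x0) \<le> 2 / k * (J (\<tau> n) - J a)"
          unfolding y_def using disp[of a "\<tau> n"] \<tau>[of n] t1ab \<gamma>(2) by simp
        also have "\<dots> \<le> 2 / k * l" using Jl[of "\<tau> n"] \<tau>[of n] t1ab k(1) Ja by (intro mult_left_mono) auto
        finally show ?thesis .
      qed
      then show "\<exists>N. \<forall>n\<ge>N. norm (y n - snd c x0) \<le> 2 / k * l" by blast
    qed
    then have zb: "z \<in> ball (snd c x0) \<rho>" using l by (simp add: dist_norm norm_minus_commute)
    then have zc: "z \<in> snd c ` fst c" using nb unfolding norm_ball_def by blast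
    have yU: "\<gamma> (\<tau> n) \<in> fst c" for n using before[OF \<tau>] by (simp add: U_def)
    have "(\<lambda>n. chart_inv c (y n)) \<longlonglongrightarrow> chart_inv c z"
      by (rule continuous_on_tendsto_compose[OF continuous_on_chart_inv[OF cA(1)] z zc])
         (use yU in \<open>auto simp: y_def\<close>)
    moreover have "chart_inv c (y n) = \<gamma> (\<tau> n)" for n unfolding y_def by (rule chart_inv_left[OF cA(1) yU])
    ultimately have "\<gamma> t1 = chart_inv c z" using LIMSEQ_unique \<gamma>lim by simp
    then have "\<gamma> t1 \<in> U" using zb chart_inv_in[OF cA(1) zc] chart_inv_right[OF cA(1) zc] by (simp add: U_def)
    then show False using t1(1) by (simp add: Bad_def)
  qed
  moreover have "J b = l" using \<gamma>(4) by (simp add: J_def path_length_eq)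
  ultimately have 1: "\<gamma> b \<in> U" "norm (snd c (\<gamma> b) - snd c (\<gamma> a)) \<le> 2 / k * l"
    using disp[of a b] ab Ja by auto
  show "q \<in> fst c \<inter> snd c -` ball (snd c x0) \<rho>" using 1(1) unfolding U_def \<gamma>(3) .
  show "norm (snd c q - snd c x0) \<le> 2 / k * l" using 1(2) unfolding \<gamma>(2,3) .
qed

text \<open>The converse of \<open>d_small_nhd\<close>: leaving a chart ball costs a fixed positive
  length, so the topology of \<open>d\<close> is that of the manifold. In particular
  \<open>d\<close> separates points.\<close>

lemma d_nhd_subset:
  assumes "open V" "x0 \<in> V" obtains e where "e > 0" "\<And>q. d x0 q < e \<Longrightarrow> q \<in> V"
proof -
  obtain c where c: "c \<in> charts_at A x0" by (rule charts_at_nonempty)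
  obtain \<rho> where nb: "norm_ball c x0 1 \<rho>" "chart_inv c ` ball (snd c x0) \<rho> \<subseteq> V"
    using norm_ball_exists[OF zero_less_one c assms] by blast
  obtain k where k: "k > 0" "\<And>v. k * norm v \<le> cnorm c x0 v" using cnorm_equiv[OF c] by metis
  show ?thesis
  proof (rule that)
    show "k / 2 * \<rho> > 0" using k nb by (simp add: norm_ball_def)
    fix q assume "d x0 q < k / 2 * \<rho>"
    then obtain l where l: "joined x0 q l" "l < k / 2 * \<rho>" using d_less by blast
    have "2 / k * l < \<rho>" using l(2) k(1) by (simp add: field_simps)
    from joined_lower_bound(1)[OF c nb(1) k l(1) this]
    have q: "q \<in> fst c" "snd c q \<in> ball (snd c x0) \<rho>" by auto
    then have "chart_inv c (snd c q) \<in> V" using nb(2) by blast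
    then show "q \<in> V" using q charts_atD[OF c] by (simp add: chart_inv_left)
  qed
qed

lemma d_eq_0: assumes "d x y = 0" shows "x = y"
proof (rule ccontr)
  assume "x \<noteq> y"
  then obtain V where "open V" "x \<in> V" "y \<notin> V" using t1_space by blast
  then show False using d_nhd_subset[of V x] assms by metis
qed

section \<open>Convergence and completeness with respect to the metric\<close>

lemma Metric_space_d: "Metric_space UNIV d"
proof
  show "0 \<le> d x y" "d x y = d y x" "d x z \<le> d x y + d y z" for x y z by (rule d_nonneg d_sym d_triangle)+
  show "d x y = 0 \<longleftrightarrow> x = y" for x y using d_eq_0 d_refl by blast
qed

lemma d_tendsto:
  assumes "(\<lambda>n. d (\<sigma> n) l) \<longlonglongrightarrow> 0" shows "\<sigma> \<longlonglongrightarrow> l"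
proof (rule topological_tendstoI)
  fix V assume "open V" "l \<in> V"
  then obtain e where e: "e > 0" "\<And>q. d l q < e \<Longrightarrow> q \<in> V" using d_nhd_subset by metis
  have "\<forall>\<^sub>F n in sequentially. d (\<sigma> n) l < e" using assms e(1) by (rule order_tendstoD)
  then show "\<forall>\<^sub>F n in sequentially. \<sigma> n \<in> V" by eventually_elim (use e(2) d_sym in metis)
qed

lemma closed_d_ball: "closed {q. d x0 q \<le> e}"
  unfolding closed_def
proof (subst open_subopen, intro ballI)
  fix q assume "q \<in> - {q. d x0 q \<le> e}"
  then have "d x0 q - e > 0" by simp
  then obtain V where V: "open V" "q \<in> V" "\<And>q'. q' \<in> V \<Longrightarrow> d q q' < d x0 q - e" using d_small_nhd by blast
  have "q' \<in> - {q. d x0 q \<le> e}" if "q' \<in> V" for q'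
    using V(3)[OF that] d_triangle[of x0 q q'] d_sym[of q q'] by simp
  with V show "\<exists>V. open V \<and> q \<in> V \<and> V \<subseteq> - {q. d x0 q \<le> e}" by blast
qed

lemma complete_Cauchy:
  assumes "complete_Finsler A F"
    and "\<And>e. e > 0 \<Longrightarrow> \<exists>N. \<forall>m\<ge>N. \<forall>n\<ge>m. d (\<sigma> m) (\<sigma> n) < e"
  obtains l where "(\<lambda>n. d (\<sigma> n) l) \<longlonglongrightarrow> 0"
proof -
  interpret Metric_space UNIV d by (rule Metric_space_d)
  have "MCauchy \<sigma>"
    unfolding MCauchy_def
  proof (intro conjI allI impI)
    fix e :: real assume "e > 0"
    then obtain N where N: "\<And>m n. m \<ge> N \<Longrightarrow> n \<ge> m \<Longrightarrow> d (\<sigma> m) (\<sigma> n) < e" using assms(2) by blast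
    have "d (\<sigma> n) (\<sigma> n') < e" if "N \<le> n" "N \<le> n'" for n n'
      using N[of n n'] N[of n' n] that d_sym by (cases "n \<le> n'") auto
    then show "\<exists>N. \<forall>n n'. N \<le> n \<longrightarrow> N \<le> n' \<longrightarrow> d (\<sigma> n) (\<sigma> n') < e" by blast
  qed simp
  then obtain l where "limitin mtopology \<sigma> l sequentially"
    using assms(1) unfolding complete_Finsler_def mcomplete_def by blast
  then have lim: "\<And>e. e > 0 \<Longrightarrow> \<forall>\<^sub>F n in sequentially. d (\<sigma> n) l < e"
    by (auto simp: limitin_metric)
  have "(\<lambda>n. d (\<sigma> n) l) \<longlonglongrightarrow> 0"
  proof (rule order_tendstoI)
    fix e :: real assume "e < 0"
    then show "\<forall>\<^sub>F n in sequentially. e < d (\<sigma> n) l" by (intro always_eventually allI) (use d_nonneg in \<open>auto intro: less_le_trans\<close>)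
  qed (use lim in blast)
  then show ?thesis by (rule that)
qed

end

section \<open>Covectors and test functions\<close>

lemma lower_semicontinuous_seq_lsc:
  assumes "lower_semicontinuous_on S f" shows "seq_lsc S f"
  unfolding seq_lsc_def
proof (intro allI impI)
  fix \<sigma> l r assume *: "\<forall>n::nat. \<sigma> n \<in> S" "l \<in> S" "\<sigma> \<longlonglongrightarrow> l" "r < f l"
  obtain T where T: "open T" "{x \<in> S. r < f x} = S \<inter> T"
    using assms unfolding lower_semicontinuous_on_def openin_open by blast
  have "l \<in> T" using T(2) * by blast
  from topological_tendstoD[OF *(3) T(1) this]
  show "\<forall>\<^sub>F n in sequentially. r < f (\<sigma> n)"
  proof eventually_elim
    case (elim n)
    then have "\<sigma> n \<in> {x \<in> S. r < f x}" unfolding T(2) using *(1) by blast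
    then show ?case by blast
  qed
qed

lemma upper_semicontinuous_seq_lsc:
  assumes "upper_semicontinuous_on S f" shows "seq_lsc S (\<lambda>x. - f x)"
proof (rule lower_semicontinuous_seq_lsc)
  have "{x \<in> S. r < - f x} = {x \<in> S. f x < - r}" for r by auto
  then show "lower_semicontinuous_on S (\<lambda>x. - f x)"
    using assms unfolding lower_semicontinuous_on_def upper_semicontinuous_on_def by simp
qed

context C1_Finsler_manifold begin

text \<open>The cotangent vector at \<open>x\<close> with coordinate functional \<open>p\<close>;
  the restriction gives the default value off the tangent space that \<open>cotangent_space\<close>
  asks for.\<close>

definition covec :: "('m, 'b) chart \<Rightarrow> 'm \<Rightarrow> ('b \<Rightarrow> real) \<Rightarrow> ('m, 'b) tangent \<Rightarrow> real" where
  "covec c x p = restrict (\<lambda>\<xi>. p (\<xi> c)) (tangent_space A x)"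

lemma covec_tangent_of:
  assumes "c \<in> charts_at A x" "c' \<in> charts_at A x"
  shows "covec c x p (tangent_of A c' x v) = p (dT c' c x v)"
  using tangent_of_in[OF assms(2)] by (simp add: covec_def tangent_of_apply[OF assms(1)])

lemma covec_in_cotangent_space:
  assumes c: "c \<in> charts_at A x" and p: "bounded_linear p"
  shows "covec c x p \<in> cotangent_space A x"
  unfolding cotangent_space_def
proof (intro CollectI conjI ballI)
  show "covec c x p \<in> extensional (tangent_space A x)" by (simp add: covec_def)
  fix c' assume c': "c' \<in> charts_at A x"
  show "bounded_linear (\<lambda>v. covec c x p (tangent_of A c' x v))"
    unfolding covec_tangent_of[OF c c'] by (rule bounded_linear_compose[OF p bounded_linear_dT[OF c' c]])
qed

definition cdual :: "('m, 'b) chart \<Rightarrow> 'm \<Rightarrow> ('b \<Rightarrow> real) \<Rightarrow> real" where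
  "cdual c x p = dual_norm A F x (covec c x p)"

text \<open>Evaluation at \<open>c\<close> identifies the tangent space with the model space and
  turns \<open>F x\<close> into \<open>cnorm c x\<close>.\<close>

lemma cdual_eq:
  assumes c: "c \<in> charts_at A x"
  shows "cdual c x p = Sup (insert 0 {\<bar>p w\<bar> | w. cnorm c x w = 1})"
proof -
  have "{\<bar>covec c x p \<xi>\<bar> | \<xi>. \<xi> \<in> tangent_space A x \<and> F x \<xi> = 1} = {\<bar>p w\<bar> | w. cnorm c x w = 1}" (is "?X = ?Y")
  proof
    show "?X \<subseteq> ?Y"
    proof
      fix r assume "r \<in> ?X"
      then obtain \<xi> where \<xi>: "r = \<bar>covec c x p \<xi>\<bar>" "\<xi> \<in> tangent_space A x" "F x \<xi> = 1" by blast
      have "cnorm c x (\<xi> c) = 1" using \<xi> by (simp add: cnorm_def tangent_of_eq[OF c])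
      moreover have "r = \<bar>p (\<xi> c)\<bar>" using \<xi> by (simp add: covec_def)
      ultimately show "r \<in> ?Y" by blast
    qed
    show "?Y \<subseteq> ?X"
    proof
      fix r assume "r \<in> ?Y"
      then obtain w where w: "r = \<bar>p w\<bar>" "cnorm c x w = 1" by blast
      have "r = \<bar>covec c x p (tangent_of A c x w)\<bar>"
        using w by (simp add: covec_tangent_of[OF c c] dT_self[OF c])
      then show "r \<in> ?X" using tangent_of_in[OF c, of w] w(2) unfolding cnorm_def by blast
    qed
  qed
  then show ?thesis by (simp add: cdual_def dual_norm_def)
qed

lemma cdual_le:
  assumes c: "c \<in> charts_at A x" and B: "B \<ge> 0" "\<And>w. \<bar>p w\<bar> \<le> B * cnorm c x w"
  shows "cdual c x p \<le> B"
  unfolding cdual_eq[OF c]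
proof (rule cSup_least)
  fix r assume "r \<in> insert 0 {\<bar>p w\<bar> | w. cnorm c x w = 1}"
  then show "r \<le> B"
  proof
    assume "r \<in> {\<bar>p w\<bar> | w. cnorm c x w = 1}"
    then obtain w where "r = \<bar>p w\<bar>" "cnorm c x w = 1" by blast
    then show ?thesis using B(2)[of w] by simp
  qed (use B in simp)
qed simp

lemma cdual_bound:
  assumes c: "c \<in> charts_at A x" and p: "bounded_linear p" and B: "\<And>w. \<bar>p w\<bar> \<le> B * cnorm c x w"
  shows "0 \<le> cdual c x p" "\<bar>p w\<bar> \<le> cdual c x p * cnorm c x w"
proof -
  let ?X = "insert 0 {\<bar>p w\<bar> | w. cnorm c x w = 1}"
  interpret bounded_linear p by (rule p)
  have "r \<le> max 0 B" if "r \<in> ?X" for r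
  proof -
    have "\<bar>p w\<bar> \<le> B" if "cnorm c x w = 1" for w using B[of w] that by simp
    then show ?thesis using that by fastforce
  qed
  then have bdd: "bdd_above ?X" by (rule bdd_aboveI)
  show 0: "0 \<le> cdual c x p" unfolding cdual_eq[OF c] by (rule cSup_upper[OF _ bdd]) simp
  show "\<bar>p w\<bar> \<le> cdual c x p * cnorm c x w"
  proof (cases "cnorm c x w = 0")
    \<comment> \<open>Here \<open>w\<close> cannot be normalized; the a priori bound by
      \<open>B\<close> gives \<open>p w = 0\<close>.\<close>
    case True then show ?thesis using B[of w] by simp
  next
    case False
    then have n: "cnorm c x w > 0" using cnorm_nonneg[OF c, of w] by simp
    let ?w = "(1 / cnorm c x w) *\<^sub>R w"
    have "cnorm c x ?w = 1" using n by (simp add: cnorm_scale[OF c])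
    then have "\<bar>p ?w\<bar> \<le> cdual c x p" unfolding cdual_eq[OF c] by (intro cSup_upper[OF _ bdd]) blast
    then show ?thesis using n by (simp add: scaleR abs_mult pos_divide_le_eq)
  qed
qed

text \<open>Dual norms at \<open>x1\<close> and \<open>x2\<close> are compared through
  \<open>x0\<close>: two changes of base point multiply a dual norm of size at most
  \<open>2 * P\<close> by \<open>(1 + e)^2 \<le> 1 + 3 * e\<close>, whence \<open>6 * e * P\<close>;
  the change of functional costs \<open>(1 + e) * \<kappa> \<le> 2 * \<kappa>\<close>.\<close>

lemma cdual_compare:
  assumes c: "c \<in> charts_at A x0" "c \<in> charts_at A x1" "c \<in> charts_at A x2"
    and p: "bounded_linear p1" "bounded_linear p2"
    and x1: "\<And>w. cnorm c x0 w \<le> (1 + e) * cnorm c x1 w" "\<And>w. cnorm c x1 w \<le> (1 + e) * cnorm c x0 w"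
    and x2: "\<And>w. cnorm c x0 w \<le> (1 + e) * cnorm c x2 w" "\<And>w. cnorm c x2 w \<le> (1 + e) * cnorm c x0 w"
    and e: "0 < e" "e \<le> 1" and P: "P \<ge> 0" "\<And>w. \<bar>p1 w\<bar> \<le> P * cnorm c x0 w" "\<And>w. \<bar>p2 w\<bar> \<le> P * cnorm c x0 w"
    and \<kappa>: "\<kappa> \<ge> 0" "\<And>w. \<bar>p1 w - p2 w\<bar> \<le> \<kappa> * cnorm c x0 w"
  shows "cdual c x1 p1 \<le> 2 * P" "cdual c x1 p1 - cdual c x2 p2 \<le> 6 * e * P + 2 * \<kappa>"
proof -
  have b: "a * cnorm c x0 w \<le> ((1 + e) * a) * cnorm c x w"
    if "a \<ge> 0" "\<And>w. cnorm c x0 w \<le> (1 + e) * cnorm c x w" for a w x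
    using mult_left_mono[OF that(2)[of w] that(1)] by (simp add: algebra_simps)
  have b1: "\<bar>p1 w\<bar> \<le> ((1 + e) * P) * cnorm c x1 w" for w using P(2)[of w] b[OF P(1) x1(1), of w] by linarith
  have b2: "\<bar>p2 w\<bar> \<le> ((1 + e) * P) * cnorm c x2 w" for w using P(3)[of w] b[OF P(1) x2(1), of w] by linarith
  have eP: "(1 + e) * P \<le> 2 * P" using e P(1) by (intro mult_right_mono) auto
  have "cdual c x1 p1 \<le> (1 + e) * P" by (rule cdual_le[OF c(2) _ b1]) (use e P in simp)
  with eP show "cdual c x1 p1 \<le> 2 * P" by linarith
  define D where "D = cdual c x2 p2"
  have D: "0 \<le> D" "\<And>w. \<bar>p2 w\<bar> \<le> D * cnorm c x2 w"
    unfolding D_def using cdual_bound[OF c(3) p(2) b2] by auto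
  have D2: "D \<le> 2 * P" using cdual_le[OF c(3) _ b2] e P eP unfolding D_def by simp
  have "cdual c x1 p1 \<le> (1 + e) * (1 + e) * D + (1 + e) * \<kappa>"
  proof (rule cdual_le[OF c(2)])
    show "0 \<le> (1 + e) * (1 + e) * D + (1 + e) * \<kappa>" using e D(1) \<kappa>(1) by simp
    fix w
    have "\<bar>p1 w\<bar> \<le> \<bar>p2 w\<bar> + \<bar>p1 w - p2 w\<bar>" by simp
    also have "\<dots> \<le> D * cnorm c x2 w + \<kappa> * cnorm c x0 w" using D(2)[of w] \<kappa>(2)[of w] by linarith
    also have "D * cnorm c x2 w \<le> D * ((1 + e) * ((1 + e) * cnorm c x1 w))"
    proof (rule mult_left_mono[OF _ D(1)])
      have "(1 + e) * cnorm c x0 w \<le> (1 + e) * ((1 + e) * cnorm c x1 w)" using x1(1)[of w] e by (intro mult_left_mono) auto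
      then show "cnorm c x2 w \<le> (1 + e) * ((1 + e) * cnorm c x1 w)" using x2(2)[of w] by linarith
    qed
    also have "\<kappa> * cnorm c x0 w \<le> ((1 + e) * \<kappa>) * cnorm c x1 w" by (rule b[OF \<kappa>(1) x1(1)])
    finally show "\<bar>p1 w\<bar> \<le> ((1 + e) * (1 + e) * D + (1 + e) * \<kappa>) * cnorm c x1 w"
      by (simp add: algebra_simps)
  qed
  also have "(1 + e) * (1 + e) * D = D + (2 + e) * e * D" by (simp add: algebra_simps)
  also have "(2 + e) * e * D \<le> 3 * e * (2 * P)"
    using e D(1) D2 by (intro mult_mono) auto
  also have "(1 + e) * \<kappa> \<le> 2 * \<kappa>" using e \<kappa> by (intro mult_right_mono) auto
  finally show "cdual c x1 p1 - cdual c x2 p2 \<le> 6 * e * P + 2 * \<kappa>" by (simp add: D_def)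
qed

text \<open>For an extension by zero to be C1 on all of M, the support must lie in a subset of the
  chart domain that is closed in M. Closedness in coordinates does not give this, as closed balls of
  the model space need not be compact; a closed ball of the Finsler metric does.\<close>

lemma cutoff_exists:
  assumes h: "normalized_bump (h :: 'b \<Rightarrow> real)" and c: "c \<in> charts_at A x"
  obtains \<beta> :: "'b \<Rightarrow> real" and r C where "C1_on \<beta> UNIV" "r > 0"
    "\<And>y. y \<in> ball (snd c x) r \<Longrightarrow> \<beta> y = 1"
    "closed C" "C \<subseteq> fst c" "\<And>q. q \<in> fst c \<Longrightarrow> q \<notin> C \<Longrightarrow> \<beta> (snd c q) = 0"
proof -
  have cA: "c \<in> A" "x \<in> fst c" using c by (auto simp: charts_at_def)
  obtain e where e: "e > 0" "\<And>q. d x q < e \<Longrightarrow> q \<in> fst c"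
    using d_nhd_subset[OF chart_facts(1)[OF cA(1)] cA(2)] by metis
  define C where "C = {q. d x q \<le> e / 2}"
  have C: "closed C" unfolding C_def by (rule closed_d_ball)
  have C': "C \<subseteq> fst c" using e by (auto simp: C_def)
  have e2: "e / 2 > 0" using e by simp
  obtain V where V: "open V" "x \<in> V" "\<And>q. q \<in> V \<Longrightarrow> d x q < e / 2" using d_small_nhd[OF e2] by metis
  obtain \<rho> where nb: "norm_ball c x 1 \<rho>" "chart_inv c ` ball (snd c x) \<rho> \<subseteq> V"
    by (rule norm_ball_exists[OF zero_less_one c V(1,2)])
  have \<rho>: "\<rho> > 0" using nb by (simp add: norm_ball_def)
  obtain r0 where r0: "r0 > 0" "\<And>x. norm x < r0 \<Longrightarrow> h x = 1" using h unfolding normalized_bump_def by blast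
  define \<beta> where "\<beta> y = h ((1 / \<rho>) *\<^sub>R y + (- (1 / \<rho>) *\<^sub>R snd c x))" for y
  have \<beta>_eq: "\<beta> y = h ((1 / \<rho>) *\<^sub>R (y - snd c x))" for y by (simp add: \<beta>_def algebra_simps)
  show ?thesis
  proof (rule that)
    have "C1_on h UNIV" using h by (simp add: normalized_bump_def)
    moreover have "C1_on (\<lambda>y. (1 / \<rho>) *\<^sub>R y + (- (1 / \<rho>) *\<^sub>R snd c x)) UNIV"
      by (intro C1_on_add C1_on_const C1_on_bounded_linear bounded_linear_scaleR_right)
    ultimately show "C1_on \<beta> UNIV"
      unfolding \<beta>_def using C1_on_compose[of h UNIV "\<lambda>y. (1 / \<rho>) *\<^sub>R y + (- (1 / \<rho>) *\<^sub>R snd c x)" UNIV] by blast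
    show "r0 * \<rho> > 0" using r0 \<rho> by simp
    fix y assume "y \<in> ball (snd c x) (r0 * \<rho>)"
    then have "norm ((1 / \<rho>) *\<^sub>R (y - snd c x)) < r0"
      using \<rho> by (simp add: dist_norm norm_minus_commute pos_divide_less_eq)
    then show "\<beta> y = 1" unfolding \<beta>_eq by (rule r0)
  next
    fix q assume q: "q \<in> fst c" "q \<notin> C"
    have "snd c q \<notin> ball (snd c x) \<rho>"
    proof
      assume "snd c q \<in> ball (snd c x) \<rho>"
      then have "chart_inv c (snd c q) \<in> V" using nb(2) by blast
      then have "d x q < e / 2" using V(3) q cA by (simp add: chart_inv_left)
      then show False using q by (simp add: C_def)
    qed
    then have "norm ((1 / \<rho>) *\<^sub>R (snd c q - snd c x)) \<ge> 1"
      using \<rho> by (simp add: dist_norm norm_minus_commute)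
    then show "\<beta> (snd c q) = 0" unfolding \<beta>_eq using h unfolding normalized_bump_def by blast
  qed (rule C C')+
qed

text \<open>The subdifferential asks for test functions on the whole manifold, whereas the
  variational argument produces them in one chart. A cutoff in the space variable bridges this; none
  is applied in time, where the coordinate function is already global.\<close>

lemma test_function_exists:
  fixes f :: "real \<times> 'b \<Rightarrow> real"
  assumes h: "normalized_bump (h :: 'b \<Rightarrow> real)" and c: "c \<in> charts_at A x"
    and f: "C1_on f UNIV" and q: "(f has_derivative q) (at (t, snd c x))"
  obtains g where "C1_function A g" "\<forall>\<^sub>F z in nhds (t, x). g z = f (fst z, snd c (snd z))"
    "g (t, x) = f (t, snd c x)"
    "represents_differential A g (t, x) (q (1, 0), covec c x (\<lambda>v. q (0, v)))"
proof -
  have cA: "c \<in> A" "x \<in> fst c" using c by (auto simp: charts_at_def)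
  obtain \<beta> :: "'b \<Rightarrow> real" and r C where \<beta>C: "C1_on \<beta> UNIV" and r: "r > 0"
    and \<beta>1: "\<And>y. y \<in> ball (snd c x) r \<Longrightarrow> \<beta> y = 1"
    and C: "closed C" "C \<subseteq> fst c" and \<beta>0: "\<And>q. q \<in> fst c \<Longrightarrow> q \<notin> C \<Longrightarrow> \<beta> (snd c q) = 0"
    using cutoff_exists[OF h c] by metis
  define g where "g z = (if snd z \<in> fst c then \<beta> (snd c (snd z)) * f (fst z, snd c (snd z)) else 0)" for z
  let ?B = "fst c \<inter> snd c -` ball (snd c x) r"
  have B: "open ?B" "x \<in> ?B" using open_chart_vimage[OF cA(1) open_ball] cA r by auto
  have gB: "g z = f (fst z, snd c (snd z))" if "snd z \<in> ?B" for z
    using that \<beta>1[of "snd c (snd z)"] by (simp add: g_def)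
  have op: "open ((UNIV :: real set) \<times> snd c' ` W)" if "c' \<in> A" "open W" "W \<subseteq> fst c'" for c' :: "('m, 'b) chart" and W
    using open_chart_image[OF that] by (intro open_Times) auto
  have C1g: "C1_function A g"
    unfolding C1_function_def
  proof (intro ballI C1_on_local)
    fix c' :: "('m, 'b) chart" and z :: "real \<times> 'b" assume c': "c' \<in> A" and z: "z \<in> {0<..} \<times> snd c' ` fst c'"
    obtain s x' where z: "z = (s, snd c' x')" "x' \<in> fst c'" using z by auto
    show "\<exists>T. open T \<and> z \<in> T \<and> C1_on (\<lambda>(t, y). g (t, chart_inv c' y)) T"
    proof (cases "x' \<in> fst c")
      case True
      let ?W = "fst c' \<inter> fst c"
      let ?T = "(UNIV :: real set) \<times> snd c' ` ?W"
      have oT: "open ?T" using chart_facts(1)[OF c'] chart_facts(1)[OF cA(1)] by (intro op[OF c']) auto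
      have tr: "C1_on (\<lambda>z. transition c' c (snd z)) ?T"
      proof (rule C1_on_compose[of "transition c' c" "snd c' ` ?W" snd ?T])
        show "C1_on (transition c' c) (snd c' ` ?W)" by (rule C1_on_transition[OF c' cA(1)])
        show "C1_on snd ?T" by (rule C1_on_snd)
        show "snd w \<in> snd c' ` ?W" if "w \<in> ?T" for w using that by (rule mem_Times_iff[THEN iffD1, THEN conjunct2])
      qed
      have "C1_on (\<lambda>z. \<beta> (transition c' c (snd z))) ?T"
        using C1_on_compose[of \<beta> UNIV "\<lambda>z. transition c' c (snd z)" ?T] \<beta>C tr by simp
      moreover have "C1_on (\<lambda>z. f (fst z, transition c' c (snd z))) ?T"
        using C1_on_compose[of f UNIV "\<lambda>z. (fst z, transition c' c (snd z))" ?T] f C1_on_Pair[OF C1_on_fst tr] by simp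
      ultimately have "C1_on (\<lambda>z. \<beta> (transition c' c (snd z)) * f (fst z, transition c' c (snd z))) ?T" by (rule C1_on_mult)
      then have "C1_on (\<lambda>(t, y). g (t, chart_inv c' y)) ?T"
      proof (rule C1_on_cong_open[OF _ oT])
        fix w assume "w \<in> ?T"
        then obtain a b where w: "w = (a, snd c' b)" "b \<in> ?W" by auto
        then show "\<beta> (transition c' c (snd w)) * f (fst w, transition c' c (snd w)) = (\<lambda>(t, y). g (t, chart_inv c' y)) w"
          using c' by (simp add: g_def transition_apply chart_inv_left)
      qed
      moreover have "z \<in> ?T" using True z by auto
      ultimately show ?thesis using oT by blast
    next
      case False
      \<comment> \<open>A point outside the domain of \<open>c\<close> is outside the closed set
        \<open>C\<close>, and on the complement of \<open>C\<close> the function \<open>g\<close>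
        vanishes identically.\<close>
      let ?W = "fst c' \<inter> - C"
      let ?T = "(UNIV :: real set) \<times> snd c' ` ?W"
      have oT: "open ?T" using chart_facts(1)[OF c'] C by (intro op[OF c']) auto
      have "C1_on (\<lambda>(t, y). g (t, chart_inv c' y)) ?T"
      proof (rule C1_on_cong_open[OF C1_on_const[of 0] oT])
        fix w assume "w \<in> ?T"
        then obtain a b where w: "w = (a, snd c' b)" "b \<in> ?W" by auto
        then show "0 = (\<lambda>(t, y). g (t, chart_inv c' y)) w"
          using c' \<beta>0[of b] by (simp add: g_def chart_inv_left)
      qed
      moreover have "z \<in> ?T" using False z C by auto
      ultimately show ?thesis using oT by blast
    qed
  qed
  have ev: "\<forall>\<^sub>F z in nhds (t, x). g z = f (fst z, snd c (snd z))"
  proof -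
    have "open (UNIV \<times> ?B)" using B by (intro open_Times) auto
    moreover have "(t, x) \<in> UNIV \<times> ?B" using B by simp
    ultimately have "\<forall>\<^sub>F z in nhds (t, x). z \<in> UNIV \<times> ?B" by (rule eventually_nhds_in_open)
    then show ?thesis by (rule eventually_mono) (use gB in auto)
  qed
  have gtx: "g (s, x) = f (s, snd c x)" for s using gB[of "(s, x)"] B by simp
  interpret q: bounded_linear q using q by (rule has_derivative_bounded_linear)
  have p: "bounded_linear (\<lambda>v. q (0, v))"
    by (rule bounded_linear_compose[OF q.bounded_linear_axioms]) (intro bounded_linear_Pair bounded_linear_zero bounded_linear_ident)
  have dt: "((\<lambda>s. g (s, x)) has_real_derivative q (1, 0)) (at t)"
  proof -
    have "((\<lambda>s. (s, snd c x)) has_derivative (\<lambda>h. (h, 0))) (at t)"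
      by (intro has_derivative_Pair has_derivative_ident has_derivative_const)
    from has_derivative_compose[OF this q]
    have "((\<lambda>s. g (s, x)) has_derivative (\<lambda>h. q (h, 0))) (at t)" by (simp add: gtx)
    moreover have "q (h, 0) = q (1, 0) * h" for h using q.scaleR[of h "(1, 0)"] by simp
    then have "(\<lambda>h. q (h, 0)) = (*) (q (1, 0))" by (rule ext)
    ultimately show ?thesis by (simp add: has_field_derivative_def)
  qed
  have dx: "((\<lambda>y. g (t, chart_inv c' y)) has_derivative (\<lambda>v. covec c x (\<lambda>v. q (0, v)) (tangent_of A c' x v))) (at (snd c' x))"
    if c': "c' \<in> charts_at A x" for c'
  proof -
    have c'A: "c' \<in> A" "x \<in> fst c'" using c' by (auto simp: charts_at_def)
    let ?T = "snd c' ` (fst c' \<inter> ?B)"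
    have T: "open ?T" "snd c' x \<in> ?T"
      using chart_facts(1)[OF c'A(1)] B c'A by (auto intro!: open_chart_image[OF c'A(1)] open_Int imageI)
    have "((\<lambda>y. (t, transition c' c y)) has_derivative (\<lambda>v. (0, dT c' c x v))) (at (snd c' x))"
      by (intro has_derivative_Pair has_derivative_const dT_has_derivative c' c)
    moreover have "(f has_derivative q) (at (t, transition c' c (snd c' x)))"
      using q c'A by (simp add: transition_apply)
    ultimately have "((\<lambda>y. f (t, transition c' c y)) has_derivative (\<lambda>v. q (0, dT c' c x v))) (at (snd c' x))"
      by (rule has_derivative_compose)
    then have "((\<lambda>y. g (t, chart_inv c' y)) has_derivative (\<lambda>v. q (0, dT c' c x v))) (at (snd c' x))"
    proof (rule has_derivative_transform_within_open[OF _ T])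
      fix y assume "y \<in> ?T"
      then obtain b where b: "y = snd c' b" "b \<in> fst c'" "b \<in> ?B" by blast
      then show "f (t, transition c' c y) = g (t, chart_inv c' y)"
        using gB[of "(t, b)"] c'A by (simp add: transition_apply chart_inv_left)
    qed
    then show ?thesis by (simp only: covec_tangent_of[OF c c'])
  qed
  have "represents_differential A g (t, x) (q (1, 0), covec c x (\<lambda>v. q (0, v)))"
    unfolding represents_differential_def using dt covec_in_cotangent_space[OF c p] dx by simp
  then show ?thesis using that C1g ev gtx by blast
qed

lemma subdifferentialI:
  fixes f :: "real \<times> 'b \<Rightarrow> real"
  assumes h: "normalized_bump (h :: 'b \<Rightarrow> real)" and c: "c \<in> charts_at A x"
    and f: "C1_on f UNIV" and q: "(f has_derivative q) (at (t, snd c x))"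
    and mn: "\<forall>\<^sub>F z in nhds (t, x). w (t, x) - f (t, snd c x) \<le> w z - f (fst z, snd c (snd z))"
  shows "(q (1, 0), covec c x (\<lambda>v. q (0, v))) \<in> subdifferential A w (t, x)"
proof -
  obtain g where g: "C1_function A g" "\<forall>\<^sub>F z in nhds (t, x). g z = f (fst z, snd c (snd z))"
    "g (t, x) = f (t, snd c x)"
    "represents_differential A g (t, x) (q (1, 0), covec c x (\<lambda>v. q (0, v)))"
    by (rule test_function_exists[OF h c f q])
  have "\<forall>\<^sub>F z in nhds (t, x). w (t, x) - g (t, x) \<le> w z - g z"
    using mn g(2) by eventually_elim (simp add: g(3))
  with g show ?thesis unfolding subdifferential_def by blast
qed

lemma superdifferentialI:
  fixes f :: "real \<times> 'b \<Rightarrow> real"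
  assumes h: "normalized_bump (h :: 'b \<Rightarrow> real)" and c: "c \<in> charts_at A x"
    and f: "C1_on f UNIV" and q: "(f has_derivative q) (at (t, snd c x))"
    and mx: "\<forall>\<^sub>F z in nhds (t, x). w z - f (fst z, snd c (snd z)) \<le> w (t, x) - f (t, snd c x)"
  shows "(q (1, 0), covec c x (\<lambda>v. q (0, v))) \<in> superdifferential A w (t, x)"
proof -
  obtain g where g: "C1_function A g" "\<forall>\<^sub>F z in nhds (t, x). g z = f (fst z, snd c (snd z))"
    "g (t, x) = f (t, snd c x)"
    "represents_differential A g (t, x) (q (1, 0), covec c x (\<lambda>v. q (0, v)))"
    by (rule test_function_exists[OF h c f q])
  have "\<forall>\<^sub>F z in nhds (t, x). w z - g z \<le> w (t, x) - g (t, x)"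
    using mx g(2) by eventually_elim (simp add: g(3))
  with g show ?thesis unfolding superdifferential_def by blast
qed

section \<open>The comparison principle\<close>

lemma chart_tendsto:
  assumes c: "c \<in> A" "x \<in> fst c"
  shows "((\<lambda>z. (fst z, snd c (snd z))) \<longlongrightarrow> (t, snd c x)) (nhds (t :: real, x))"
    and "\<forall>\<^sub>F z in nhds (t :: real, x). snd z \<in> fst c"
proof -
  have "isCont (snd c) x"
    using continuous_on_chart[OF c(1)] chart_facts(1)[OF c(1)] c(2) by (simp add: continuous_on_eq_continuous_at)
  then have lim: "(snd c \<longlongrightarrow> snd c x) (nhds x)" by (simp add: isCont_def tendsto_at_iff_tendsto_nhds)
  have f: "filterlim fst (nhds t) (nhds (t, x))" "filterlim snd (nhds x) (nhds (t, x))"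
    using tendsto_fst[OF filterlim_ident, of "(t, x)"] tendsto_snd[OF filterlim_ident, of "(t, x)"] by simp_all
  show "((\<lambda>z. (fst z, snd c (snd z))) \<longlongrightarrow> (t, snd c x)) (nhds (t, x))"
    by (rule tendsto_Pair[OF f(1) filterlim_compose[OF lim f(2)]])
  have "\<forall>\<^sub>F x' in nhds x. x' \<in> fst c" by (rule eventually_nhds_in_open[OF chart_facts(1)[OF c(1)] c(2)])
  then show "\<forall>\<^sub>F z in nhds (t, x). snd z \<in> fst c" using f(2) by (rule eventually_compose_filterlim)
qed

text \<open>Since \<open>v + g\<close> is minimal, the test function is \<open>- g\<close>, whence
  the minus signs on the derivative \<open>q\<close>.\<close>

lemma supersolution_in_chart:
  assumes h: "normalized_bump (h :: 'b \<Rightarrow> real)" and c: "c \<in> charts_at A x" and t: "t > 0"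
    and super: "\<And>t x \<alpha> \<Delta>. t > 0 \<Longrightarrow> (\<alpha>, \<Delta>) \<in> subdifferential A v (t, x) \<Longrightarrow> 0 \<le> \<alpha> + H (t, x, dual_norm A F x \<Delta>)"
    and g: "C1_on g UNIV" "(g has_derivative q) (at (t, snd c x))"
    and mn: "\<forall>\<^sub>F z in nhds (t, snd c x). v (t, x) + g (t, snd c x) \<le> v (fst z, chart_inv c (snd z)) + g z"
  shows "0 \<le> - q (1, 0) + H (t, x, cdual c x (\<lambda>w. - q (0, w)))"
  unfolding cdual_def
proof (rule super[OF t])
  have cA: "c \<in> A" "x \<in> fst c" using c by (auto simp: charts_at_def)
  have "\<forall>\<^sub>F z in nhds (t, x). v (t, x) + g (t, snd c x) \<le>
      v (fst (fst z, snd c (snd z)), chart_inv c (snd (fst z, snd c (snd z)))) + g (fst z, snd c (snd z))"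
    by (rule eventually_compose_filterlim[OF mn chart_tendsto(1)[OF cA]])
  with chart_tendsto(2)[OF cA]
  have "\<forall>\<^sub>F z in nhds (t, x). v (t, x) - - g (t, snd c x) \<le> v z - - g (fst z, snd c (snd z))"
    by eventually_elim (simp add: chart_inv_left[OF cA(1)])
  from subdifferentialI[OF h c C1_on_uminus[OF g(1)] has_derivative_minus[OF g(2)] this]
  show "(- q (1, 0), covec c x (\<lambda>w. - q (0, w))) \<in> subdifferential A v (t, x)" .
qed

text \<open>Minimality of \<open>- u + g\<close> is maximality of \<open>u - g\<close>, so here
  \<open>g\<close> itself is the test function. Because of this asymmetry with the supersolution,
  the difference of the two covectors is a sum of derivatives, as in the sum rule.\<close>

lemma subsolution_in_chart:
  assumes h: "normalized_bump (h :: 'b \<Rightarrow> real)" and c: "c \<in> charts_at A x" and t: "t > 0"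
    and sub: "\<And>t x \<alpha> \<Delta>. t > 0 \<Longrightarrow> (\<alpha>, \<Delta>) \<in> superdifferential A u (t, x) \<Longrightarrow> \<alpha> + H (t, x, dual_norm A F x \<Delta>) \<le> 0"
    and g: "C1_on g UNIV" "(g has_derivative q) (at (t, snd c x))"
    and mn: "\<forall>\<^sub>F z in nhds (t, snd c x). - u (t, x) + g (t, snd c x) \<le> - u (fst z, chart_inv c (snd z)) + g z"
  shows "q (1, 0) + H (t, x, cdual c x (\<lambda>w. q (0, w))) \<le> 0"
  unfolding cdual_def
proof (rule sub[OF t])
  have cA: "c \<in> A" "x \<in> fst c" using c by (auto simp: charts_at_def)
  have "\<forall>\<^sub>F z in nhds (t, x). - u (t, x) + g (t, snd c x) \<le>
      - u (fst (fst z, snd c (snd z)), chart_inv c (snd (fst z, snd c (snd z)))) + g (fst z, snd c (snd z))"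
    by (rule eventually_compose_filterlim[OF mn chart_tendsto(1)[OF cA]])
  with chart_tendsto(2)[OF cA]
  have "\<forall>\<^sub>F z in nhds (t, x). u z - g (fst z, snd c (snd z)) \<le> u (t, x) - g (t, snd c x)"
    by eventually_elim (simp add: chart_inv_left[OF cA(1)])
  from superdifferentialI[OF h c g this]
  show "(q (1, 0), covec c x (\<lambda>w. q (0, w))) \<in> superdifferential A u (t, x)" .
qed

text \<open>The order of quantifiers carries the proof: \<open>\<epsilon>\<close> is limited only by
  \<open>\<tau>\<close> and \<open>\<sigma>\<close>, while the local Lipschitz constant and the
  constants of the chart are obtained inside. The covectors differ by a multiple of
  \<open>\<epsilon>\<close>, which the tolerance \<open>\<tau>\<close> of \<open>\<omega>\<close>
  absorbs; the points differ by a multiple of \<open>\<eta>\<close>, which is chosen last and beats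
  the bound on the covectors.\<close>

lemma no_approximate_touching_point:
  fixes \<omega> :: "real \<times> real \<times> real \<Rightarrow> real" and \<theta> \<theta>' :: "real \<Rightarrow> real"
  assumes h: "normalized_bump (h :: 'b \<Rightarrow> real)"
    and super: "\<And>t x \<alpha> \<Delta>. t > 0 \<Longrightarrow> (\<alpha>, \<Delta>) \<in> subdifferential A v (t, x) \<Longrightarrow> 0 \<le> \<alpha> + H (t, x, dual_norm A F x \<Delta>)"
    and sub: "\<And>t x \<alpha> \<Delta>. t > 0 \<Longrightarrow> (\<alpha>, \<Delta>) \<in> superdifferential A u (t, x) \<Longrightarrow> \<alpha> + H (t, x, dual_norm A F x \<Delta>) \<le> 0"
    and lsc: "seq_lsc ({0..} \<times> UNIV) v" "seq_lsc ({0..} \<times> UNIV) (\<lambda>z. - u z)"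
    and bd: "\<And>t x. 0 \<le> t \<Longrightarrow> t \<le> T \<Longrightarrow> \<bar>u (t, x)\<bar> \<le> M \<and> \<bar>v (t, x)\<bar> \<le> M"
    and Lip: "Lipschitz_near A F u (t0, x0) \<or> Lipschitz_near A F v (t0, x0)"
    and C: "C \<ge> 0"
    and HA: "\<And>t1 t2 x1 x2 r1 r2. 0 \<le> t1 \<Longrightarrow> 0 \<le> t2 \<Longrightarrow> \<bar>H (t1, x1, r1) - H (t2, x2, r2)\<bar> \<le>
       \<omega> (\<bar>t1 - t2\<bar>, d x1 x2, r1 - r2) + C * max \<bar>r1\<bar> \<bar>r2\<bar> * (\<bar>t1 - t2\<bar> + d x1 x2)"
    and \<omega>: "\<And>a b c. 0 \<le> a \<Longrightarrow> a \<le> \<tau> \<Longrightarrow> \<bar>b\<bar> \<le> \<tau> \<Longrightarrow> \<bar>c\<bar> \<le> \<tau> \<Longrightarrow> \<omega> (a, b, c) \<le> \<sigma> / 4" and \<tau>: "\<tau> > 0"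
    and \<theta>: "\<And>t. 0 < t \<Longrightarrow> t < T \<Longrightarrow> (\<theta> has_real_derivative \<theta>' t) (at t)" "\<And>t. 0 < t \<Longrightarrow> t < T \<Longrightarrow> \<sigma> \<le> \<theta>' t"
    and L\<theta>: "\<And>s t. 0 \<le> s \<Longrightarrow> s \<le> T \<Longrightarrow> 0 \<le> t \<Longrightarrow> t \<le> T \<Longrightarrow> \<bar>\<theta> s - \<theta> t\<bar> \<le> L\<theta> * \<bar>s - t\<bar>" "L\<theta> \<ge> 0"
    and t0: "0 < t0" "t0 < T" and \<sigma>: "\<sigma> > 0" and \<epsilon>: "\<epsilon> > 0" "16 * \<epsilon> \<le> \<tau>" "16 * \<epsilon> \<le> \<sigma>"
    and mn: "\<And>t x. 0 \<le> t \<Longrightarrow> t \<le> T \<Longrightarrow>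
       v (t0, x0) - u (t0, x0) + \<theta> t0 \<le> v (t, x) - u (t, x) + \<theta> t + \<epsilon> * (\<bar>t - t0\<bar> + d x0 x)"
  shows False
proof -
  obtain c where c: "c \<in> charts_at A x0" by (rule charts_at_nonempty)
  have cA: "c \<in> A" "x0 \<in> fst c" using c by (auto simp: charts_at_def)
  define y0 where "y0 = snd c x0"
  define z0 where "z0 = (t0, y0)"
  let ?N = "cnorm c x0"
  obtain k K where k: "k > 0" "K > 0" "\<And>w. k * norm w \<le> ?N w" "\<And>w. ?N w \<le> K * norm w"
    using cnorm_equiv[OF c] by metis
  have N0: "0 \<le> ?N w" for w by (rule cnorm_nonneg[OF c])
  obtain NL L where NL: "open NL" "(t0, x0) \<in> NL" and L: "L \<ge> 0" and
    LL: "(\<forall>t s x y. t \<ge> 0 \<longrightarrow> s \<ge> 0 \<longrightarrow> (t, x) \<in> NL \<longrightarrow> (s, y) \<in> NL \<longrightarrow> \<bar>u (t, x) - u (s, y)\<bar> \<le> L * (\<bar>t - s\<bar> + d x y)) \<or>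
     (\<forall>t s x y. t \<ge> 0 \<longrightarrow> s \<ge> 0 \<longrightarrow> (t, x) \<in> NL \<longrightarrow> (s, y) \<in> NL \<longrightarrow> \<bar>v (t, x) - v (s, y)\<bar> \<le> L * (\<bar>t - s\<bar> + d x y))"
  proof -
    have *: "\<exists>NL L. open NL \<and> (t0, x0) \<in> NL \<and> L \<ge> 0 \<and> (\<forall>t s x y. t \<ge> 0 \<longrightarrow> s \<ge> 0 \<longrightarrow> (t, x) \<in> NL \<longrightarrow> (s, y) \<in> NL \<longrightarrow>
        \<bar>w (t, x) - w (s, y)\<bar> \<le> L * (\<bar>t - s\<bar> + d x y))" if "Lipschitz_near A F w (t0, x0)" for w
    proof -
      from that obtain NL L where NL: "open NL" "(t0, x0) \<in> NL" and
        L: "\<And>t s x y. t \<ge> 0 \<Longrightarrow> s \<ge> 0 \<Longrightarrow> (t, x) \<in> NL \<Longrightarrow> (s, y) \<in> NL \<Longrightarrow> \<bar>w (t, x) - w (s, y)\<bar> \<le> L * (\<bar>t - s\<bar> + d x y)"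
        unfolding Lipschitz_near_def by blast
      have "L * (\<bar>t - s\<bar> + d x y) \<le> max L 0 * (\<bar>t - s\<bar> + d x y)" for t s x y
        using d_nonneg[of x y] by (intro mult_right_mono) auto
      then have "\<bar>w (t, x) - w (s, y)\<bar> \<le> max L 0 * (\<bar>t - s\<bar> + d x y)"
        if "t \<ge> 0" "s \<ge> 0" "(t, x) \<in> NL" "(s, y) \<in> NL" for t s x y
        using L[OF that] order_trans by blast
      then show ?thesis using NL by (intro exI[of _ NL] exI[of _ "max L 0"]) simp
    qed
    from Lip show ?thesis
    proof
      assume "Lipschitz_near A F u (t0, x0)"
      from *[OF this] obtain NL L where "open NL" "(t0, x0) \<in> NL" "L \<ge> 0" "\<forall>t s x y. t \<ge> 0 \<longrightarrow> s \<ge> 0 \<longrightarrow> (t, x) \<in> NL \<longrightarrow> (s, y) \<in> NL \<longrightarrow>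
        \<bar>u (t, x) - u (s, y)\<bar> \<le> L * (\<bar>t - s\<bar> + d x y)" by blast
      then show ?thesis by (intro that disjI1)
    next
      assume "Lipschitz_near A F v (t0, x0)"
      from *[OF this] obtain NL L where "open NL" "(t0, x0) \<in> NL" "L \<ge> 0" "\<forall>t s x y. t \<ge> 0 \<longrightarrow> s \<ge> 0 \<longrightarrow> (t, x) \<in> NL \<longrightarrow> (s, y) \<in> NL \<longrightarrow>
        \<bar>v (t, x) - v (s, y)\<bar> \<le> L * (\<bar>t - s\<bar> + d x y)" by blast
      then show ?thesis by (intro that disjI2)
    qed
  qed
  \<comment> \<open>Bounds both covectors: \<open>2 * L\<close> comes from the Lipschitz function,
    as \<open>d\<close> is at most twice the norm at \<open>x0\<close>, and
    \<open>4 * \<epsilon>\<close> from the discrepancy between the two.\<close>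
  define P where "P = 2 * L + 4 * \<epsilon>"
  have P: "P \<ge> 0" using L \<epsilon> by (simp add: P_def)
  \<comment> \<open>P2 is used with this \<open>e\<close>, so that comparing dual norms at two
    points costs at most \<open>6 * e * P \<le> \<tau> / 2\<close>.\<close>
  define e where "e = min 1 (\<tau> / (12 * (P + 1)))"
  have e: "0 < e" "e \<le> 1" using \<tau> P by (auto simp: e_def)
  have eP: "6 * e * P \<le> \<tau> / 2"
  proof -
    have "e * (12 * (P + 1)) \<le> \<tau> / (12 * (P + 1)) * (12 * (P + 1))"
      using P by (intro mult_right_mono) (simp_all add: e_def)
    also have "\<dots> = \<tau>" using P by simp
    finally show ?thesis using e(1) by (simp add: algebra_simps)
  qed
  obtain \<rho> where nb: "norm_ball c x0 e \<rho>" by (rule norm_ball_exists_simple[OF e(1) c])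
  have \<rho>: "\<rho> > 0" and \<rho>c: "ball y0 \<rho> \<subseteq> snd c ` fst c" using nb by (auto simp: norm_ball_def y0_def)
  have nbN: "?N w \<le> (1 + e) * cnorm c (chart_inv c y) w" "cnorm c (chart_inv c y) w \<le> (1 + e) * ?N w"
    if "y \<in> ball y0 \<rho>" for y w
    using nb that unfolding norm_ball_def y0_def by blast+
  have dN: "d (chart_inv c y) (chart_inv c y') \<le> 2 * ?N (y' - y)" if "y \<in> ball y0 \<rho>" "y' \<in> ball y0 \<rho>" for y y'
  proof -
    have "d (chart_inv c y) (chart_inv c y') \<le> (1 + e) * ?N (y' - y)"
      by (rule norm_ball_d[OF c nb]) (use that in \<open>simp_all add: y0_def\<close>)
    also have "\<dots> \<le> 2 * ?N (y' - y)" using e N0 by (intro mult_right_mono) auto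
    finally show ?thesis .
  qed
  define \<Psi> where "\<Psi> z = (fst z, chart_inv c (snd z))" for z :: "real \<times> 'b"
  have \<Psi>c: "continuous_on (UNIV \<times> ball y0 \<rho>) \<Psi>"
    unfolding \<Psi>_def
    by (intro continuous_on_Pair continuous_on_fst continuous_on_id
        continuous_on_compose2[OF continuous_on_subset[OF continuous_on_chart_inv[OF cA(1)] \<rho>c] continuous_on_snd])
       auto
  obtain R where R: "R > 0" and RZ: "\<And>z. z \<in> cball z0 R \<Longrightarrow> 0 < fst z \<and> fst z < T \<and> snd z \<in> ball y0 \<rho> \<and> \<Psi> z \<in> NL"
  proof -
    let ?Z = "({0<..<T} \<times> ball y0 \<rho>) \<inter> ((UNIV \<times> ball y0 \<rho>) \<inter> \<Psi> -` NL)"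
    have "open ((UNIV \<times> ball y0 \<rho>) \<inter> \<Psi> -` NL)"
      by (rule continuous_open_preimage[OF \<Psi>c _ NL(1)]) (simp add: open_Times)
    then have "open ?Z" by (rule open_Int[OF open_Times[OF open_greaterThanLessThan open_ball]])
    moreover have "z0 \<in> ?Z"
      using t0 \<rho> NL(2) cA by (simp add: z0_def \<Psi>_def y0_def chart_inv_left)
    ultimately obtain R where "R > 0" "cball z0 R \<subseteq> ?Z" by (meson open_contains_cball)
    then show ?thesis by (intro that) auto
  qed
  let ?S = "cball z0 R"
  define V where "V z = v (\<Psi> z)" for z
  define U where "U z = - u (\<Psi> z)" for z
  \<comment> \<open>In the chart the error term of \<open>mn\<close> is at most
    \<open>\<epsilon>\<close> times the time distance plus \<open>2 * \<epsilon>\<close> times the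
    distance in \<open>?N\<close>; the additional \<open>\<epsilon>\<close> in each slope makes the
    minimum strict, as the sum rule demands.\<close>
  define \<phi> where "\<phi> z = 2 * \<epsilon> * \<bar>fst z - t0\<bar> + 3 * \<epsilon> * ?N (snd z - y0)" for z :: "real \<times> 'b"
  define f3 where "f3 z = \<phi> z + \<theta> (fst z)" for z
  \<comment> \<open>\<open>SL\<close> and \<open>S3\<close> measure slopes in the norm of the
    tangent space at \<open>x0\<close>, because the covector estimates must not involve
    \<open>k\<close> and \<open>K\<close>, on which \<open>\<epsilon>\<close> cannot depend. The
    constants \<open>K1\<close> and \<open>K3\<close> below enter only through the sum rule.\<close>
  define SL where "SL w = L * (\<bar>fst w\<bar> + 2 * ?N (snd w))" for w :: "real \<times> 'b"
  define S3 where "S3 w = 2 * \<epsilon> * \<bar>fst w\<bar> + 3 * \<epsilon> * ?N (snd w)" for w :: "real \<times> 'b"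
  have nf: "\<bar>fst w\<bar> \<le> norm w" and ns: "norm (snd w) \<le> norm w" for w :: "real \<times> 'b"
    using norm_fst_le[of "fst w" "snd w"] norm_snd_le[of "snd w" "fst w"] by simp_all
  have nN: "?N (snd w) \<le> K * norm w" for w :: "real \<times> 'b"
    using k(4)[of "snd w"] mult_left_mono[OF ns[of w], of K] k(2) by linarith
  have Nminus: "?N (- w) = ?N w" for w by (rule cnorm_minus[OF c])
  have Nscale: "?N (a *\<^sub>R w) = \<bar>a\<bar> * ?N w" for a w by (rule cnorm_scale[OF c])
  have z0S: "z0 \<in> ?S" using R by simp
  have N00: "?N 0 = 0" using Nscale[of 0 0] by simp
  have \<Psi>0: "\<Psi> z0 = (t0, x0)" using cA by (simp add: z0_def \<Psi>_def y0_def chart_inv_left)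
  have \<Psi>S: "\<Psi> z \<in> {0..} \<times> UNIV" if "z \<in> ?S" for z using RZ[OF that] by (simp add: \<Psi>_def)
  have \<Psi>cS: "continuous_on ?S \<Psi>" by (rule continuous_on_subset[OF \<Psi>c]) (use RZ in \<open>auto simp: mem_Times_iff\<close>)
  have lscV: "seq_lsc ?S V" unfolding V_def by (rule seq_lsc_compose[OF lsc(1) \<Psi>cS]) (use \<Psi>S in blast)
  have lscU: "seq_lsc ?S U" unfolding U_def by (rule seq_lsc_compose[OF lsc(2) \<Psi>cS]) (use \<Psi>S in blast)
  have bdV: "- M \<le> V z" and bdU: "- M \<le> U z" if "z \<in> ?S" for z
    using bd[of "fst z" "chart_inv c (snd z)"] RZ[OF that] by (auto simp: V_def U_def \<Psi>_def)
  have Ndiff: "?N (a - c0) \<le> ?N (a - b) + ?N (b - c0)" for a b c0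
    using cnorm_triangle[OF c, of "a - b" "b - c0"] by simp
  have \<phi>_lip: "\<phi> z - \<phi> z' \<le> S3 (z - z')" for z z'
  proof -
    have "2 * \<epsilon> * \<bar>fst z - t0\<bar> \<le> 2 * \<epsilon> * (\<bar>fst z - fst z'\<bar> + \<bar>fst z' - t0\<bar>)"
      using \<epsilon> by (intro mult_left_mono) auto
    moreover have "3 * \<epsilon> * ?N (snd z - y0) \<le> 3 * \<epsilon> * (?N (snd z - snd z') + ?N (snd z' - y0))"
      using \<epsilon> Ndiff by (intro mult_left_mono) auto
    ultimately show ?thesis by (simp add: \<phi>_def S3_def distrib_left)
  qed
  have S3K: "S3 w \<le> (2 * \<epsilon> + 3 * \<epsilon> * K) * norm w" for w
  proof -
    have "2 * \<epsilon> * \<bar>fst w\<bar> \<le> 2 * \<epsilon> * norm w" using nf[of w] \<epsilon> by (intro mult_left_mono) auto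
    moreover have "3 * \<epsilon> * ?N (snd w) \<le> 3 * \<epsilon> * (K * norm w)" using nN[of w] \<epsilon> by (intro mult_left_mono) auto
    ultimately show ?thesis by (simp add: S3_def algebra_simps)
  qed
  define K3 where "K3 = 2 * \<epsilon> + 3 * \<epsilon> * K + L\<theta>"
  have K3: "K3 \<ge> 0" using \<epsilon> k L\<theta> by (simp add: K3_def)
  have lip3: "\<bar>f3 z - f3 z'\<bar> \<le> K3 * norm (z - z')" if "z \<in> ?S" "z' \<in> ?S" for z z'
  proof -
    have "\<bar>\<phi> z - \<phi> z'\<bar> \<le> (2 * \<epsilon> + 3 * \<epsilon> * K) * norm (z - z')"
      using \<phi>_lip[of z z'] \<phi>_lip[of z' z] S3K[of "z - z'"] S3K[of "z' - z"] by (auto simp: norm_minus_commute)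
    moreover have "\<bar>\<theta> (fst z) - \<theta> (fst z')\<bar> \<le> L\<theta> * norm (z - z')"
      using L\<theta>(1)[of "fst z" "fst z'"] RZ[OF that(1)] RZ[OF that(2)]
        mult_left_mono[OF nf[of "z - z'"] L\<theta>(2)] by simp
    moreover have "f3 z - f3 z' = (\<phi> z - \<phi> z') + (\<theta> (fst z) - \<theta> (fst z'))" by (simp add: f3_def)
    ultimately show ?thesis unfolding K3_def by (simp add: distrib_right abs_le_iff)
  qed
  define K1 where "K1 = L * (1 + 2 * K)"
  have K1: "K1 \<ge> 0" using L k by (simp add: K1_def)
  have SLK: "SL w \<le> K1 * norm w" for w
  proof -
    have "SL w \<le> L * (norm w + 2 * (K * norm w))"
      unfolding SL_def using nf[of w] nN[of w] L by (intro mult_left_mono add_mono) auto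
    then show ?thesis by (simp add: K1_def algebra_simps)
  qed
  have Lip': "(\<forall>z\<in>?S. \<forall>z'\<in>?S. \<bar>V z - V z'\<bar> \<le> SL (z - z')) \<or> (\<forall>z\<in>?S. \<forall>z'\<in>?S. \<bar>U z - U z'\<bar> \<le> SL (z - z'))"
  proof -
    have dd: "L * (\<bar>fst z - fst z'\<bar> + d (chart_inv c (snd z)) (chart_inv c (snd z'))) \<le> SL (z - z')"
      if "z \<in> ?S" "z' \<in> ?S" for z z'
    proof -
      have "d (chart_inv c (snd z)) (chart_inv c (snd z')) \<le> 2 * ?N (snd z' - snd z)"
        by (rule dN) (use RZ[OF that(1)] RZ[OF that(2)] in auto)
      also have "?N (snd z' - snd z) = ?N (snd z - snd z')" using Nminus[of "snd z - snd z'"] by simp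
      finally show ?thesis unfolding SL_def using L by (intro mult_left_mono) auto
    qed
    have ps: "0 \<le> fst z" "(fst z, chart_inv c (snd z)) \<in> NL" if "z \<in> ?S" for z
      using RZ[OF that] by (auto simp: \<Psi>_def)
    from LL show ?thesis
    proof
      assume a: "\<forall>t s x y. t \<ge> 0 \<longrightarrow> s \<ge> 0 \<longrightarrow> (t, x) \<in> NL \<longrightarrow> (s, y) \<in> NL \<longrightarrow> \<bar>u (t, x) - u (s, y)\<bar> \<le> L * (\<bar>t - s\<bar> + d x y)"
      have "\<bar>U z - U z'\<bar> \<le> SL (z - z')" if z: "z \<in> ?S" "z' \<in> ?S" for z z'
      proof -
        have "\<bar>u (fst z, chart_inv c (snd z)) - u (fst z', chart_inv c (snd z'))\<bar> \<le>
            L * (\<bar>fst z - fst z'\<bar> + d (chart_inv c (snd z)) (chart_inv c (snd z')))"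
          using a ps[OF z(1)] ps[OF z(2)] by blast
        with dd[OF z] show ?thesis by (simp add: U_def \<Psi>_def abs_minus_commute)
      qed
      then show ?thesis by blast
    next
      assume a: "\<forall>t s x y. t \<ge> 0 \<longrightarrow> s \<ge> 0 \<longrightarrow> (t, x) \<in> NL \<longrightarrow> (s, y) \<in> NL \<longrightarrow> \<bar>v (t, x) - v (s, y)\<bar> \<le> L * (\<bar>t - s\<bar> + d x y)"
      have "\<bar>V z - V z'\<bar> \<le> SL (z - z')" if z: "z \<in> ?S" "z' \<in> ?S" for z z'
      proof -
        have "\<bar>v (fst z, chart_inv c (snd z)) - v (fst z', chart_inv c (snd z'))\<bar> \<le>
            L * (\<bar>fst z - fst z'\<bar> + d (chart_inv c (snd z)) (chart_inv c (snd z')))"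
          using a ps[OF z(1)] ps[OF z(2)] by blast
        with dd[OF z] show ?thesis by (simp add: V_def \<Psi>_def)
      qed
      then show ?thesis by blast
    qed
  qed
  \<comment> \<open>The spare slope \<open>\<epsilon>\<close> in time and in \<open>?N\<close>,
    expressed in the norm of the product space.\<close>
  define c0 where "c0 = \<epsilon> * min 1 k"
  have c0: "c0 > 0" using \<epsilon> k by (simp add: c0_def)
  have mnS: "V z0 + U z0 + f3 z0 + c0 * norm (z - z0) \<le> V z + U z + f3 z" if z: "z \<in> ?S" for z
  proof -
    have "v (t0, x0) - u (t0, x0) + \<theta> t0 \<le> v (\<Psi> z) - u (\<Psi> z) + \<theta> (fst z) + \<epsilon> * (\<bar>fst z - t0\<bar> + d x0 (chart_inv c (snd z)))"
      using mn[of "fst z" "chart_inv c (snd z)"] RZ[OF z] by (simp add: \<Psi>_def)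
    moreover have "d x0 (chart_inv c (snd z)) \<le> 2 * ?N (snd z - y0)"
      using dN[of y0 "snd z"] RZ[OF z] \<rho> cA by (simp add: y0_def chart_inv_left)
    then have "\<epsilon> * (\<bar>fst z - t0\<bar> + d x0 (chart_inv c (snd z))) \<le> \<epsilon> * (\<bar>fst z - t0\<bar> + 2 * ?N (snd z - y0))"
      using \<epsilon> by (intro mult_left_mono) auto
    moreover have "c0 * norm (z - z0) \<le> \<epsilon> * \<bar>fst z - t0\<bar> + \<epsilon> * ?N (snd z - y0)"
    proof -
      have "norm (z - z0) \<le> \<bar>fst z - t0\<bar> + norm (snd z - y0)"
        using norm_Pair_le[of "fst z - t0" "snd z - y0"] by (simp add: z0_def minus_prod_def)
      then have "c0 * norm (z - z0) \<le> c0 * (\<bar>fst z - t0\<bar> + norm (snd z - y0))"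
        using c0 by (intro mult_left_mono) auto
      also have "\<dots> = \<epsilon> * (min 1 k * \<bar>fst z - t0\<bar> + min 1 k * norm (snd z - y0))"
        by (simp add: c0_def algebra_simps)
      also have "\<dots> \<le> \<epsilon> * (1 * \<bar>fst z - t0\<bar> + k * norm (snd z - y0))"
        using \<epsilon> by (intro mult_left_mono add_mono mult_right_mono) auto
      also have "\<dots> \<le> \<epsilon> * (1 * \<bar>fst z - t0\<bar> + ?N (snd z - y0))"
        using \<epsilon> k(3)[of "snd z - y0"] by (intro mult_left_mono add_mono) auto
      finally show ?thesis by (simp add: distrib_left)
    qed
    moreover have "f3 z0 = \<theta> t0" by (simp add: f3_def \<phi>_def z0_def N00)
    ultimately show ?thesis
      unfolding V_def U_def \<Psi>0 f3_def \<phi>_def by (simp add: algebra_simps)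
  qed
  \<comment> \<open>The four bounds control, in this order, the error in the time derivative, the
    error in the covectors relative to \<open>?N\<close>, the distance of the two points against
    \<open>\<tau>\<close>, and the product term of condition (A). The factor
    \<open>2 + 4 * K\<close> turns \<open>\<eta>\<close> into a bound for that distance.\<close>
  define \<eta> where "\<eta> = min (min (\<sigma> / 8) (k * \<epsilon>)) (min (\<tau> / (2 + 4 * K)) (\<sigma> / (16 * (C + 1) * (P + 1) * (2 + 4 * K))))"
  have \<eta>: "\<eta> > 0" using \<sigma> k \<epsilon> \<tau> C P by (simp add: \<eta>_def)
  have \<eta>1: "\<eta> \<le> \<sigma> / 8" "\<eta> \<le> k * \<epsilon>"
    unfolding \<eta>_def by (rule order_trans[OF min.cobounded1 min.cobounded1] order_trans[OF min.cobounded1 min.cobounded2])+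
  have \<eta>2: "(2 + 4 * K) * \<eta> \<le> \<tau>"
  proof -
    have "\<eta> \<le> \<tau> / (2 + 4 * K)" unfolding \<eta>_def by (rule order_trans[OF min.cobounded2 min.cobounded1])
    then show ?thesis using k by (simp add: pos_le_divide_eq mult.commute)
  qed
  have \<eta>3: "C * (2 * P) * ((2 + 4 * K) * \<eta>) \<le> \<sigma> / 8"
  proof -
    have "\<eta> \<le> \<sigma> / (16 * (C + 1) * (P + 1) * (2 + 4 * K))" unfolding \<eta>_def by (rule order_trans[OF min.cobounded2 min.cobounded2])
    then have "\<eta> * (16 * (C + 1) * (P + 1) * (2 + 4 * K)) \<le> \<sigma>" using k C P by (simp add: pos_le_divide_eq)
    moreover have "C * P * ((2 + 4 * K) * \<eta>) \<le> (C + 1) * (P + 1) * ((2 + 4 * K) * \<eta>)"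
      using C P k \<eta> by (intro mult_right_mono mult_mono) auto
    ultimately show ?thesis by (simp add: algebra_simps)
  qed
  have hE: "normalized_bump (\<lambda>(s, y). hR (2 *\<^sub>R s) * h (2 *\<^sub>R y))" if "normalized_bump hR" for hR :: "real \<Rightarrow> real"
    using normalized_bump_prod[OF that h] .
  obtain hR :: "real \<Rightarrow> real" where "normalized_bump hR" by (rule normalized_bump_real)
  note hE = hE[OF this]
  \<comment> \<open>Formulated with the roles of \<open>V\<close> and \<open>U\<close> fixed, so
    that it applies whichever of them is the Lipschitz one.\<close>
  have fin: False
    if near: "norm (zV - z0) < \<eta>" "norm (zU - z0) < \<eta>"
      and inS: "norm (zV - z0) < R" "norm (zU - z0) < R" "norm (z3 - z0) < R"
      and C1: "C1_on gV UNIV" "C1_on gU UNIV"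
      and q: "(gV has_derivative qV) (at zV)" "(gU has_derivative qU) (at zU)" "(g3 has_derivative q3) (at z3)"
      and mV: "\<And>z. z \<in> ?S \<Longrightarrow> V zV + gV zV \<le> V z + gV z"
      and mU: "\<And>z. z \<in> ?S \<Longrightarrow> U zU + gU zU \<le> U z + gU z"
      and m3: "\<And>z. z \<in> ?S \<Longrightarrow> f3 z3 + g3 z3 \<le> f3 z + g3 z"
      and sum: "\<And>w. \<bar>qV w + qU w + q3 w\<bar> \<le> \<eta> * norm w"
    for zV zU z3 gV gU g3 qV qU q3
  proof -
    interpret qV: bounded_linear qV using q(1) by (rule has_derivative_bounded_linear)
    interpret qU: bounded_linear qU using q(2) by (rule has_derivative_bounded_linear)
    interpret q3: bounded_linear q3 using q(3) by (rule has_derivative_bounded_linear)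
    have ev: "\<forall>\<^sub>F z in nhds w. z \<in> ?S" if "norm (w - z0) < R" for w
    proof -
      have "w \<in> ball z0 R" using that by (simp add: dist_norm norm_minus_commute)
      then have "\<forall>\<^sub>F z in nhds w. z \<in> ball z0 R" by (intro eventually_nhds_in_open) auto
      then show ?thesis by (rule eventually_mono) simp
    qed
    have inS': "zV \<in> ?S" "zU \<in> ?S" "z3 \<in> ?S" using inS by (simp_all add: dist_norm norm_minus_commute)
    define xV where "xV = chart_inv c (snd zV)"
    define xU where "xU = chart_inv c (snd zU)"
    note RV = RZ[OF inS'(1)] and RU = RZ[OF inS'(2)]
    have sV: "snd zV \<in> snd c ` fst c" "snd zU \<in> snd c ` fst c" using RV RU \<rho>c by blast+
    have cx: "c \<in> charts_at A xV" "c \<in> charts_at A xU"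
      using chart_inv_in[OF cA(1)] sV cA(1) by (auto simp: charts_at_def xV_def xU_def)
    have sx: "snd c xV = snd zV" "snd c xU = snd zU" unfolding xV_def xU_def by (rule chart_inv_right[OF cA(1)], rule sV)+
    have zz: "(fst zV, snd c xV) = zV" "(fst zU, snd c xU) = zU" by (simp_all add: sx)
    let ?pV = "\<lambda>w. - qV (0, w)" and ?pU = "\<lambda>w. qU (0, w)"
    have HV: "0 \<le> - qV (1, 0) + H (fst zV, xV, cdual c xV ?pV)"
    proof (rule supersolution_in_chart[where v=v and H=H and t="fst zV" and g=gV and q=qV, OF h cx(1) _ super C1(1)])
      show "\<forall>\<^sub>F z in nhds (fst zV, snd c xV). v (fst zV, xV) + gV (fst zV, snd c xV) \<le> v (fst z, chart_inv c (snd z)) + gV z"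
        unfolding zz using ev[OF inS(1)]
        by eventually_elim (use mV in \<open>simp add: V_def \<Psi>_def xV_def\<close>)
    qed (use RV q(1) zz in simp_all)
    have HU: "qU (1, 0) + H (fst zU, xU, cdual c xU ?pU) \<le> 0"
    proof (rule subsolution_in_chart[where u=u and H=H and t="fst zU" and g=gU and q=qU, OF h cx(2) _ sub C1(2)])
      show "\<forall>\<^sub>F z in nhds (fst zU, snd c xU). - u (fst zU, xU) + gU (fst zU, snd c xU) \<le> - u (fst z, chart_inv c (snd z)) + gU z"
        unfolding zz using ev[OF inS(2)]
        by eventually_elim (use mU in \<open>simp add: U_def \<Psi>_def xU_def\<close>)
    qed (use RU q(2) zz in simp_all)
    \<comment> \<open>At \<open>z3\<close> the sum of \<open>\<phi>\<close> and the differentiable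
      \<open>\<theta> + g3\<close> is minimal, so the derivative of the latter is bounded by the
      slope \<open>S3\<close> of \<open>\<phi>\<close>: in time \<open>q3\<close> is
      \<open>- \<theta>'\<close> up to \<open>2 * \<epsilon>\<close>, in space it is at most
      \<open>3 * \<epsilon>\<close>.\<close>
    have b3: "\<bar>\<theta>' (fst z3) * fst w + q3 w\<bar> \<le> S3 w" for w
    proof -
      note R3 = RZ[OF inS'(3)]
      have "(\<theta> has_real_derivative \<theta>' (fst z3)) (at (fst z3))" using \<theta>(1) R3 by blast
      then have "(\<theta> has_derivative (\<lambda>h. \<theta>' (fst z3) * h)) (at (fst z3))" by (simp add: has_field_derivative_def)
      from has_derivative_compose[OF has_derivative_fst[OF has_derivative_ident] this]
      have d: "((\<lambda>z. \<theta> (fst z)) has_derivative (\<lambda>w. \<theta>' (fst z3) * fst w)) (at z3)" .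
      have "- S3 w \<le> \<theta>' (fst z3) * fst w + q3 w" for w
      proof (rule derivative_ge_at_min[OF has_derivative_add[OF d q(3)]])
        show "\<forall>\<^sub>F z in nhds z3. \<phi> z3 + (\<theta> (fst z3) + g3 z3) \<le> \<phi> z + (\<theta> (fst z) + g3 z)"
          using ev[OF inS(3)] by eventually_elim (use m3 in \<open>simp add: f3_def add.assoc\<close>)
        show "\<forall>\<^sub>F z in nhds z3. \<phi> z - \<phi> z3 \<le> S3 (z - z3)" using \<phi>_lip by (intro always_eventually allI)
        show "S3 (a *\<^sub>R w) = a * S3 w" if "a \<ge> 0" for a w
          using that by (simp add: S3_def Nscale abs_mult algebra_simps)
      qed
      from this[of w] this[of "- w"] show ?thesis by (simp add: q3.neg S3_def Nminus)
    qed
    have pdiff: "\<bar>?pV w - ?pU w\<bar> \<le> (4 * \<epsilon>) * ?N w" for w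
    proof -
      have "\<bar>qV (0, w) + qU (0, w) + q3 (0, w)\<bar> \<le> \<eta> * norm w" using sum[of "(0, w)"] by simp
      moreover have "\<bar>q3 (0, w)\<bar> \<le> 3 * \<epsilon> * ?N w" using b3[of "(0, w)"] by (simp add: S3_def)
      moreover have "\<eta> * norm w \<le> \<epsilon> * ?N w"
      proof -
        have "\<eta> * norm w \<le> (k * \<epsilon>) * norm w" by (intro mult_right_mono \<eta>1) simp
        also have "\<dots> = \<epsilon> * (k * norm w)" by simp
        also have "\<dots> \<le> \<epsilon> * ?N w" using k(3) \<epsilon> by (intro mult_left_mono) auto
        finally show ?thesis .
      qed
      ultimately show ?thesis by linarith
    qed
    have \<alpha>: "- qV (1, 0) - qU (1, 0) \<le> - \<theta>' (fst z3) + 2 * \<epsilon> + \<eta>"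
    proof -
      have "\<bar>qV (1, 0) + qU (1, 0) + q3 (1, 0)\<bar> \<le> \<eta>" using sum[of "(1, 0)"] by simp
      moreover have "\<bar>\<theta>' (fst z3) + q3 (1, 0)\<bar> \<le> 2 * \<epsilon>" using b3[of "(1, 0)"] by (simp add: S3_def N00)
      ultimately show ?thesis by linarith
    qed
    have SLhom: "SL (a *\<^sub>R w) = a * SL w" if "a \<ge> 0" for a w
      using that by (simp add: SL_def Nscale abs_mult algebra_simps)
    have SLm: "SL (- w) = SL w" for w by (simp add: SL_def Nminus)
    \<comment> \<open>The Lipschitz function bounds its own covector; the bound for the other one is
      inherited through \<open>pdiff\<close>.\<close>
    have bP: "(\<forall>w. \<bar>qV (0, w)\<bar> \<le> P * ?N w) \<and> (\<forall>w. \<bar>qU (0, w)\<bar> \<le> P * ?N w)"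
    proof -
      have LP: "2 * L * ?N w + (4 * \<epsilon>) * ?N w = P * ?N w" for w by (simp add: P_def distrib_right)
      have e0: "0 \<le> (4 * \<epsilon>) * ?N w" for w using \<epsilon> N0[of w] by simp
      from Lip' show ?thesis
      proof
        assume lip: "\<forall>z\<in>?S. \<forall>z'\<in>?S. \<bar>V z - V z'\<bar> \<le> SL (z - z')"
        have "- SL w \<le> qV w" for w
        proof (rule derivative_ge_at_min[OF q(1), of V SL])
          show "\<forall>\<^sub>F z in nhds zV. V zV + gV zV \<le> V z + gV z" using ev[OF inS(1)] by eventually_elim (rule mV)
          show "\<forall>\<^sub>F z in nhds zV. V z - V zV \<le> SL (z - zV)"
            using ev[OF inS(1)] by eventually_elim (use lip inS'(1) in fastforce)
        qed (rule SLhom)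
        then have "- SL (0, w) \<le> qV (0, w)" "- SL (- (0, w)) \<le> qV (- (0, w))" for w by blast+
        then have "\<bar>qV (0, w)\<bar> \<le> SL (0, w)" for w
          unfolding SLm qV.neg abs_le_iff by (simp add: minus_le_iff)
        then have "\<bar>qV (0, w)\<bar> \<le> 2 * L * ?N w" for w by (simp add: SL_def mult.left_commute mult.assoc)
        then show ?thesis using LP e0 pdiff by (smt (verit))
      next
        assume lip: "\<forall>z\<in>?S. \<forall>z'\<in>?S. \<bar>U z - U z'\<bar> \<le> SL (z - z')"
        have "- SL w \<le> qU w" for w
        proof (rule derivative_ge_at_min[OF q(2), of U SL])
          show "\<forall>\<^sub>F z in nhds zU. U zU + gU zU \<le> U z + gU z" using ev[OF inS(2)] by eventually_elim (rule mU)
          show "\<forall>\<^sub>F z in nhds zU. U z - U zU \<le> SL (z - zU)"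
            using ev[OF inS(2)] by eventually_elim (use lip inS'(2) in fastforce)
        qed (rule SLhom)
        then have "- SL (0, w) \<le> qU (0, w)" "- SL (- (0, w)) \<le> qU (- (0, w))" for w by blast+
        then have "\<bar>qU (0, w)\<bar> \<le> SL (0, w)" for w
          unfolding SLm qU.neg abs_le_iff by (simp add: minus_le_iff)
        then have "\<bar>qU (0, w)\<bar> \<le> 2 * L * ?N w" for w by (simp add: SL_def mult.left_commute mult.assoc)
        then show ?thesis using LP e0 pdiff by (smt (verit))
      qed
    qed
    have emb: "bounded_linear (\<lambda>w. (0::real, w::'b))"
      by (intro bounded_linear_Pair bounded_linear_zero bounded_linear_ident)
    have blV: "bounded_linear ?pV"
      by (rule bounded_linear_minus[OF bounded_linear_compose[OF qV.bounded_linear_axioms emb]])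
    have blU: "bounded_linear ?pU" by (rule bounded_linear_compose[OF qU.bounded_linear_axioms emb])
    have PV: "\<bar>?pV w\<bar> \<le> P * ?N w" and PU: "\<bar>?pU w\<bar> \<le> P * ?N w" for w using bP by auto
    have pdiff': "\<bar>?pU w - ?pV w\<bar> \<le> (4 * \<epsilon>) * ?N w" for w using pdiff[of w] by linarith
    have nV: "?N w \<le> (1 + e) * cnorm c xV w" "cnorm c xV w \<le> (1 + e) * ?N w" for w
      unfolding xV_def using nbN RV by auto
    have nU: "?N w \<le> (1 + e) * cnorm c xU w" "cnorm c xU w \<le> (1 + e) * ?N w" for w
      unfolding xU_def using nbN RU by auto
    let ?rV = "cdual c xV ?pV" and ?rU = "cdual c xU ?pU"
    have e4: "4 * \<epsilon> \<ge> 0" using \<epsilon> by simp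
    note cmp1 = cdual_compare[OF c cx blV blU nV nU e P PV PU e4 pdiff]
    note cmp2 = cdual_compare[OF c cx(2,1) blU blV nU nV e P PU PV e4 pdiff']
    have r0: "0 \<le> ?rV" "0 \<le> ?rU"
    proof -
      have "\<bar>?pV w\<bar> \<le> (P * (1 + e)) * cnorm c xV w" for w
        using PV[of w] mult_left_mono[OF nV(1)[of w] P] by (simp add: mult.assoc)
      then show "0 \<le> ?rV" by (rule cdual_bound(1)[OF cx(1) blV])
      have "\<bar>?pU w\<bar> \<le> (P * (1 + e)) * cnorm c xU w" for w
        using PU[of w] mult_left_mono[OF nU(1)[of w] P] by (simp add: mult.assoc)
      then show "0 \<le> ?rU" by (rule cdual_bound(1)[OF cx(2) blU])
    qed
    \<comment> \<open>At most \<open>\<tau> / 2\<close> is spent on the change of base point, and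
      \<open>8 * \<epsilon> \<le> \<tau> / 2\<close> on the difference of the covectors.\<close>
    have r: "\<bar>?rV - ?rU\<bar> \<le> \<tau>" using cmp1(2) cmp2(2) eP \<epsilon> by linarith
    have zdist: "norm (zV - zU) \<le> 2 * \<eta>"
      using norm_triangle_ineq4[of "zV - z0" "zU - z0"] near by simp
    have tdist: "\<bar>fst zV - fst zU\<bar> \<le> 2 * \<eta>" using nf[of "zV - zU"] zdist by simp
    have xdist: "d xV xU \<le> 4 * K * \<eta>"
    proof -
      have "d xV xU \<le> 2 * ?N (snd zU - snd zV)" unfolding xV_def xU_def by (rule dN) (use RV RU in auto)
      also have "\<dots> \<le> 2 * (K * norm (zU - zV))" using nN[of "zU - zV"] by simp
      also have "\<dots> \<le> 2 * (K * (2 * \<eta>))" using zdist k(2) by (simp add: norm_minus_commute)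
      finally show ?thesis by simp
    qed
    have dsum: "\<bar>fst zV - fst zU\<bar> + d xV xU \<le> (2 + 4 * K) * \<eta>" using tdist xdist by (simp add: distrib_right)
    have "\<omega> (\<bar>fst zV - fst zU\<bar>, d xV xU, ?rV - ?rU) \<le> \<sigma> / 4"
      using dsum \<eta>2 r d_nonneg[of xV xU] by (intro \<omega>) auto
    moreover have "C * max \<bar>?rV\<bar> \<bar>?rU\<bar> * (\<bar>fst zV - fst zU\<bar> + d xV xU) \<le> C * (2 * P) * ((2 + 4 * K) * \<eta>)"
      using r0 cmp1(1) cmp2(1) dsum C P k \<eta> d_nonneg[of xV xU] by (intro mult_mono mult_left_mono) auto
    moreover have "\<bar>H (fst zV, xV, ?rV) - H (fst zU, xU, ?rU)\<bar> \<le>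
       \<omega> (\<bar>fst zV - fst zU\<bar>, d xV xU, ?rV - ?rU) + C * max \<bar>?rV\<bar> \<bar>?rU\<bar> * (\<bar>fst zV - fst zU\<bar> + d xV xU)"
      by (rule HA) (use RV RU in auto)
    moreover have "\<sigma> \<le> \<theta>' (fst z3)" using \<theta>(2) RZ[OF inS'(3)] by blast
    \<comment> \<open>Combining \<open>HV\<close> and \<open>HU\<close> leaves \<open>\<sigma> \<le>
      2 * \<epsilon> + \<eta> + \<sigma> / 4 + \<sigma> / 8\<close>, where
      \<open>2 * \<epsilon>\<close> and \<open>\<eta>\<close> are at most
      \<open>\<sigma> / 8\<close> each: the right side is at most five eighths of
      \<open>\<sigma>\<close>.\<close>
    ultimately show False using HV HU \<alpha> \<eta>1(1) \<eta>3 \<epsilon>(3) \<sigma> unfolding abs_le_iff by linarith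
  qed
  \<comment> \<open>The function not known to be Lipschitz is placed as the summand
    \<open>f2\<close> of the sum rule.\<close>
  from Lip' show False
  proof
    assume lip: "\<forall>z\<in>?S. \<forall>z'\<in>?S. \<bar>V z - V z'\<bar> \<le> SL (z - z')"
    have lip1: "\<bar>V z - V z'\<bar> \<le> K1 * norm (z - z')" if "z \<in> ?S" "z' \<in> ?S" for z z'
      using lip that SLK order_trans by blast
    show False
    proof (rule fuzzy_sum_rule[OF hE R lscU bdU lip1 lip3 K1 K3 mnS c0 \<eta>])
      fix z1 z2 z3 g1 g2 g3 q1 q2 q3
      assume a: "norm (z1 - z0) < \<eta>" "norm (z2 - z0) < \<eta>" "norm (z1 - z0) < R" "norm (z2 - z0) < R" "norm (z3 - z0) < R"
        "C1_on g1 UNIV" "C1_on g2 UNIV"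
        "(g1 has_derivative q1) (at z1)" "(g2 has_derivative q2) (at z2)" "(g3 has_derivative q3) (at z3)"
        "\<And>x. x \<in> ?S \<Longrightarrow> V z1 + g1 z1 \<le> V x + g1 x" "\<And>x. x \<in> ?S \<Longrightarrow> U z2 + g2 z2 \<le> U x + g2 x"
        "\<And>x. x \<in> ?S \<Longrightarrow> f3 z3 + g3 z3 \<le> f3 x + g3 x" "\<And>w. \<bar>q1 w + q2 w + q3 w\<bar> \<le> \<eta> * norm w"
      show False by (rule fin[OF a])
    qed
  next
    assume lip: "\<forall>z\<in>?S. \<forall>z'\<in>?S. \<bar>U z - U z'\<bar> \<le> SL (z - z')"
    have lip1: "\<bar>U z - U z'\<bar> \<le> K1 * norm (z - z')" if "z \<in> ?S" "z' \<in> ?S" for z z'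
      using lip that SLK order_trans by blast
    have mnS': "U z0 + V z0 + f3 z0 + c0 * norm (z - z0) \<le> U z + V z + f3 z" if "z \<in> ?S" for z
      using mnS[OF that] by simp
    show False
    proof (rule fuzzy_sum_rule[OF hE R lscV bdV lip1 lip3 K1 K3 mnS' c0 \<eta>])
      fix z1 z2 z3 g1 g2 g3 q1 q2 q3
      assume a: "norm (z1 - z0) < \<eta>" "norm (z2 - z0) < \<eta>" "norm (z1 - z0) < R" "norm (z2 - z0) < R" "norm (z3 - z0) < R"
        "C1_on g1 UNIV" "C1_on g2 UNIV"
        "(g1 has_derivative q1) (at z1)" "(g2 has_derivative q2) (at z2)" "(g3 has_derivative q3) (at z3)"
        "\<And>x. x \<in> ?S \<Longrightarrow> U z1 + g1 z1 \<le> U x + g1 x" "\<And>x. x \<in> ?S \<Longrightarrow> V z2 + g2 z2 \<le> V x + g2 x"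
        "\<And>x. x \<in> ?S \<Longrightarrow> f3 z3 + g3 z3 \<le> f3 x + g3 x" "\<And>w. \<bar>q1 w + q2 w + q3 w\<bar> \<le> \<eta> * norm w"
      have s: "\<bar>q2 w + q1 w + q3 w\<bar> \<le> \<eta> * norm w" for w using a(14)[of w] by (simp add: add.commute)
      show False by (rule fin[OF a(2,1,4,3,5,7,6,9,8,10,12,11,13) s])
    qed
  qed
qed

text \<open>The product of \<open>{0..T}\<close> and M is complete for the sum metric.
  Semicontinuity refers to the manifold topology and reaches metric limits because convergence in
  \<open>d\<close> implies topological convergence.\<close>

lemma ekeland_space_time:
  assumes compl: "complete_Finsler A F" and f: "seq_lsc ({0..T} \<times> UNIV) f"
    and bdd: "\<And>z. z \<in> {0..T} \<times> UNIV \<Longrightarrow> B \<le> f z"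
    and z1: "z1 \<in> {0..T} \<times> UNIV" and e: "e > 0"
  obtains t0 x0 where "0 \<le> t0" "t0 \<le> T" "f (t0, x0) \<le> f z1"
    "\<And>t x. 0 \<le> t \<Longrightarrow> t \<le> T \<Longrightarrow> f (t0, x0) \<le> f (t, x) + e * (\<bar>t - t0\<bar> + d x0 x)"
proof -
  define D where "D z w = \<bar>fst z - fst w\<bar> + d (snd z) (snd w)" for z w :: "real \<times> 'm"
  have D0: "0 \<le> D z w" "D z z = 0" for z w using d_nonneg[of "snd z" "snd w"] by (simp_all add: D_def d_refl)
  have Dtri: "D x z \<le> D x y + D y z" for x y z
    using d_triangle[of "snd x" "snd z" "snd y"] by (simp add: D_def)
  have complD: "\<exists>l\<in>{0..T} \<times> UNIV. ((\<lambda>n. D (s n) l) \<longlonglongrightarrow> 0) \<and> (\<forall>c. (\<forall>\<^sub>F n in sequentially. f (s n) \<le> c) \<longrightarrow> f l \<le> c)"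
    if s: "\<And>n. s n \<in> {0..T} \<times> UNIV" and cau: "\<And>e. e > 0 \<Longrightarrow> \<exists>N. \<forall>m\<ge>N. \<forall>n\<ge>m. D (s m) (s n) < e"
    for s :: "nat \<Rightarrow> real \<times> 'm"
  proof -
    have lt: "\<bar>fst (s m) - fst (s n)\<bar> < e" "d (snd (s m)) (snd (s n)) < e" if "D (s m) (s n) < e" for m n e
      using that d_nonneg[of "snd (s m)" "snd (s n)"] by (simp_all add: D_def)
    have "\<exists>N. \<forall>m\<ge>N. \<forall>n\<ge>m. d (snd (s m)) (snd (s n)) < e" if "e > 0" for e using cau[OF that] lt(2) by blast
    then obtain x where x: "(\<lambda>n. d (snd (s n)) x) \<longlonglongrightarrow> 0" by (rule complete_Cauchy[OF compl])
    have "Cauchy (\<lambda>n. fst (s n))"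
    proof (rule CauchyI)
      fix e :: real assume "e > 0"
      from cau[OF this] obtain N where N: "\<And>m n. m \<ge> N \<Longrightarrow> n \<ge> m \<Longrightarrow> D (s m) (s n) < e" by blast
      have "norm (fst (s m) - fst (s n)) < e" if "m \<ge> N" "n \<ge> N" for m n
        using lt(1)[OF N[of m n]] lt(1)[OF N[of n m]] that by (cases "m \<le> n") (auto simp: abs_minus_commute)
      then show "\<exists>M. \<forall>m\<ge>M. \<forall>n\<ge>M. norm (fst (s m) - fst (s n)) < e" by blast
    qed
    then obtain t where t: "(\<lambda>n. fst (s n)) \<longlonglongrightarrow> t" by (meson Cauchy_convergent_iff convergent_def)
    have tS: "t \<in> {0..T}"
      by (rule closed_sequentially[OF closed_atLeastAtMost _ t]) (use s in \<open>simp add: mem_Times_iff\<close>)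
    have lim: "s \<longlonglongrightarrow> (t, x)" using tendsto_Pair[OF t d_tendsto[OF x]] by simp
    show ?thesis
    proof (intro bexI[of _ "(t, x)"] conjI allI impI)
      have "(\<lambda>n. \<bar>fst (s n) - t\<bar> + d (snd (s n)) x) \<longlonglongrightarrow> \<bar>t - t\<bar> + 0" by (intro tendsto_intros t x)
      then show "(\<lambda>n. D (s n) (t, x)) \<longlonglongrightarrow> 0" by (simp add: D_def)
      show tx: "(t, x) \<in> {0..T} \<times> UNIV" using tS by simp
      fix c assume c: "\<forall>\<^sub>F n in sequentially. f (s n) \<le> c"
      show "f (t, x) \<le> c"
      proof (rule ccontr)
        assume "\<not> f (t, x) \<le> c"
        then have "\<forall>\<^sub>F n in sequentially. c < f (s n)" by (intro seq_lscD[OF f s tx lim]) simp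
        with c have "\<forall>\<^sub>F n in sequentially. False" by eventually_elim simp
        then show False by simp
      qed
    qed
  qed
  obtain z0 where z0: "z0 \<in> {0..T} \<times> UNIV" "f z0 \<le> f z1" "\<And>z. z \<in> {0..T} \<times> UNIV \<Longrightarrow> f z0 \<le> f z + e * D z0 z"
    using ekeland_variational_principle[of D "{0..T} \<times> UNIV" B f z1 e, OF D0 Dtri bdd complD z1 e] by blast
  show ?thesis
  proof (rule that[of "fst z0" "snd z0"])
    show "f (fst z0, snd z0) \<le> f (t, x) + e * (\<bar>t - fst z0\<bar> + d (snd z0) x)" if "0 \<le> t" "t \<le> T" for t x
      using z0(3)[of "(t, x)"] that by (simp add: D_def abs_minus_commute)
  qed (use z0 in \<open>auto simp: mem_Times_iff\<close>)
qed

lemma comparison: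
  assumes compl: "complete_Finsler A F" and h: "normalized_bump (h :: 'b \<Rightarrow> real)"
    and super: "\<And>t x \<alpha> \<Delta>. t > 0 \<Longrightarrow> (\<alpha>, \<Delta>) \<in> subdifferential A v (t, x) \<Longrightarrow> 0 \<le> \<alpha> + H (t, x, dual_norm A F x \<Delta>)"
    and sub: "\<And>t x \<alpha> \<Delta>. t > 0 \<Longrightarrow> (\<alpha>, \<Delta>) \<in> superdifferential A u (t, x) \<Longrightarrow> \<alpha> + H (t, x, dual_norm A F x \<Delta>) \<le> 0"
    and lsc: "seq_lsc ({0..} \<times> UNIV) v" "seq_lsc ({0..} \<times> UNIV) (\<lambda>z. - u z)"
    and bd: "\<And>T. T > 0 \<Longrightarrow> bounded (u ` ({0..<T} \<times> UNIV))" "\<And>T. T > 0 \<Longrightarrow> bounded (v ` ({0..<T} \<times> UNIV))"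
    and Lip: "\<And>t x. t > 0 \<Longrightarrow> Lipschitz_near A F u (t, x) \<or> Lipschitz_near A F v (t, x)"
    and HA: "condition_A A F H"
    and init: "\<And>x. u (0, x) - v (0, x) \<le> \<kappa>" and ts: "ts \<ge> 0"
  shows "u (ts, xs) - v (ts, xs) \<le> \<kappa>"
proof (rule ccontr)
  assume neg: "\<not> u (ts, xs) - v (ts, xs) \<le> \<kappa>"
  \<comment> \<open>Half of the excess: one half pays for the barrier
    \<open>\<delta> / (T - t)\<close> at the starting point, the other keeps the value there below
    \<open>- \<kappa>\<close>.\<close>
  define \<delta> where "\<delta> = (u (ts, xs) - v (ts, xs) - \<kappa>) / 2"
  have \<delta>: "\<delta> > 0" "v (ts, xs) - u (ts, xs) = - \<kappa> - 2 * \<delta>" using neg by (auto simp: \<delta>_def field_simps)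
  \<comment> \<open>With \<open>T - ts = 1\<close> the barrier contributes exactly
    \<open>\<delta>\<close> at the starting point, so
    \<open>f (ts, xs) = - \<kappa> - \<delta>\<close>.\<close>
  define T where "T = ts + 1"
  have T: "T > 0" using ts by (simp add: T_def)
  obtain M1 where M1: "\<And>z. z \<in> {0..<T} \<times> UNIV \<Longrightarrow> \<bar>u z\<bar> \<le> M1"
    using bd(1)[OF T] unfolding bounded_iff by auto
  obtain M2 where M2: "\<And>z. z \<in> {0..<T} \<times> UNIV \<Longrightarrow> \<bar>v z\<bar> \<le> M2"
    using bd(2)[OF T] unfolding bounded_iff by auto
  define M where "M = max M1 M2"
  have M: "\<bar>u (t, x)\<bar> \<le> M \<and> \<bar>v (t, x)\<bar> \<le> M" if "0 \<le> t" "t < T" for t x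
    using M1[of "(t, x)"] M2[of "(t, x)"] that by (auto simp: M_def)
  have M0: "M \<ge> 0" using M[of ts xs] ts unfolding T_def by linarith
  \<comment> \<open>At time \<open>T - r\<close> the barrier is at least
    \<open>4 * M + \<delta> + 1\<close>, so \<open>f\<close> is at least
    \<open>2 * M + \<delta> + 1\<close> there, while its starting value is at most
    \<open>2 * M + \<delta>\<close>. The bound 1/2 leaves \<open>ts\<close> below
    \<open>T - r\<close>.\<close>
  define r where "r = min (1 / 2) (\<delta> / (4 * M + \<delta> + 1))"
  have r: "0 < r" "r \<le> 1 / 2"
  proof -
    show "0 < r" using \<delta>(1) M0 by (simp add: r_def)
    show "r \<le> 1 / 2" unfolding r_def by (rule min.cobounded1)
  qed
  have r\<delta>: "4 * M + \<delta> + 1 \<le> \<delta> / r"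
  proof -
    have "r \<le> \<delta> / (4 * M + \<delta> + 1)" by (simp add: r_def)
    then have "(4 * M + \<delta> + 1) * r \<le> \<delta>" using M0 \<delta> by (simp add: pos_le_divide_eq mult.commute)
    then show ?thesis using r(1) by (simp add: pos_le_divide_eq)
  qed
  \<comment> \<open>Stopping short of \<open>T\<close> gives a closed time interval on which the
    barrier is Lipschitz and \<open>u\<close> and \<open>v\<close> are bounded.\<close>
  define T' where "T' = T - r"
  have T': "0 < T'" "T' < T" "ts < T'" using r ts by (auto simp: T'_def T_def)
  define \<theta> where "\<theta> t = \<delta> / (T - t)" for t
  \<comment> \<open>The derivative \<open>\<delta> / (T - t)^2\<close> of the barrier is smallest at
    time 0; this value measures by how much the two viscosity inequalities will contradict each
    other.\<close>
  define \<sigma> where "\<sigma> = \<delta> / T\<^sup>2"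
  have \<sigma>: "\<sigma> > 0" using \<delta> T by (simp add: \<sigma>_def)
  have \<theta>d: "(\<theta> has_real_derivative \<delta> / (T - t)\<^sup>2) (at t)" "\<sigma> \<le> \<delta> / (T - t)\<^sup>2" if t: "0 < t" "t < T'" for t
  proof -
    have "T - t > 0" "T - t \<le> T" using t T' by auto
    then show "(\<theta> has_real_derivative \<delta> / (T - t)\<^sup>2) (at t)"
      unfolding \<theta>_def by (auto intro!: derivative_eq_intros simp: power2_eq_square)
    have "(T - t)\<^sup>2 \<le> T\<^sup>2" using \<open>T - t > 0\<close> \<open>T - t \<le> T\<close> by (intro power_mono) auto
    then show "\<sigma> \<le> \<delta> / (T - t)\<^sup>2" unfolding \<sigma>_def using \<delta>(1) \<open>T - t > 0\<close> by (intro frac_le) auto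
  qed
  have \<theta>L: "\<bar>\<theta> s - \<theta> t\<bar> \<le> (\<delta> / (r * r)) * \<bar>s - t\<bar>" if "0 \<le> s" "s \<le> T'" "0 \<le> t" "t \<le> T'" for s t
  proof -
    have b: "r \<le> T - s" "r \<le> T - t" using that by (auto simp: T'_def)
    have "\<theta> s - \<theta> t = \<delta> * (s - t) / ((T - s) * (T - t))"
      using b r(1) unfolding \<theta>_def by (simp add: field_simps)
    then have "\<bar>\<theta> s - \<theta> t\<bar> = \<delta> * \<bar>s - t\<bar> / ((T - s) * (T - t))"
      using b r(1) \<delta> by (simp add: abs_mult)
    also have "\<dots> \<le> \<delta> * \<bar>s - t\<bar> / (r * r)"
      using b r(1) \<delta> by (intro divide_left_mono mult_mono) auto
    finally show ?thesis by simp
  qed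
  obtain C \<omega> where C: "C \<ge> 0" and \<omega>c: "continuous_on ({0..} \<times> UNIV \<times> UNIV) \<omega>" "\<omega> (0::real, 0::real, 0::real) = (0::real)"
    and H: "\<And>t1 t2 x1 x2 r1 r2. 0 \<le> t1 \<Longrightarrow> 0 \<le> t2 \<Longrightarrow> \<bar>H (t1, x1, r1) - H (t2, x2, r2)\<bar> \<le>
       \<omega> (\<bar>t1 - t2\<bar>, d x1 x2, r1 - r2) + C * max \<bar>r1\<bar> \<bar>r2\<bar> * (\<bar>t1 - t2\<bar> + d x1 x2)"
  proof -
    from HA obtain C \<omega> where C\<omega>: "C \<ge> 0" "continuous_on ({0..} \<times> UNIV \<times> UNIV) \<omega>" "\<omega> (0::real, 0::real, 0::real) = (0::real)"
      and H: "\<forall>t\<^sub>1\<ge>0. \<forall>t\<^sub>2\<ge>0. \<forall>x\<^sub>1 x\<^sub>2 r\<^sub>1 r\<^sub>2. \<bar>H (t\<^sub>1, x\<^sub>1, r\<^sub>1) - H (t\<^sub>2, x\<^sub>2, r\<^sub>2)\<bar> \<le>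
         \<omega> (\<bar>t\<^sub>1 - t\<^sub>2\<bar>, d x\<^sub>1 x\<^sub>2, r\<^sub>1 - r\<^sub>2) + C * max \<bar>r\<^sub>1\<bar> \<bar>r\<^sub>2\<bar> * (\<bar>t\<^sub>1 - t\<^sub>2\<bar> + d x\<^sub>1 x\<^sub>2)"
      unfolding condition_A_def by (elim exE conjE)
    show ?thesis by (rule that[OF C\<omega> H[rule_format]])
  qed
  have s4: "\<sigma> / 4 > 0" using \<sigma> by simp
  have z: "(0 :: real, 0 :: real, 0 :: real) \<in> {0..} \<times> UNIV \<times> UNIV" by simp
  obtain \<rho> where \<rho>: "\<rho> > 0" and
    \<rho>': "\<forall>z\<in>{0..} \<times> UNIV \<times> UNIV. dist z (0, 0, 0) < \<rho> \<longrightarrow> dist (\<omega> z) (\<omega> (0, 0, 0)) < \<sigma> / 4"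
    using mp[OF spec[OF bspec[OF \<omega>c(1)[unfolded continuous_on_iff] z]] s4] by (elim exE conjE)
  \<comment> \<open>Three coordinates of size at most \<open>\<rho> / 4\<close> have joint norm
    below \<open>\<rho>\<close>.\<close>
  define \<tau> where "\<tau> = \<rho> / 4"
  have \<tau>: "\<tau> > 0" using \<rho> by (simp add: \<tau>_def)
  have \<omega>: "\<omega> (a, b, c) \<le> \<sigma> / 4" if "0 \<le> a" "a \<le> \<tau>" "\<bar>b\<bar> \<le> \<tau>" "\<bar>c\<bar> \<le> \<tau>" for a b c
  proof -
    have "norm (a, b, c) \<le> \<bar>a\<bar> + (\<bar>b\<bar> + \<bar>c\<bar>)"
      using norm_Pair_le[of a "(b, c)"] norm_Pair_le[of b c] by simp
    also have "\<dots> < \<rho>" using that \<tau> by (simp add: \<tau>_def)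
    finally have "dist (a, b, c) (0, 0, 0) < \<rho>" by (simp add: dist_norm)
    moreover have "(a, b, c) \<in> {0..} \<times> UNIV \<times> UNIV" using that by simp
    ultimately have "dist (\<omega> (a, b, c)) (\<omega> (0, 0, 0)) < \<sigma> / 4" using \<rho>' by (simp only: Ball_def)
    then show ?thesis using \<omega>c(2) by (simp add: dist_real_def)
  qed
  define \<epsilon> where "\<epsilon> = min (\<tau> / 16) (\<sigma> / 16)"
  have \<epsilon>: "\<epsilon> > 0" "16 * \<epsilon> \<le> \<tau>" "16 * \<epsilon> \<le> \<sigma>" using \<tau> \<sigma> by (auto simp: \<epsilon>_def)
  define f where "f z = v z + (- u z + \<theta> (fst z))" for z
  have sub0: "{0..T'} \<times> UNIV \<subseteq> {0..} \<times> (UNIV :: 'm set)" by auto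
  have "continuous_on ({0..T'} \<times> (UNIV :: 'm set)) (\<lambda>z. \<theta> (fst z))"
    unfolding \<theta>_def using T' by (intro continuous_intros) auto
  then have lscf: "seq_lsc ({0..T'} \<times> UNIV) f"
    unfolding f_def by (intro seq_lsc_add seq_lsc_continuous seq_lsc_subset[OF lsc(1) sub0] seq_lsc_subset[OF lsc(2) sub0])
  have \<theta>0: "0 \<le> \<theta> t" if "t < T" for t using that \<delta> by (simp add: \<theta>_def)
  have fb: "- 2 * M \<le> f z" if "z \<in> {0..T'} \<times> UNIV" for z
    using M[of "fst z" "snd z"] \<theta>0[of "fst z"] that T' by (auto simp: f_def mem_Times_iff)
  have start: "(ts, xs) \<in> {0..T'} \<times> UNIV" using ts T' by simp
  obtain t0 x0 where z0: "0 \<le> t0" "t0 \<le> T'" "f (t0, x0) \<le> f (ts, xs)"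
    "\<And>t x. 0 \<le> t \<Longrightarrow> t \<le> T' \<Longrightarrow> f (t0, x0) \<le> f (t, x) + \<epsilon> * (\<bar>t - t0\<bar> + d x0 x)"
    using ekeland_space_time[OF compl lscf fb start \<epsilon>(1)] by blast
  have fs: "f (ts, xs) = - \<kappa> - \<delta>" using \<delta>(2) by (simp add: f_def \<theta>_def T_def)
  \<comment> \<open>The initial condition gives \<open>f \<ge> - \<kappa>\<close> at time 0, above
    the starting value \<open>- \<kappa> - \<delta>\<close>.\<close>
  have "t0 \<noteq> 0"
  proof
    assume "t0 = 0"
    then have "- \<kappa> \<le> f (t0, x0)" using init[of x0] \<theta>0[of 0] T by (simp add: f_def)
    then show False using z0(3) fs \<delta>(1) by linarith
  qed
  moreover have "t0 \<noteq> T'"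
  proof
    assume "t0 = T'"
    then have "f (t0, x0) = v (T', x0) - u (T', x0) + \<delta> / r" by (simp add: f_def \<theta>_def T'_def)
    then have "- 2 * M + (4 * M + \<delta> + 1) \<le> f (t0, x0)" using M[of T' x0] T' r\<delta> by linarith
    moreover have "f (ts, xs) = v (ts, xs) - u (ts, xs) + \<delta>" by (simp add: f_def \<theta>_def T_def)
    moreover have "\<bar>u (ts, xs)\<bar> \<le> M \<and> \<bar>v (ts, xs)\<bar> \<le> M" using M ts by (simp add: T_def)
    ultimately show False using z0(3) by linarith
  qed
  ultimately have t0: "0 < t0" "t0 < T'" using z0(1,2) by auto
  show False
  proof (rule no_approximate_touching_point[where v=v and u=u and H=H and \<omega>=\<omega> and \<theta>=\<theta> and
        \<theta>'="\<lambda>t. \<delta> / (T - t)\<^sup>2" and T=T', OF h super sub lsc _ Lip[OF t0(1)] C H \<omega> \<tau> \<theta>d \<theta>L _ t0 \<sigma> \<epsilon>])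
    show "\<bar>u (t, x)\<bar> \<le> M \<and> \<bar>v (t, x)\<bar> \<le> M" if "0 \<le> t" "t \<le> T'" for t x using M that T' by simp
    show "0 \<le> \<delta> / (r * r)" using \<delta> r by simp
    show "v (t0, x0) - u (t0, x0) + \<theta> t0 \<le> v (t, x) - u (t, x) + \<theta> t + \<epsilon> * (\<bar>t - t0\<bar> + d x0 x)"
      if "0 \<le> t" "t \<le> T'" for t x using z0(4)[OF that, of x] by (simp add: f_def)
  qed
qed

end

section \<open>Passage to suprema in the extended reals\<close>

theorem proposition5p6:
  fixes A :: "('m::t2_space, 'b::banach) chart set"
    and F :: "'m \<Rightarrow> ('m, 'b) tangent \<Rightarrow> real"
    and H\<^sub>1 H\<^sub>2 :: "real \<times> 'm \<times> real \<Rightarrow> real"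
    and h\<^sub>1 h\<^sub>2 :: "'m \<Rightarrow> real"
    and u v :: "real \<times> 'm \<Rightarrow> real"
  assumes "C1_Finsler_manifold A F"
    and "complete_Finsler A F"
    and "\<exists>b :: 'b \<Rightarrow> real. C1_Lipschitz_bump b"
    and "continuous_on ({0..} \<times> UNIV \<times> UNIV) H\<^sub>1" and "condition_A A F H\<^sub>1"
    and "continuous_on ({0..} \<times> UNIV \<times> UNIV) H\<^sub>2" and "condition_A A F H\<^sub>2"
    and "\<And>t x r. t \<ge> 0 \<Longrightarrow> H\<^sub>1 (t, x, r) \<le> H\<^sub>2 (t, x, r)"
    and "continuous_on UNIV h\<^sub>1" and "bounded (range h\<^sub>1)"
    and "continuous_on UNIV h\<^sub>2" and "bounded (range h\<^sub>2)"
    and "\<And>x. h\<^sub>2 x \<le> h\<^sub>1 x"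
    and "viscosity_supersolution A F H\<^sub>1 h\<^sub>1 v"
    and "viscosity_subsolution A F H\<^sub>2 h\<^sub>2 u"
    and "\<And>T. T > 0 \<Longrightarrow> bounded (u ` ({0..<T} \<times> UNIV))"
    and "\<And>T. T > 0 \<Longrightarrow> bounded (v ` ({0..<T} \<times> UNIV))"
    and "\<And>t x. t > 0 \<Longrightarrow> Lipschitz_near A F u (t, x) \<or> Lipschitz_near A F v (t, x)"
  shows "(SUP p \<in> {0..} \<times> UNIV. ereal (u p - v p)) \<le>
         (SUP p \<in> {0..} \<times> UNIV \<times> UNIV. ereal (H\<^sub>2 p - H\<^sub>1 p)) + (SUP x. ereal (h\<^sub>2 x - h\<^sub>1 x))"
proof -
  interpret C1_Finsler_manifold A F by (rule assms(1))
  obtain b :: "'b \<Rightarrow> real" where "C1_Lipschitz_bump b" using assms(3) by blast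
  then obtain h :: "'b \<Rightarrow> real" where h: "normalized_bump h" by (rule normalized_bump_exists)
  define k where "k = (SUP x. ereal (h\<^sub>2 x - h\<^sub>1 x))"
  have k_ge: "ereal (h\<^sub>2 x - h\<^sub>1 x) \<le> k" for x unfolding k_def by (rule SUP_upper) simp
  \<comment> \<open>A supremum of nonpositive reals over the nonempty M is finite, so comparison
    applies with a real bound; \<open>undefined\<close> merely serves as some point of M.\<close>
  have "k \<le> 0" unfolding k_def by (rule SUP_least) (simp add: assms(13))
  moreover have "k \<noteq> - \<infinity>" using k_ge[of undefined] by auto
  ultimately obtain \<kappa> where \<kappa>: "k = ereal \<kappa>" by (cases k) auto
  note v = assms(14)[unfolded viscosity_supersolution_def]
  note u = assms(15)[unfolded viscosity_subsolution_def]
  have super: "0 \<le> \<alpha> + H\<^sub>1 (t, x, dual_norm A F x \<Delta>)"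
    if "t > 0" "(\<alpha>, \<Delta>) \<in> subdifferential A v (t, x)" for t x \<alpha> \<Delta>
    using v that by fastforce
  have sub: "\<alpha> + H\<^sub>1 (t, x, dual_norm A F x \<Delta>) \<le> 0"
    if "t > 0" "(\<alpha>, \<Delta>) \<in> superdifferential A u (t, x)" for t x \<alpha> \<Delta>
  proof -
    have "\<alpha> + H\<^sub>2 (t, x, dual_norm A F x \<Delta>) \<le> 0" using u that by fastforce
    moreover have "H\<^sub>1 (t, x, dual_norm A F x \<Delta>) \<le> H\<^sub>2 (t, x, dual_norm A F x \<Delta>)"
      using that by (intro assms(8)) simp
    ultimately show ?thesis by linarith
  qed
  have init: "u (0, x) - v (0, x) \<le> \<kappa>" for x
  proof -
    have "h\<^sub>2 x - h\<^sub>1 x \<le> \<kappa>" using k_ge[of x] by (simp add: \<kappa>)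
    moreover have "u (0, x) \<le> h\<^sub>2 x" "h\<^sub>1 x \<le> v (0, x)" using u v by blast+
    ultimately show ?thesis by linarith
  qed
  have lsc: "seq_lsc ({0..} \<times> UNIV) v" "seq_lsc ({0..} \<times> UNIV) (\<lambda>z. - u z)"
    using lower_semicontinuous_seq_lsc upper_semicontinuous_seq_lsc u v by blast+
  have main: "u (t, x) - v (t, x) \<le> \<kappa>" if "t \<ge> 0" for t x
    by (rule comparison[OF assms(2) h super sub lsc assms(16,17,18,5) init that])
  \<comment> \<open>This supremum may be infinite, so it enters only through its sign; adding
    \<open>k\<close> preserves the inequality in the extended reals.\<close>
  have "0 \<le> (SUP p \<in> {0..} \<times> UNIV \<times> UNIV. ereal (H\<^sub>2 p - H\<^sub>1 p))"
    by (rule SUP_upper2[of "(0, undefined, 0)"]) (simp_all add: assms(8))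
  then have "0 + k \<le> (SUP p \<in> {0..} \<times> UNIV \<times> UNIV. ereal (H\<^sub>2 p - H\<^sub>1 p)) + k"
    by (rule add_right_mono)
  moreover have "(SUP p \<in> {0..} \<times> UNIV. ereal (u p - v p)) \<le> k"
    unfolding \<kappa> by (rule SUP_least) (use main in auto)
  ultimately show ?thesis unfolding k_def by simp
qed

end
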